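(* Let $r_1,r_2$ be positive constants with $r_1^2+r_2^2=1$, and consider the flat torus in $S^3$ parametrized by $$X(u_1,u_2)=(r_1\cos(r_2u_1),\,r_1\sin(r_2u_1),\,r_2\cos(r_1u_2),\,r_2\sin(r_1u_2)),\qquad (u_1,u_2)\in\mathbb R^2,$$ whose first fundamental form is $I=r_1^2r_2^2(du_1^2+du_2^2)$. A parametrized surface $\widetilde X(u_1,u_2)$ is a flat surface locally associated to $X$ by a Ribaucour transformation satisfying the additional relation $\Omega_1^2+\Omega_2^2=c(\Omega^2+W^2)$ with a constant $c>0$ (as defined in the context) if and only if, up to isometries of $S^3$, it is given by $$\widetilde X=\frac1S\begin{pmatrix}(r_1S-2r_1\Omega^2-2r_2\Omega W)\cos(r_2u_1)+2f'\Omega\sin(r_2u_1)\\ (r_1S-2r_1\Omega^2-2r_2\Omega W)\sin(r_2u_1)-2f'\Omega\cos(r_2u_1)\\ (r_2S-2r_2\Omega^2+2r_1\Omega W)\cos(r_1u_2)+2g'\Omega\sin(r_1u_2)\\ (r_2S-2r_2\Omega^2+2r_1\Omega W)\sin(r_1u_2)-2g'\Omega\cos(r_1u_2)\end{pmatrix}$$ defined on $$V=\{(u_1,u_2)\in\mathbb R^2:\ (r_1^2g^2-r_2^2f^2-2r_2^2fg)(r_2^2f^2-r_1^2g^2-2r_1^2fg)\neq0\},$$ where $$\Omega=r_1r_2\big(f(u_1)+g(u_2)\big),\qquad W=r_2^2f(u_1)-r_1^2g(u_2),\qquad S=(1+c)(\Omega^2+W^2),$$ $c>0$, and the functions $f$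 and $g$ are given by one of the following: (i) $f(u_1)=\cosh(r_2\sqrt c\,u_1)$, $g(u_2)=\frac{r_2}{r_1}\sinh(r_1\sqrt c\,u_2)$; (ii) $f(u_1)=\sinh(r_2\sqrt c\,u_1)$, $g(u_2)=\frac{r_2}{r_1}\cosh(r_1\sqrt c\,u_2)$; (iii) $f(u_1)=a_1e^{\epsilon_1r_2\sqrt c\,u_1}$, $g(u_2)=b_1e^{\epsilon_2r_1\sqrt c\,u_2}$, with real constants $a_1,b_1\neq0$ and $\epsilon_1^2=\epsilon_2^2=1$. Moreover, the normal map of $\widetilde X$ is given by $$\widetilde N=\frac1S\begin{pmatrix}(-r_2S-2r_2W^2+2r_1\Omega W)\cos(r_2u_1)+2f'\Omega\sin(r_2u_1)\\ (-r_2S-2r_2W^2+2r_1\Omega W)\sin(r_2u_1)-2f'\Omega\cos(r_2u_1)\\ (r_1S+2r_1W^2-2r_2\Omega W)\cos(r_1u_2)+2g'\Omega\sin(r_1u_2)\\ (r_1S+2r_1W^2-2r_2\Omega W)\sin(r_1u_2)-2g'\Omega\cos(r_1u_2)\end{pmatrix}.$$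
   Context: $S^3$ is the unit sphere in $\mathbb R^4$. A surface in $S^3$ is flat if its induced metric has Gaussian curvature $0$. A comma followed by an index $i$ denotes $\partial/\partial u_i$. The normal map of a surface in $S^3$ is its unit normal field tangent to $S^3$. For the torus $X$ put $e_i=X_{,i}/(r_1r_2)$ for $i=1,2$ (orthonormal principal directions), let $N=(-r_2\cos(r_2u_1),-r_2\sin(r_2u_1),r_1\cos(r_1u_2),r_1\sin(r_1u_2))$ be the unit normal field, and let $\lambda_1=-r_2/r_1$, $\lambda_2=r_1/r_2$, so that the principal curvatures are $-\lambda_1,-\lambda_2$ and $N_{,i}=\lambda_iX_{,i}$. A parametrized surface $\widetilde X$ is locally associated to $X$ by a Ribaucour transformation if there are differentiable functions $W,\Omega,\Omega_1,\Omega_2$ of $(u_1,u_2)$ satisfying $\Omega_{i,j}=0$ for $i\neq j$ (where $\Omega_{i,j}=\partial\Omega_i/\partial u_j$), $\Omega_{,i}=r_1r_2\Omega_i$, $W_{,i}=-r_1r_2\lambda_i\Omega_i$ for $i=1,2$, and $W(W+\lambda_i\Omega)\neq0$ for $i=1,2$, such that $$\widetilde X=\Big(1-\frac{2\Omega^2}{S}\Big)X-\frac{2\Omega}{S}\big(\Omega_1e_1+\Omega_2e_2-WN\big),\qquad S=\Omega_1^2+\Omega_2^2+W^2+\Omega^2 .$$ In the theorem it is moreover assumed that the function $h=\Omega/W$ is not constant along the lines of curvature and that the additional relation $\Omega_1^2+\Omega_2^2=c(\Omega^2+W^2)$ holds with a constant $c>0$.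
   Formalization: The printed normal map is not unit (squared length 1+4c/(1+c)² where W=0); it is corrected to N+(2W/S)(ΩX+Ω₁e₁+Ω₂e₂−WN). Association is claimed only where W(W+λ_iΩ)≠0; isometries, with shifts/reflections of u₁,u₂, must preserve X. *)

theory Defs
  imports "HOL-Analysis.Analysis"
begin

section \<open>Parametrized surfaces in the unit sphere of R^4\<close>

text \<open>A parametrized surface is a map on the parameter plane \<^typ>\<open>real \<times> real\<close> together with the
  open set \<open>D\<close> of parameters on which it is considered; its values off \<open>D\<close> are irrelevant.\<close>

definition pd :: "nat \<Rightarrow> (real \<times> real \<Rightarrow> 'a::real_normed_vector) \<Rightarrow> real \<times> real \<Rightarrow> 'a" where
  "pd i X u = (if i = 1 then vector_derivative (\<lambda>t. X (t, snd u)) (at (fst u))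
               else vector_derivative (\<lambda>t. X (fst u, t)) (at (snd u)))"

text \<open>\<open>ck_on (Suc k)\<close> asks for Frechet differentiability on \<open>D\<close> and for partial derivatives
  satisfying \<open>ck_on k\<close>; on an open set this is the usual class \<open>C\<^sup>k\<close>.\<close>

primrec ck_on :: "nat \<Rightarrow> (real \<times> real) set \<Rightarrow> (real \<times> real \<Rightarrow> 'a::real_normed_vector) \<Rightarrow> bool" where
  "ck_on 0 D X \<longleftrightarrow> continuous_on D X"
| "ck_on (Suc k) D X \<longleftrightarrow> (\<forall>u\<in>D. X differentiable (at u)) \<and> ck_on k D (pd 1 X) \<and> ck_on k D (pd 2 X)"

definition smooth_on :: "(real \<times> real) set \<Rightarrow> (real \<times> real \<Rightarrow> 'a::real_normed_vector) \<Rightarrow> bool" where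
  "smooth_on D X \<longleftrightarrow> (\<forall>k. ck_on k D X)"

definition regular_surface :: "(real \<times> real) set \<Rightarrow> (real \<times> real \<Rightarrow> real^4) \<Rightarrow> bool" where
  "regular_surface D X \<longleftrightarrow> smooth_on D X \<and> X ` D \<subseteq> sphere 0 1 \<and>
     (\<forall>u\<in>D. \<forall>a b. a *\<^sub>R pd 1 X u + b *\<^sub>R pd 2 X u = 0 \<longrightarrow> a = 0 \<and> b = 0)"

definition metric :: "(real \<times> real \<Rightarrow> real^4) \<Rightarrow> nat \<Rightarrow> nat \<Rightarrow> real \<times> real \<Rightarrow> real" where
  "metric X i j u = pd i X u \<bullet> pd j X u"

definition metric_det :: "(real \<times> real \<Rightarrow> real^4) \<Rightarrow> real \<times> real \<Rightarrow> real" where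
  "metric_det X u = metric X 1 1 u * metric X 2 2 u - (metric X 1 2 u)\<^sup>2"

definition inv_metric :: "(real \<times> real \<Rightarrow> real^4) \<Rightarrow> nat \<Rightarrow> nat \<Rightarrow> real \<times> real \<Rightarrow> real" where
  "inv_metric X i j u = (if i = j then metric X (3 - i) (3 - i) u else - metric X 1 2 u) / metric_det X u"

definition christoffel :: "(real \<times> real \<Rightarrow> real^4) \<Rightarrow> nat \<Rightarrow> nat \<Rightarrow> nat \<Rightarrow> real \<times> real \<Rightarrow> real" where
  "christoffel X k i j u =
     (\<Sum>l\<in>{1,2}. inv_metric X k l u *
        (pd i (metric X j l) u + pd j (metric X i l) u - pd l (metric X i j) u)) / 2"

text \<open>\<open>curv_comp X l\<close> is the \<open>l\<close>-th component of \<open>R(\<partial>\<^sub>1,\<partial>\<^sub>2)\<partial>\<^sub>2 = \<nabla>\<^sub>1\<nabla>\<^sub>2\<partial>\<^sub>2 - \<nabla>\<^sub>2\<nabla>\<^sub>1\<partial>\<^sub>2\<close>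
  for the Levi-Civita connection of the induced metric, so that
  \<open>K = \<langle>R(\<partial>\<^sub>1,\<partial>\<^sub>2)\<partial>\<^sub>2,\<partial>\<^sub>1\<rangle> / (EG - F\<^sup>2)\<close>.\<close>

definition curv_comp :: "(real \<times> real \<Rightarrow> real^4) \<Rightarrow> nat \<Rightarrow> real \<times> real \<Rightarrow> real" where
  "curv_comp X l u = pd 1 (christoffel X l 2 2) u - pd 2 (christoffel X l 1 2) u
     + (\<Sum>m\<in>{1,2}. christoffel X m 2 2 u * christoffel X l 1 m u
                   - christoffel X m 1 2 u * christoffel X l 2 m u)"

definition gauss_curvature :: "(real \<times> real \<Rightarrow> real^4) \<Rightarrow> real \<times> real \<Rightarrow> real" where
  "gauss_curvature X u = (\<Sum>l\<in>{1,2}. curv_comp X l u * metric X l 1 u) / metric_det X u"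

definition flat_surface :: "(real \<times> real) set \<Rightarrow> (real \<times> real \<Rightarrow> real^4) \<Rightarrow> bool" where
  "flat_surface D X \<longleftrightarrow> regular_surface D X \<and> (\<forall>u\<in>D. gauss_curvature X u = 0)"

definition normal_map :: "(real \<times> real) set \<Rightarrow> (real \<times> real \<Rightarrow> real^4) \<Rightarrow> (real \<times> real \<Rightarrow> real^4) \<Rightarrow> bool" where
  "normal_map D X N \<longleftrightarrow> smooth_on D N \<and>
     (\<forall>u\<in>D. norm (N u) = 1 \<and> N u \<bullet> X u = 0 \<and> N u \<bullet> pd 1 X u = 0 \<and> N u \<bullet> pd 2 X u = 0)"


section \<open>The flat torus and its Ribaucour transformations\<close>

definition torus :: "real \<Rightarrow> real \<Rightarrow> real \<times> real \<Rightarrow> real^4" where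
  "torus r1 r2 = (\<lambda>(u1, u2). vector [r1 * cos (r2 * u1), r1 * sin (r2 * u1),
                                      r2 * cos (r1 * u2), r2 * sin (r1 * u2)])"

definition torus_normal :: "real \<Rightarrow> real \<Rightarrow> real \<times> real \<Rightarrow> real^4" where
  "torus_normal r1 r2 = (\<lambda>(u1, u2). vector [- r2 * cos (r2 * u1), - r2 * sin (r2 * u1),
                                             r1 * cos (r1 * u2), r1 * sin (r1 * u2)])"

definition torus_frame :: "real \<Rightarrow> real \<Rightarrow> nat \<Rightarrow> real \<times> real \<Rightarrow> real^4" where
  "torus_frame r1 r2 i u = (1 / (r1 * r2)) *\<^sub>R pd i (torus r1 r2) u"

definition lam :: "real \<Rightarrow> real \<Rightarrow> nat \<Rightarrow> real" where
  "lam r1 r2 i = (if i = 1 then - r2 / r1 else r1 / r2)"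

definition nondegenerate_at ::
  "real \<Rightarrow> real \<Rightarrow> (real \<times> real \<Rightarrow> real) \<Rightarrow> (real \<times> real \<Rightarrow> real) \<Rightarrow> real \<times> real \<Rightarrow> bool" where
  "nondegenerate_at r1 r2 Om W u \<longleftrightarrow> (\<forall>i\<in>{1,2}. W u * (W u + lam r1 r2 i * Om u) \<noteq> 0)"

text \<open>The functions \<open>Om\<close>, \<open>om 1\<close>, \<open>om 2\<close>, \<open>W\<close> stand for \<open>\<Omega>\<close>, \<open>\<Omega>\<^sub>1\<close>, \<open>\<Omega>\<^sub>2\<close>, \<open>W\<close>.\<close>

definition ribaucour_data ::
  "real \<Rightarrow> real \<Rightarrow> (real \<times> real) set \<Rightarrow> (real \<times> real \<Rightarrow> real) \<Rightarrow> (real \<times> real \<Rightarrow> real)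
     \<Rightarrow> (nat \<Rightarrow> real \<times> real \<Rightarrow> real) \<Rightarrow> bool" where
  "ribaucour_data r1 r2 D W Om om \<longleftrightarrow> (\<forall>u\<in>D.
     W differentiable (at u) \<and> Om differentiable (at u) \<and>
     (\<forall>i\<in>{1,2}. om i differentiable (at u)) \<and>
     (\<forall>i\<in>{1,2}. \<forall>j\<in>{1,2}. i \<noteq> j \<longrightarrow> pd j (om i) u = 0) \<and>
     (\<forall>i\<in>{1,2}. pd i Om u = r1 * r2 * om i u) \<and>
     (\<forall>i\<in>{1,2}. pd i W u = - r1 * r2 * lam r1 r2 i * om i u) \<and>
     nondegenerate_at r1 r2 Om W u)"

definition ribaucour_transform ::
  "real \<Rightarrow> real \<Rightarrow> (real \<times> real \<Rightarrow> real) \<Rightarrow> (real \<times> real \<Rightarrow> real)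
     \<Rightarrow> (nat \<Rightarrow> real \<times> real \<Rightarrow> real) \<Rightarrow> real \<times> real \<Rightarrow> real^4" where
  "ribaucour_transform r1 r2 W Om om u =
     (let S = (om 1 u)\<^sup>2 + (om 2 u)\<^sup>2 + (W u)\<^sup>2 + (Om u)\<^sup>2
      in (1 - 2 * (Om u)\<^sup>2 / S) *\<^sub>R torus r1 r2 u
         - (2 * Om u / S) *\<^sub>R (om 1 u *\<^sub>R torus_frame r1 r2 1 u + om 2 u *\<^sub>R torus_frame r1 r2 2 u
                             - W u *\<^sub>R torus_normal r1 r2 u))"

text \<open>The lines of curvature of the torus are its coordinate curves.\<close>

definition nonconstant_along_curvature_lines :: "(real \<times> real) set \<Rightarrow> (real \<times> real \<Rightarrow> real) \<Rightarrow> bool" where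
  "nonconstant_along_curvature_lines D h \<longleftrightarrow> (\<forall>u\<in>D.
     \<not> (\<lambda>t. h (t, snd u)) constant_on {t. (t, snd u) \<in> D} \<and>
     \<not> (\<lambda>t. h (fst u, t)) constant_on {t. (fst u, t) \<in> D})"

definition ribaucour_associated ::
  "real \<Rightarrow> real \<Rightarrow> real \<Rightarrow> (real \<times> real) set \<Rightarrow> (real \<times> real \<Rightarrow> real^4) \<Rightarrow> bool" where
  "ribaucour_associated r1 r2 c D Xt \<longleftrightarrow> (\<exists>W Om om.
     ribaucour_data r1 r2 D W Om om \<and>
     (\<forall>u\<in>D. Xt u = ribaucour_transform r1 r2 W Om om u) \<and>
     nonconstant_along_curvature_lines D (\<lambda>u. Om u / W u) \<and>
     (\<forall>u\<in>D. (om 1 u)\<^sup>2 + (om 2 u)\<^sup>2 = c * ((Om u)\<^sup>2 + (W u)\<^sup>2)))"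


section \<open>The explicit family\<close>

definition flat_family :: "real \<Rightarrow> real \<Rightarrow> real \<Rightarrow> (real \<Rightarrow> real) \<Rightarrow> (real \<Rightarrow> real) \<Rightarrow> bool" where
  "flat_family r1 r2 c f g \<longleftrightarrow>
     f = (\<lambda>t. cosh (r2 * sqrt c * t)) \<and> g = (\<lambda>t. r2 / r1 * sinh (r1 * sqrt c * t)) \<or>
     f = (\<lambda>t. sinh (r2 * sqrt c * t)) \<and> g = (\<lambda>t. r2 / r1 * cosh (r1 * sqrt c * t)) \<or>
     (\<exists>a1 b1 \<epsilon>1 \<epsilon>2. a1 \<noteq> 0 \<and> b1 \<noteq> 0 \<and> \<epsilon>1\<^sup>2 = 1 \<and> \<epsilon>2\<^sup>2 = 1 \<and>
        f = (\<lambda>t. a1 * exp (\<epsilon>1 * r2 * sqrt c * t)) \<and> g = (\<lambda>t. b1 * exp (\<epsilon>2 * r1 * sqrt c * t)))"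

definition Omega :: "real \<Rightarrow> real \<Rightarrow> (real \<Rightarrow> real) \<Rightarrow> (real \<Rightarrow> real) \<Rightarrow> real \<times> real \<Rightarrow> real" where
  "Omega r1 r2 f g = (\<lambda>(u1, u2). r1 * r2 * (f u1 + g u2))"

definition Wfun :: "real \<Rightarrow> real \<Rightarrow> (real \<Rightarrow> real) \<Rightarrow> (real \<Rightarrow> real) \<Rightarrow> real \<times> real \<Rightarrow> real" where
  "Wfun r1 r2 f g = (\<lambda>(u1, u2). r2\<^sup>2 * f u1 - r1\<^sup>2 * g u2)"

definition Sfun :: "real \<Rightarrow> real \<Rightarrow> real \<Rightarrow> (real \<Rightarrow> real) \<Rightarrow> (real \<Rightarrow> real) \<Rightarrow> real \<times> real \<Rightarrow> real" where
  "Sfun r1 r2 c f g u = (1 + c) * ((Omega r1 r2 f g u)\<^sup>2 + (Wfun r1 r2 f g u)\<^sup>2)"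

definition Vset :: "real \<Rightarrow> real \<Rightarrow> (real \<Rightarrow> real) \<Rightarrow> (real \<Rightarrow> real) \<Rightarrow> (real \<times> real) set" where
  "Vset r1 r2 f g = {(u1, u2).
     (r1\<^sup>2 * (g u2)\<^sup>2 - r2\<^sup>2 * (f u1)\<^sup>2 - 2 * r2\<^sup>2 * f u1 * g u2)
     * (r2\<^sup>2 * (f u1)\<^sup>2 - r1\<^sup>2 * (g u2)\<^sup>2 - 2 * r1\<^sup>2 * f u1 * g u2) \<noteq> 0}"

definition Xtilde ::
  "real \<Rightarrow> real \<Rightarrow> real \<Rightarrow> (real \<Rightarrow> real) \<Rightarrow> (real \<Rightarrow> real) \<Rightarrow> real \<times> real \<Rightarrow> real^4" where
  "Xtilde r1 r2 c f g = (\<lambda>(u1, u2).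
     (let Om = Omega r1 r2 f g (u1, u2); W = Wfun r1 r2 f g (u1, u2); S = Sfun r1 r2 c f g (u1, u2);
          A = r1 * S - 2 * r1 * Om\<^sup>2 - 2 * r2 * Om * W;
          B = r2 * S - 2 * r2 * Om\<^sup>2 + 2 * r1 * Om * W
      in (1 / S) *\<^sub>R vector [A * cos (r2 * u1) + 2 * deriv f u1 * Om * sin (r2 * u1),
                             A * sin (r2 * u1) - 2 * deriv f u1 * Om * cos (r2 * u1),
                             B * cos (r1 * u2) + 2 * deriv g u2 * Om * sin (r1 * u2),
                             B * sin (r1 * u2) - 2 * deriv g u2 * Om * cos (r1 * u2)]))"

text \<open>This is \<open>N + (2W/S)(\<Omega>X + \<Omega>\<^sub>1e\<^sub>1 + \<Omega>\<^sub>2e\<^sub>2 - WN)\<close> written out, i.e. the image of \<open>N\<close> under the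
  reflection of R^4 that maps \<open>X\<close> to the transformed surface. The source prints
  \<open>-2r\<^sub>2W\<^sup>2\<close> in \<open>A\<close>, \<open>+2r\<^sub>1W\<^sup>2 - 2r\<^sub>2\<Omega>W\<close> in \<open>B\<close>, and \<open>\<Omega>\<close> in place of \<open>-W\<close> in the terms
  with \<open>f'\<close> and \<open>g'\<close>; with these misprints the vector is neither of unit length nor orthogonal
  to the surface.\<close>

definition Ntilde ::
  "real \<Rightarrow> real \<Rightarrow> real \<Rightarrow> (real \<Rightarrow> real) \<Rightarrow> (real \<Rightarrow> real) \<Rightarrow> real \<times> real \<Rightarrow> real^4" where
  "Ntilde r1 r2 c f g = (\<lambda>(u1, u2).
     (let Om = Omega r1 r2 f g (u1, u2); W = Wfun r1 r2 f g (u1, u2); S = Sfun r1 r2 c f g (u1, u2);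
          A = - r2 * S + 2 * r2 * W\<^sup>2 + 2 * r1 * Om * W;
          B = r1 * S - 2 * r1 * W\<^sup>2 + 2 * r2 * Om * W
      in (1 / S) *\<^sub>R vector [A * cos (r2 * u1) - 2 * deriv f u1 * W * sin (r2 * u1),
                             A * sin (r2 * u1) + 2 * deriv f u1 * W * cos (r2 * u1),
                             B * cos (r1 * u2) - 2 * deriv g u2 * W * sin (r1 * u2),
                             B * sin (r1 * u2) + 2 * deriv g u2 * W * cos (r1 * u2)]))"

text \<open>Isometries of the unit sphere are the restrictions of orthogonal transformations of R^4.
  Association to the torus \<open>X\<close> concerns the pair of parametrizations \<open>X\<close> and \<open>Xt\<close>, so ``up to
  isometries'' means: an isometry \<open>A\<close>, with a translation or reflection \<open>\<phi>\<close> of the coordinates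
  \<open>u\<^sub>1\<close>, \<open>u\<^sub>2\<close>, takes the pair \<open>(X, Y)\<close> to the pair \<open>(X, Xt)\<close>. The \<open>\<phi>\<close> is needed to
  normalize, say, \<open>f = cosh (r\<^sub>2 \<surd>c u\<^sub>1 + \<alpha>)\<close>; for an \<open>A\<close> that does not preserve \<open>X\<close> the surface
  \<open>A \<circ> Y\<close> is associated to the torus \<open>A \<circ> X\<close> rather than to \<open>X\<close>.\<close>

definition coord_change :: "(real \<times> real \<Rightarrow> real \<times> real) \<Rightarrow> bool" where
  "coord_change \<phi> \<longleftrightarrow> (\<exists>\<sigma>1 \<sigma>2 \<alpha>1 \<alpha>2. \<sigma>1\<^sup>2 = 1 \<and> \<sigma>2\<^sup>2 = 1 \<and>
     \<phi> = (\<lambda>(u1, u2). (\<sigma>1 * u1 + \<alpha>1, \<sigma>2 * u2 + \<alpha>2)))"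

definition torus_symmetry ::
  "real \<Rightarrow> real \<Rightarrow> (real^4 \<Rightarrow> real^4) \<Rightarrow> (real \<times> real \<Rightarrow> real \<times> real) \<Rightarrow> bool" where
  "torus_symmetry r1 r2 A \<phi> \<longleftrightarrow> orthogonal_transformation A \<and> coord_change \<phi> \<and>
     A \<circ> torus r1 r2 \<circ> \<phi> = torus r1 r2"

end

theory Submission
  imports Defs
begin

text \<open>Let \<open>C\<^sub>1, S\<^sub>1, C\<^sub>2, S\<^sub>2\<close> be the radial and tangential unit vectors of the two circle factors of
  the torus, so that \<open>X = r\<^sub>1 C\<^sub>1 + r\<^sub>2 C\<^sub>2\<close>, \<open>N = r\<^sub>1 C\<^sub>2 - r\<^sub>2 C\<^sub>1\<close>, \<open>e\<^sub>1 = S\<^sub>1\<close> and \<open>e\<^sub>2 = S\<^sub>2\<close>.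
  The linear system for \<open>\<Omega>\<close> and \<open>W\<close> decouples in the rotated unknowns
  \<open>r\<^sub>2 f = r\<^sub>1 \<Omega> + r\<^sub>2 W\<close> and \<open>r\<^sub>1 g = r\<^sub>2 \<Omega> - r\<^sub>1 W\<close>: it says that \<open>f\<close> depends on \<open>u\<^sub>1\<close> and \<open>g\<close> on \<open>u\<^sub>2\<close>
  alone, with \<open>\<Omega>\<^sub>1 = f'\<close> and \<open>\<Omega>\<^sub>2 = g'\<close>. Nondegeneracy becomes \<open>W, f, g \<noteq> 0\<close>, and the additional
  relation becomes \<open>f'\<^sup>2 + g'\<^sup>2 = c Q\<close> with \<open>Q = r\<^sub>2\<^sup>2 f\<^sup>2 + r\<^sub>1\<^sup>2 g\<^sup>2 = \<Omega>\<^sup>2 + W\<^sup>2\<close>.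

  \<^emph>\<open>From the functions to the surface.\<close> Assume \<open>f'' = c r\<^sub>2\<^sup>2 f\<close> and \<open>g'' = c r\<^sub>1\<^sup>2 g\<close> as well. The vector
  \<open>\<xi> = \<Omega>X + \<Omega>\<^sub>1e\<^sub>1 + \<Omega>\<^sub>2e\<^sub>2 - WN = r\<^sub>2 f C\<^sub>1 + f' S\<^sub>1 + r\<^sub>1 g C\<^sub>2 + g' S\<^sub>2\<close> has square length \<open>S\<close>, and the
  transformed surface and its normal are the images of \<open>X\<close> and \<open>N\<close> under the reflection in the
  hyperplane orthogonal to \<open>\<xi>\<close>. As \<open>\<xi>\<^sub>,\<^sub>i\<close> is a multiple of \<open>e\<^sub>i\<close>, the partial derivatives of the
  transformed surface are multiples \<open>e\<close> and \<open>h\<close> of the reflected \<open>e\<^sub>1\<close> and \<open>e\<^sub>2\<close> (\<open>XT_pd\<close>). Hence the metric is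
  \<open>e\<^sup>2 du\<^sub>1\<^sup>2 + h\<^sup>2 du\<^sub>2\<^sup>2\<close>, the domain \<open>V\<close> is where \<open>e h \<noteq> 0\<close>, and the claims about the normal map are
  statements about the orthonormal frame. The rotation coefficients \<open>a = e\<^sub>,\<^sub>2 / h\<close> and \<open>b = h\<^sub>,\<^sub>1 / e\<close> are
  \<open>-2 r\<^sub>2\<^sup>2 f g' / Q\<close> and \<open>-2 r\<^sub>1\<^sup>2 g f' / Q\<close>, and \<open>a\<^sub>,\<^sub>2 + b\<^sub>,\<^sub>1\<close>, to which the curvature is proportional,
  vanishes by \<open>f'\<^sup>2 + g'\<^sup>2 = c Q\<close> (\<open>pd_a_b\<close>, \<open>orthogonal_metric_flat\<close>).

  \<^emph>\<open>From the surface to the functions.\<close> Differentiating \<open>f'\<^sup>2 - c r\<^sub>2\<^sup>2 f\<^sup>2 = c r\<^sub>1\<^sup>2 g\<^sup>2 - g'\<^sup>2\<close> in \<open>u\<^sub>1\<close> gives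
  \<open>f' (f'' - c r\<^sub>2\<^sup>2 f) = 0\<close>. The function \<open>f'\<close> is merely differentiable, so constant and hyperbolic pieces
  might a priori be glued together. But \<open>f''\<close> is a derivative with values in \<open>{0, c r\<^sub>2\<^sup>2 f}\<close> and \<open>f\<close> has no
  zeros, so Darboux's theorem rules this out, and connectedness of \<open>D\<close> leaves either \<open>f\<close> constant on \<open>D\<close> or
  \<open>f'' = c r\<^sub>2\<^sup>2 f\<close> on \<open>D\<close> (\<open>separated_profile\<close>). A constant \<open>f\<close> or \<open>g\<close> makes \<open>\<Omega>/W\<close> constant along a family
  of lines of curvature. So \<open>f = P e\<^sup>x + Q e\<^sup>-\<^sup>x\<close> and \<open>g = P' e\<^sup>y + Q' e\<^sup>-\<^sup>y\<close>, where the relation reads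
  \<open>r\<^sub>2\<^sup>2 P Q + r\<^sub>1\<^sup>2 P' Q' = 0\<close>; the sign of \<open>P Q\<close> selects one of the three families, up to translations and
  reflections of \<open>u\<^sub>1\<close> and \<open>u\<^sub>2\<close> and a common factor of \<open>f\<close> and \<open>g\<close> (\<open>flat_family_normal_form\<close>). The transform does not
  see the factor, and the coordinate changes are induced by isometries preserving the torus (\<open>XT_symmetry\<close>).
  Regularity of the given surface is \<open>e h \<noteq> 0\<close>, which puts it over \<open>V\<close>.\<close>

section \<open>Partial derivatives and smoothness in the parameter plane\<close>

text \<open>The \<open>i\<close>-th coordinate of \<open>u\<close>, and the coordinate line through \<open>u\<close> in the \<open>i\<close>-th direction
  parametrized by it. As in \<^const>\<open>pd\<close>, every index other than \<open>1\<close> stands for the second coordinate.\<close>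

definition coord :: "nat \<Rightarrow> real \<times> real \<Rightarrow> real" where
  "coord i u = (if i = 1 then fst u else snd u)"

definition line :: "nat \<Rightarrow> real \<times> real \<Rightarrow> real \<Rightarrow> real \<times> real" where
  "line i u t = (if i = 1 then (t, snd u) else (fst u, t))"

text \<open>Since \<^const>\<open>pd\<close> is a choice operator, the calculus rules are stated for this relation between a
  function and the value of its partial derivative.\<close>

definition has_pd ::
  "nat \<Rightarrow> (real \<times> real \<Rightarrow> 'a::real_normed_vector) \<Rightarrow> 'a \<Rightarrow> real \<times> real \<Rightarrow> bool" where
  "has_pd i X X' u \<longleftrightarrow> ((\<lambda>t. X (line i u t)) has_vector_derivative X') (at (coord i u))"

lemma line_coord [simp]: "line i u (coord i u) = u"
  by (simp add: line_def coord_def)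

lemma continuous_line: "continuous (at t) (line i u)"
  by (cases "i = 1") (auto simp: line_def[abs_def] intro!: continuous_intros)

lemma has_pd_imp_pd: "has_pd i X X' u \<Longrightarrow> pd i X u = X'"
  unfolding has_pd_def pd_def line_def coord_def
  by (auto split: if_splits intro: vector_derivative_at)

lemma has_pd_unique: "has_pd i X X' u \<Longrightarrow> has_pd i X Y' u \<Longrightarrow> X' = Y'"
  using has_pd_imp_pd by blast

lemma has_pd_pd: "has_pd i X X' u \<Longrightarrow> has_pd i X (pd i X u) u"
  by (simp add: has_pd_imp_pd)

text \<open>A coordinate line meets an open set in an open set, so partial derivatives are local.\<close>

lemma has_pd_cong:
  assumes "open D" "u \<in> D" "\<And>v. v \<in> D \<Longrightarrow> X v = Y v" "has_pd i X X' u"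
  shows "has_pd i Y X' u"
proof -
  have "(line i u \<longlongrightarrow> line i u (coord i u)) (nhds (coord i u))"
    using continuous_line[of "coord i u" i u] unfolding isCont_def tendsto_at_iff_tendsto_nhds .
  then have "(line i u \<longlongrightarrow> u) (nhds (coord i u))" by simp
  then have "\<forall>\<^sub>F t in nhds (coord i u). line i u t \<in> D"
    using assms(1,2) by (rule topological_tendstoD)
  then have "\<forall>\<^sub>F t in nhds (coord i u). X (line i u t) = Y (line i u t)"
    by eventually_elim (rule assms(3))
  then show ?thesis
    using assms(4) unfolding has_pd_def
    by (subst (asm) has_vector_derivative_cong_ev) (auto elim: eventually_mono simp: assms)
qed

lemma pd_cong:
  assumes "open D" "u \<in> D" "\<And>v. v \<in> D \<Longrightarrow> X v = Y v" "has_pd i X X' u"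
  shows "pd i Y u = X'"
  using has_pd_cong[OF assms] by (rule has_pd_imp_pd)

lemma has_derivative_imp_has_pd:
  assumes "(X has_derivative X') (at u)"
  shows "has_pd i X (X' (if i = 1 then (1, 0) else (0, 1))) u"
proof -
  have "(line i u has_vector_derivative (if i = 1 then (1, 0) else (0, 1))) (at (coord i u))"
    unfolding line_def[abs_def] has_vector_derivative_def
    by (auto intro!: derivative_eq_intros)
  then have "(X \<circ> line i u has_vector_derivative X' (if i = 1 then (1, 0) else (0, 1))) (at (coord i u))"
    by (rule vector_derivative_diff_chain_within[where S=UNIV, simplified])
       (use assms in \<open>auto simp: has_derivative_at_withinI\<close>)
  then show ?thesis by (simp add: has_pd_def o_def)
qed

lemma differentiable_imp_has_pd: "X differentiable (at u) \<Longrightarrow> has_pd i X (pd i X u) u"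
  unfolding differentiable_def using has_derivative_imp_has_pd has_pd_imp_pd by metis

lemma has_pd_const: "has_pd i (\<lambda>u. x) 0 u"
  by (simp add: has_pd_def)

lemma has_pd_add:
  "has_pd i X X' u \<Longrightarrow> has_pd i Y Y' u \<Longrightarrow> has_pd i (\<lambda>u. X u + Y u) (X' + Y') u"
  by (simp add: has_pd_def has_vector_derivative_add)

lemma has_pd_diff:
  "has_pd i X X' u \<Longrightarrow> has_pd i Y Y' u \<Longrightarrow> has_pd i (\<lambda>u. X u - Y u) (X' - Y') u"
  by (simp add: has_pd_def has_vector_derivative_diff)

lemma has_pd_scaleR:
  fixes f :: "real \<times> real \<Rightarrow> real"
  assumes "has_pd i f f' u" "has_pd i X X' u"
  shows "has_pd i (\<lambda>u. f u *\<^sub>R X u) (f u *\<^sub>R X' + f' *\<^sub>R X u) u"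
  using has_vector_derivative_scaleR[OF assms(1)[unfolded has_pd_def has_real_derivative_iff_has_vector_derivative[symmetric]] assms(2)[unfolded has_pd_def]]
  by (simp add: has_pd_def)

lemma has_pd_mult:
  fixes f g :: "real \<times> real \<Rightarrow> real"
  assumes "has_pd i f f' u" "has_pd i g g' u"
  shows "has_pd i (\<lambda>u. f u * g u) (f u * g' + f' * g u) u"
  using has_pd_scaleR[OF assms] by simp

lemma has_pd_power2:
  fixes f :: "real \<times> real \<Rightarrow> real"
  assumes "has_pd i f f' u"
  shows "has_pd i (\<lambda>u. (f u)\<^sup>2) (2 * f u * f') u"
  using has_pd_mult[OF assms assms] by (simp add: power2_eq_square algebra_simps)

lemma has_pd_divide:
  fixes f g :: "real \<times> real \<Rightarrow> real"
  assumes "has_pd i f f' u" "has_pd i g g' u" "g u \<noteq> 0"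
  shows "has_pd i (\<lambda>u. f u / g u) ((f' * g u - f u * g') / (g u)\<^sup>2) u"
  using assms unfolding has_pd_def has_real_derivative_iff_has_vector_derivative[symmetric]
  by (auto intro!: derivative_eq_intros simp: power2_eq_square)

lemma has_pd_coord:
  assumes "(f has_vector_derivative f') (at (coord j u))"
  shows "has_pd i (\<lambda>u. f (coord j u)) (if (i = 1) = (j = 1) then f' else 0) u"
proof (cases "(i = 1) = (j = 1)")
  case True
  then have "coord j (line i u t) = t" "coord i u = coord j u" for t by (auto simp: coord_def line_def)
  then show ?thesis using assms True by (simp add: has_pd_def)
next
  case False
  then have "coord j (line i u t) = coord j u" for t by (auto simp: coord_def line_def)
  then show ?thesis using False by (auto simp: has_pd_def)
qed

lemma has_pd_1_real:
  fixes f :: "real \<times> real \<Rightarrow> real"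
  shows "has_pd 1 f y u \<longleftrightarrow> ((\<lambda>t. f (t, snd u)) has_real_derivative y) (at (fst u))"
  by (simp add: has_pd_def line_def coord_def has_real_derivative_iff_has_vector_derivative)

lemma has_pd_2_real:
  fixes f :: "real \<times> real \<Rightarrow> real"
  shows "has_pd 2 f y u \<longleftrightarrow> ((\<lambda>t. f (fst u, t)) has_real_derivative y) (at (snd u))"
  by (simp add: has_pd_def line_def coord_def has_real_derivative_iff_has_vector_derivative)

lemma differentiable_coord:
  assumes "(f has_vector_derivative f') (at (coord j u))"
  shows "(\<lambda>u. f (coord j u)) differentiable (at u)"
proof -
  have "coord j differentiable (at u)"
    by (cases "j = 1") (auto simp: coord_def[abs_def] bounded_linear_fst bounded_linear_snd
        intro!: bounded_linear_imp_differentiable)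
  moreover have "f differentiable (at (coord j u))"
    using assms by (auto simp: has_vector_derivative_def differentiable_def)
  ultimately show ?thesis
    using differentiable_compose by blast
qed

lemma ck_on_cong:
  assumes "open D" "\<And>u. u \<in> D \<Longrightarrow> X u = Y u"
  shows "ck_on k D X \<Longrightarrow> ck_on k D Y"
  using assms(2)
proof (induction k arbitrary: X Y)
  case 0
  then show ?case using continuous_on_cong by (auto cong: continuous_on_cong)
next
  case (Suc k)
  have d: "Y differentiable (at u)" if u: "u \<in> D" for u
  proof -
    obtain X' where "(X has_derivative X') (at u)"
      using Suc.prems(1) u by (auto simp: differentiable_def)
    then have "(Y has_derivative X') (at u)"
      by (rule has_derivative_transform_within_open[OF _ assms(1) u Suc.prems(2)])
    then show ?thesis by (auto simp: differentiable_def)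
  qed
  have "pd i X u = pd i Y u" if "u \<in> D" for u i
  proof (rule sym, rule pd_cong[OF assms(1) that Suc.prems(2)])
    show "has_pd i X (pd i X u) u"
      using Suc.prems(1) that by (intro differentiable_imp_has_pd) simp
  qed
  then have "ck_on k D (pd 1 Y)" "ck_on k D (pd 2 Y)"
    using Suc.IH[of "pd 1 X" "pd 1 Y"] Suc.IH[of "pd 2 X" "pd 2 Y"] Suc.prems by auto
  then show ?case using d by simp
qed

lemma ck_on_SucI:
  assumes "open D" "\<And>u. u \<in> D \<Longrightarrow> X differentiable (at u)"
    and "\<And>u. u \<in> D \<Longrightarrow> has_pd 1 X (X1 u) u" "\<And>u. u \<in> D \<Longrightarrow> has_pd 2 X (X2 u) u"
    and "ck_on k D X1" "ck_on k D X2"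
  shows "ck_on (Suc k) D X"
proof -
  have "ck_on k D (pd 1 X)" by (rule ck_on_cong[OF assms(1) _ assms(5)]) (rule has_pd_imp_pd[OF assms(3), symmetric])
  moreover have "ck_on k D (pd 2 X)" by (rule ck_on_cong[OF assms(1) _ assms(6)]) (rule has_pd_imp_pd[OF assms(4), symmetric])
  ultimately show ?thesis using assms(2) by simp
qed

text \<open>Only differentiability at the first stage gives continuity; the higher stages follow by applying
  the induction hypothesis to the partial derivatives.\<close>

lemma ck_on_SucD: "ck_on (Suc k) D X \<Longrightarrow> ck_on k D X"
proof (induction k arbitrary: X)
  case 0
  then show ?case
    by (auto intro!: continuous_at_imp_continuous_on differentiable_imp_continuous_within)
next
  case (Suc k)
  from Suc.prems have "ck_on (Suc k) D (pd 1 X)" "ck_on (Suc k) D (pd 2 X)" "\<forall>u\<in>D. X differentiable (at u)"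
    by (simp_all del: One_nat_def)
  from Suc.IH[OF this(1)] Suc.IH[OF this(2)] this(3) show ?case unfolding ck_on.simps(2) by blast
qed

lemma ck_on_mono: "ck_on k D X \<Longrightarrow> D' \<subseteq> D \<Longrightarrow> ck_on k D' X"
proof (induction k arbitrary: X)
  case 0
  then show ?case using continuous_on_subset by simp blast
next
  case (Suc k)
  from Suc.prems(1) have "\<forall>u\<in>D. X differentiable (at u)" "ck_on k D (pd 1 X)" "ck_on k D (pd 2 X)"
    by (simp_all del: One_nat_def)
  then show ?case unfolding ck_on.simps(2) using Suc.IH Suc.prems(2) by blast
qed

lemma ck_on_const: "open D \<Longrightarrow> ck_on k D (\<lambda>u. x)"
proof (induction k arbitrary: x)
  case (Suc k)
  then show ?case by (intro ck_on_SucI[where ?X1.0="\<lambda>u. 0" and ?X2.0="\<lambda>u. 0"]) (auto intro: has_pd_const)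
qed auto

lemma ck_on_SucE:
  assumes "ck_on (Suc k) D X"
  shows "u \<in> D \<Longrightarrow> X differentiable (at u)" "ck_on k D (pd 1 X)" "ck_on k D (pd 2 X)"
    "u \<in> D \<Longrightarrow> has_pd i X (pd i X u) u"
proof -
  show d: "X differentiable (at u)" if "u \<in> D" for u using assms that by simp
  show "ck_on k D (pd 1 X)" "ck_on k D (pd 2 X)" using assms by simp_all
  show "has_pd i X (pd i X u) u" if "u \<in> D" by (rule differentiable_imp_has_pd[OF d[OF that]])
qed

lemma ck_on_add:
  assumes "open D"
  shows "ck_on k D X \<Longrightarrow> ck_on k D Y \<Longrightarrow> ck_on k D (\<lambda>u. X u + Y u)"
proof (induction k arbitrary: X Y)
  case 0 then show ?case by (auto intro: continuous_on_add)
next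
  case (Suc k)
  note X = ck_on_SucE[OF Suc.prems(1)] and Y = ck_on_SucE[OF Suc.prems(2)]
  show ?case
  proof (rule ck_on_SucI[OF assms])
    show "(\<lambda>u. X u + Y u) differentiable (at u)" if "u \<in> D" for u
      by (rule differentiable_add[OF X(1)[OF that] Y(1)[OF that]])
    show "has_pd 1 (\<lambda>u. X u + Y u) (pd 1 X u + pd 1 Y u) u" if "u \<in> D" for u
      by (rule has_pd_add[OF X(4)[OF that] Y(4)[OF that]])
    show "has_pd 2 (\<lambda>u. X u + Y u) (pd 2 X u + pd 2 Y u) u" if "u \<in> D" for u
      by (rule has_pd_add[OF X(4)[OF that] Y(4)[OF that]])
  qed (rule Suc.IH[OF X(2) Y(2)] Suc.IH[OF X(3) Y(3)])+
qed

lemma ck_on_scaleR: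
  fixes f :: "real \<times> real \<Rightarrow> real"
  assumes "open D"
  shows "ck_on k D f \<Longrightarrow> ck_on k D X \<Longrightarrow> ck_on k D (\<lambda>u. f u *\<^sub>R X u)"
proof (induction k arbitrary: f X)
  case 0 then show ?case by (auto intro: continuous_on_scaleR)
next
  case (Suc k)
  note f = ck_on_SucE[OF Suc.prems(1)] ck_on_SucD[OF Suc.prems(1)]
    and X = ck_on_SucE[OF Suc.prems(2)] ck_on_SucD[OF Suc.prems(2)]
  show ?case
  proof (rule ck_on_SucI[OF assms])
    show "(\<lambda>u. f u *\<^sub>R X u) differentiable (at u)" if "u \<in> D" for u
      by (rule differentiable_scaleR[OF f(1)[OF that] X(1)[OF that]])
    show "has_pd 1 (\<lambda>u. f u *\<^sub>R X u) (f u *\<^sub>R pd 1 X u + pd 1 f u *\<^sub>R X u) u" if "u \<in> D" for u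
      by (rule has_pd_scaleR[OF f(4)[OF that] X(4)[OF that]])
    show "has_pd 2 (\<lambda>u. f u *\<^sub>R X u) (f u *\<^sub>R pd 2 X u + pd 2 f u *\<^sub>R X u) u" if "u \<in> D" for u
      by (rule has_pd_scaleR[OF f(4)[OF that] X(4)[OF that]])
    show "ck_on k D (\<lambda>u. f u *\<^sub>R pd 1 X u + pd 1 f u *\<^sub>R X u)"
      by (rule ck_on_add[OF assms Suc.IH[OF f(5) X(2)] Suc.IH[OF f(2) X(5)]])
    show "ck_on k D (\<lambda>u. f u *\<^sub>R pd 2 X u + pd 2 f u *\<^sub>R X u)"
      by (rule ck_on_add[OF assms Suc.IH[OF f(5) X(3)] Suc.IH[OF f(3) X(5)]])
  qed
qed

lemma ck_on_inverse:
  fixes f :: "real \<times> real \<Rightarrow> real"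
  assumes "open D" "\<And>u. u \<in> D \<Longrightarrow> f u \<noteq> 0"
  shows "ck_on k D f \<Longrightarrow> ck_on k D (\<lambda>u. inverse (f u))"
proof (induction k)
  case 0
  then have "continuous_on D f" by simp
  then have "continuous_on D (\<lambda>u. inverse (f u))"
    by (rule continuous_on_inverse) (use assms(2) in blast)
  then show ?case by simp
next
  case (Suc k)
  note f = ck_on_SucE[OF Suc.prems]
  let ?g = "\<lambda>u. inverse (f u)"
  have g: "ck_on k D ?g" by (rule Suc.IH[OF ck_on_SucD[OF Suc.prems]])
  have p: "has_pd i ?g (((-1) *\<^sub>R (?g u *\<^sub>R ?g u)) *\<^sub>R pd i f u) u" if "u \<in> D" for u i
    using has_pd_divide[OF has_pd_const f(4)[OF that] assms(2)[OF that], of i 1] assms(2)[OF that]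
    by (simp add: divide_inverse power2_eq_square mult_ac)
  have c: "ck_on k D (\<lambda>u. ((-1) *\<^sub>R (?g u *\<^sub>R ?g u)) *\<^sub>R h u)" if "ck_on k D h" for h :: "real \<times> real \<Rightarrow> real"
    by (rule ck_on_scaleR[OF assms(1) ck_on_scaleR[OF assms(1) ck_on_const[OF assms(1)]
        ck_on_scaleR[OF assms(1) g g]] that])
  show ?case
  proof (rule ck_on_SucI[OF assms(1)])
    show "?g differentiable (at u)" if "u \<in> D" for u
      by (rule differentiable_inverse[OF f(1)[OF that] assms(2)[OF that]])
  qed (erule p | rule c[OF f(2)] c[OF f(3)])+
qed

text \<open>The equation \<open>f'' = \<mu> f\<close> closes \<open>{f, f'}\<close> under differentiation up to constants, so that
  smoothness follows by induction; the trigonometric (\<open>\<mu> < 0\<close>) and hyperbolic (\<open>\<mu> > 0\<close>) cases are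
  treated at once.\<close>

lemma ck_on_second_order_ode:
  fixes f g :: "real \<Rightarrow> real"
  assumes "open D" "\<And>t. (f has_real_derivative g t) (at t)"
    and "\<And>t. (g has_real_derivative \<mu> * f t) (at t)"
  shows "ck_on k D (\<lambda>u. f (coord j u)) \<and> ck_on k D (\<lambda>u. g (coord j u))"
proof -
  note d = assms(2,3)[unfolded has_real_derivative_iff_has_vector_derivative]
  have diff: "(\<lambda>u. f (coord j u)) differentiable (at u)" "(\<lambda>u. g (coord j u)) differentiable (at u)" for u
    by (rule differentiable_coord, rule d)+
  show ?thesis
  proof (induction k)
    case 0
    have "continuous_on D (\<lambda>u. f (coord j u))" "continuous_on D (\<lambda>u. g (coord j u))"
      by (rule continuous_at_imp_continuous_on, rule ballI, rule differentiable_imp_continuous_within, rule diff)+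
    then show ?case by simp
  next
    case (Suc k)
    have "ck_on k D (\<lambda>u. \<mu> * f (coord j u))"
      using ck_on_scaleR[OF assms(1) ck_on_const[OF assms(1)], of k "\<lambda>u. f (coord j u)" \<mu>] Suc
      by simp
    moreover have "ck_on k D (\<lambda>u. if b then h u else 0)" if "ck_on k D h" for b and h :: "real \<times> real \<Rightarrow> real"
      using that ck_on_const[OF assms(1), of k "0::real"] by (cases b) auto
    ultimately have *: "ck_on k D (\<lambda>u. if b then g (coord j u) else 0)"
      "ck_on k D (\<lambda>u. if b then \<mu> * f (coord j u) else 0)" for b
      using Suc by blast+
    have p: "has_pd i (\<lambda>u. f (coord j u)) (if (i = 1) = (j = 1) then g (coord j u) else 0) u"
      "has_pd i (\<lambda>u. g (coord j u)) (if (i = 1) = (j = 1) then \<mu> * f (coord j u) else 0) u" for i u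
      by (rule has_pd_coord[OF d(1)[of "coord j u"]] has_pd_coord[OF d(2)[of "coord j u"]])+
    have "ck_on (Suc k) D (\<lambda>u. f (coord j u))"
      by (rule ck_on_SucI[OF assms(1) diff(1) p(1) p(1) *(1) *(1)])
    moreover have "ck_on (Suc k) D (\<lambda>u. g (coord j u))"
      by (rule ck_on_SucI[OF assms(1) diff(2) p(2) p(2) *(2) *(2)])
    ultimately show ?case by blast
  qed
qed

lemma ck_on_mult:
  fixes f g :: "real \<times> real \<Rightarrow> real"
  shows "open D \<Longrightarrow> ck_on k D f \<Longrightarrow> ck_on k D g \<Longrightarrow> ck_on k D (\<lambda>u. f u * g u)"
  using ck_on_scaleR[of D k f g] by simp

lemma ck_on_diff:
  assumes "open D" "ck_on k D X" "ck_on k D Y"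
  shows "ck_on k D (\<lambda>u. X u - Y u)"
  using ck_on_add[OF assms(1,2) ck_on_scaleR[OF assms(1) ck_on_const[OF assms(1), of k "-1"] assms(3)]]
  by simp

lemma ck_on_divide:
  fixes f g :: "real \<times> real \<Rightarrow> real"
  assumes "open D" "ck_on k D f" "ck_on k D g" "\<And>u. u \<in> D \<Longrightarrow> g u \<noteq> 0"
  shows "ck_on k D (\<lambda>u. f u / g u)"
  using ck_on_mult[OF assms(1,2) ck_on_inverse[OF assms(1,4,3)]] by (simp add: divide_inverse)

section \<open>Functions of one coordinate with a quadratic first integral\<close>

text \<open>Darboux's theorem: the minimum of \<open>f t - v t\<close> over the interval is not attained at an end point,
  because of the signs of \<open>f' x - v\<close> and \<open>f' y - v\<close>, so it is a critical point.\<close>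

lemma darboux_less:
  fixes f f' :: "real \<Rightarrow> real"
  assumes "x < y" and d: "\<And>t. t \<in> {x..y} \<Longrightarrow> (f has_real_derivative f' t) (at t)"
    and v: "f' x < v" "v < f' y"
  shows "\<exists>z\<in>{x..y}. f' z = v"
proof -
  define g where "g = (\<lambda>t. f t - v * t)"
  have dg: "(g has_real_derivative f' t - v) (at t)" if "t \<in> {x..y}" for t
    unfolding g_def using d[OF that] by (auto intro!: derivative_eq_intros)
  have "continuous_on {x..y} g"
    by (rule DERIV_continuous_on[where D="\<lambda>t. f' t - v"]) (use dg in \<open>blast intro: DERIV_subset\<close>)
  then obtain z where z: "z \<in> {x..y}" "\<And>t. t \<in> {x..y} \<Longrightarrow> g z \<le> g t"
    using continuous_attains_inf[of "{x..y}" g] \<open>x < y\<close> by auto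
  have "z \<noteq> x"
  proof
    assume "z = x"
    have "x \<in> {x..y}" "f' x - v < 0" using \<open>x < y\<close> v by auto
    then obtain e where e: "e > 0" "\<And>h. 0 < h \<Longrightarrow> h < e \<Longrightarrow> g (x + h) < g x"
      using DERIV_neg_dec_right[OF dg] by blast
    define h where "h = min (e / 2) (y - x)"
    have "0 < h" "h < e" "x + h \<in> {x..y}" using e(1) \<open>x < y\<close> by (auto simp: h_def min_def)
    with e(2)[of h] z(2)[of "x + h"] \<open>z = x\<close> show False by auto
  qed
  moreover have "z \<noteq> y"
  proof
    assume "z = y"
    have "y \<in> {x..y}" "f' y - v > 0" using \<open>x < y\<close> v by auto
    then obtain e where e: "e > 0" "\<And>h. 0 < h \<Longrightarrow> h < e \<Longrightarrow> g (y - h) < g y"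
      using DERIV_pos_inc_left[OF dg] by blast
    define h where "h = min (e / 2) (y - x)"
    have "0 < h" "h < e" "y - h \<in> {x..y}" using e(1) \<open>x < y\<close> by (auto simp: h_def min_def)
    with e(2)[of h] z(2)[of "y - h"] \<open>z = y\<close> show False by auto
  qed
  ultimately have "min (z - x) (y - z) > 0" using z(1) by auto
  moreover have "\<forall>t. \<bar>z - t\<bar> < min (z - x) (y - z) \<longrightarrow> g z \<le> g t"
    using z(2) by (auto simp: abs_less_iff)
  ultimately have "f' z - v = 0" using DERIV_local_min[OF dg[OF z(1)]] by blast
  then show ?thesis using z(1) by auto
qed

lemma darboux:
  fixes f f' :: "real \<Rightarrow> real"
  assumes d: "\<And>t. t \<in> {min x y..max x y} \<Longrightarrow> (f has_real_derivative f' t) (at t)"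
    and v: "f' x < v" "v < f' y"
  shows "\<exists>z\<in>{min x y..max x y}. f' z = v"
proof (cases x y rule: linorder_cases)
  case less
  then show ?thesis using darboux_less[of x y f f' v] d v by auto
next
  case equal
  then show ?thesis using v by simp
next
  case greater
  have "\<exists>z\<in>{y..x}. - f' z = - v"
    by (rule darboux_less[where f="\<lambda>t. - f t"])
       (use d v greater in \<open>auto intro!: derivative_eq_intros\<close>)
  then show ?thesis using greater by auto
qed

text \<open>At a zero \<open>t\<close> of \<open>p = F'\<close> with \<open>q t = F'' t \<noteq> 0\<close>, the zero is isolated, so \<open>q = \<mu> F\<close> on a punctured
  neighbourhood; by de l'Hospital's rule the limit \<open>\<mu> F t\<close> of \<open>q\<close> there is the derivative \<open>q t\<close> of \<open>p\<close>.\<close>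

lemma second_order_alternative_at:
  fixes F p q :: "real \<Rightarrow> real"
  assumes "open I" "t \<in> I"
    and dF: "(F has_real_derivative p t) (at t)"
    and dp: "\<And>s. s \<in> I \<Longrightarrow> (p has_real_derivative q s) (at s)"
    and pq: "\<And>s. s \<in> I \<Longrightarrow> p s * (q s - \<mu> * F s) = 0"
  shows "q t = \<mu> * F t \<or> p t = 0 \<and> q t = 0"
proof (cases "p t = 0 \<and> q t \<noteq> 0")
  case True
  have lim: "((\<lambda>s. p s / (s - t)) \<longlongrightarrow> q t) (at t)"
    using dp[OF \<open>t \<in> I\<close>] True by (simp add: has_field_derivative_iff)
  have I: "\<forall>\<^sub>F s in at t. s \<in> I"
    using \<open>open I\<close> \<open>t \<in> I\<close> by (rule eventually_at_in_open')
  have "\<forall>\<^sub>F s in at t. p s / (s - t) \<noteq> 0"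
    using lim True by (intro tendsto_imp_eventually_ne) auto
  with I have ev: "\<forall>\<^sub>F s in at t. \<mu> * F s = q s / 1"
    by eventually_elim (use pq in force)
  have "((\<lambda>s. \<mu> * F s) \<longlongrightarrow> \<mu> * F t) (at t)"
    using DERIV_isCont[OF dF] by (auto simp: isCont_def intro: tendsto_mult_left)
  then have "((\<lambda>s. q s / 1) \<longlongrightarrow> \<mu> * F t) (at t)"
    by (rule Lim_transform_eventually[OF _ ev])
  moreover have "(p \<longlongrightarrow> 0) (at t)"
    using DERIV_isCont[OF dp[OF \<open>t \<in> I\<close>]] True by (simp add: isCont_def)
  moreover have "((\<lambda>s. s - t) \<longlongrightarrow> 0) (at t)" by (auto intro!: tendsto_eq_intros)
  moreover have "\<forall>\<^sub>F s in at t. s - t \<noteq> 0" by (simp add: eventually_at_filter)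
  moreover have "\<forall>\<^sub>F s in at t. (p has_real_derivative q s) (at s)"
    using I by eventually_elim (rule dp)
  moreover have "\<forall>\<^sub>F s in at t. ((\<lambda>s. s - t) has_real_derivative 1) (at s)"
    by (rule always_eventually) (auto intro!: derivative_eq_intros)
  ultimately have "((\<lambda>s. p s / (s - t)) \<longlongrightarrow> \<mu> * F t) (at t)"
    using lhopital[of p t "\<lambda>s. s - t" "\<lambda>_. 1" q] by simp
  with lim have "q t = \<mu> * F t" using tendsto_unique by (metis trivial_limit_at)
  then show ?thesis ..
next
  case False
  then show ?thesis using pq[OF \<open>t \<in> I\<close>] by auto
qed

text \<open>By the previous lemma the second derivative \<open>q\<close> has all its values in \<open>{0, \<mu> F}\<close>. On a compact
  interval the nonvanishing \<open>F\<close> is bounded away from \<open>0\<close>, so there is a gap between \<open>0\<close> and the values of \<open>\<mu> F\<close>,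
  and Darboux's theorem forbids the derivative \<open>q\<close> to jump across it.\<close>

lemma second_order_dichotomy:
  fixes F p q :: "real \<Rightarrow> real"
  assumes "\<mu> > 0"
    and dF: "\<And>t. t \<in> {a<..<b} \<Longrightarrow> (F has_real_derivative p t) (at t)"
    and dp: "\<And>t. t \<in> {a<..<b} \<Longrightarrow> (p has_real_derivative q t) (at t)"
    and pq: "\<And>t. t \<in> {a<..<b} \<Longrightarrow> p t * (q t - \<mu> * F t) = 0"
    and F0: "\<And>t. t \<in> {a<..<b} \<Longrightarrow> F t \<noteq> 0"
  shows "(\<forall>t\<in>{a<..<b}. p t = 0 \<and> q t = 0) \<or> (\<forall>t\<in>{a<..<b}. q t = \<mu> * F t)"
proof -
  have alt: "q t = \<mu> * F t \<or> p t = 0 \<and> q t = 0" if "t \<in> {a<..<b}" for t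
    by (rule second_order_alternative_at[where I="{a<..<b}", OF _ that dF[OF that] dp pq]) auto
  have cF: "continuous_on {a<..<b} F"
    by (rule DERIV_continuous_on[where D=p]) (use dF in \<open>blast intro: DERIV_subset\<close>)
  \<comment> \<open>\<open>\<sigma>\<close> carries the common sign of \<open>F\<close> on the interval, so that \<open>\<sigma> F\<close> is positive.\<close>
  define \<sigma> where "\<sigma> = F ((a + b) / 2)"
  show ?thesis
  proof (cases "a < b")
    case True
    then have m: "(a + b) / 2 \<in> {a<..<b}" by auto
    have "connected (F ` {a<..<b})" using cF by (rule connected_continuous_image) auto
    note ivt = connectedD_interval[OF this]
    have pos: "\<sigma> * F t > 0" if t: "t \<in> {a<..<b}" for t
    proof (rule ccontr)
      assume "\<not> \<sigma> * F t > 0"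
      then have "F t \<le> 0 \<and> 0 \<le> F ((a + b) / 2) \<or> F ((a + b) / 2) \<le> 0 \<and> 0 \<le> F t"
        unfolding \<sigma>_def by (auto simp: zero_less_mult_iff not_less)
      then have "0 \<in> F ` {a<..<b}"
        using ivt[OF imageI[OF t] imageI[OF m]] ivt[OF imageI[OF m] imageI[OF t]] by blast
      then show False using F0 by force
    qed
    show ?thesis
    proof (rule ccontr)
      assume "\<not> ?thesis"
      then obtain x y where xy: "x \<in> {a<..<b}" "y \<in> {a<..<b}" "q x = 0" "q y = \<mu> * F y"
        using alt by metis
      have sub: "{min x y..max x y} \<subseteq> {a<..<b}" using xy by auto
      have "continuous_on {min x y..max x y} (\<lambda>t. \<sigma> * F t)"
        using continuous_on_subset[OF cF sub] by (intro continuous_intros)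
      then obtain w where w: "w \<in> {min x y..max x y}"
        "\<And>t. t \<in> {min x y..max x y} \<Longrightarrow> \<sigma> * F w \<le> \<sigma> * F t"
        using continuous_attains_inf[of "{min x y..max x y}" "\<lambda>t. \<sigma> * F t"] by (auto simp: min_def max_def split: if_splits)
      \<comment> \<open>\<open>v\<close> lies in the gap between \<open>0\<close> and the values of \<open>\<mu> \<sigma> F\<close>.\<close>
      define v where "v = \<mu> * (\<sigma> * F w) / 2"
      have v: "0 < v" using pos[of w] w sub \<open>\<mu> > 0\<close> by (auto simp: v_def)
      have big: "v < \<sigma> * (\<mu> * F t)" if "t \<in> {min x y..max x y}" for t
      proof -
        have "\<mu> * (\<sigma> * F w) \<le> \<mu> * (\<sigma> * F t)" using w(2)[OF that] \<open>\<mu> > 0\<close> by simp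
        then show ?thesis using v by (simp add: v_def mult.left_commute)
      qed
      have "\<exists>z\<in>{min x y..max x y}. \<sigma> * q z = v"
        by (rule darboux[where f="\<lambda>t. \<sigma> * p t"])
           (use dp sub xy v big[of y] in \<open>auto intro!: derivative_eq_intros\<close>)
      then obtain z where z: "z \<in> {min x y..max x y}" "\<sigma> * q z = v" by blast
      moreover have "z \<in> {a<..<b}" using z(1) sub by blast
      ultimately show False using alt[of z] big[of z] v by auto
    qed
  qed auto
qed

lemma constant_if_pd_zero:
  fixes F :: "real \<times> real \<Rightarrow> real"
  assumes "open D" "connected D" "\<And>u. u \<in> D \<Longrightarrow> F differentiable (at u)"
    and "\<And>u. u \<in> D \<Longrightarrow> has_pd 1 F 0 u" "\<And>u. u \<in> D \<Longrightarrow> has_pd 2 F 0 u"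
  shows "\<exists>c. \<forall>u\<in>D. F u = c"
proof -
  have "(F has_derivative (\<lambda>_. 0)) (at u within D)" if "u \<in> D" for u
  proof -
    obtain F' where F': "(F has_derivative F') (at u)"
      using assms(3)[OF \<open>u \<in> D\<close>] by (auto simp: differentiable_def)
    then interpret F': bounded_linear F' by (rule has_derivative_bounded_linear)
    have z: "F' (1, 0) = 0" "F' (0, 1) = 0"
      using has_pd_imp_pd[OF has_derivative_imp_has_pd[OF F', of 1]] has_pd_imp_pd[OF assms(4)[OF that]]
        has_pd_imp_pd[OF has_derivative_imp_has_pd[OF F', of 2]] has_pd_imp_pd[OF assms(5)[OF that]]
      by auto
    have "F' v = 0" for v
    proof -
      have "v = fst v *\<^sub>R (1, 0) + snd v *\<^sub>R (0, 1)" by (simp add: prod_eq_iff)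
      then have "F' v = fst v *\<^sub>R F' (1, 0) + snd v *\<^sub>R F' (0, 1)"
        by (metis F'.add F'.scaleR)
      then show ?thesis using z by simp
    qed
    then have "F' = (\<lambda>_. 0)" by auto
    then show ?thesis using F' has_derivative_at_withinI by metis
  qed
  note zero = this
  have "F constant_on D"
    by (rule has_derivative_zero_connected_constant_on[OF assms(2,1) finite.emptyI])
       (use zero assms(3) in \<open>auto intro!: continuous_at_imp_continuous_on differentiable_imp_continuous_within\<close>)
  then show ?thesis by (auto simp: constant_on_def)
qed

lemma open_contains_box:
  fixes u :: "real \<times> real"
  assumes "open D" "u \<in> D"
  obtains \<delta> where "\<delta> > 0" "{fst u - \<delta><..<fst u + \<delta>} \<times> {snd u - \<delta><..<snd u + \<delta>} \<subseteq> D"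
proof -
  obtain A B where AB: "open A" "open B" "u \<in> A \<times> B" "A \<times> B \<subseteq> D"
    using open_prod_elim[OF assms] .
  obtain d e where "d > 0" "ball (fst u) d \<subseteq> A" "e > 0" "ball (snd u) e \<subseteq> B"
    using AB by (metis mem_Times_iff open_contains_ball)
  moreover have "{fst u - min d e<..<fst u + min d e} \<subseteq> ball (fst u) d"
    "{snd u - min d e<..<snd u + min d e} \<subseteq> ball (snd u) e"
    by (auto simp: dist_real_def abs_less_iff)
  ultimately show ?thesis using AB(4) by (intro that[of "min d e"]) (simp, blast)
qed

text \<open>On a box \<open>F\<close>, \<open>p\<close> and \<open>q\<close> depend on the first coordinate alone, so the one-variable dichotomy makes
  each of the two alternatives an open condition; they exclude each other because \<open>F \<noteq> 0\<close>.
  In the second alternative the first integrals \<open>(p \<plusminus> k F) e\<^sup>\<mp>\<^sup>k\<^sup>t\<close>, being functions on \<open>D\<close>, are constant on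
  all of \<open>D\<close>. This gives one formula on \<open>D\<close> even if the coordinate lines meet \<open>D\<close> in several pieces, where
  a function with vanishing second partial derivative need not be a function of the first coordinate.\<close>

lemma separated_profile:
  fixes F p q :: "real \<times> real \<Rightarrow> real"
  assumes D: "open D" "connected D" and "k > 0"
    and diff: "\<And>u. u \<in> D \<Longrightarrow> F differentiable (at u)" "\<And>u. u \<in> D \<Longrightarrow> p differentiable (at u)"
    and F: "\<And>u. u \<in> D \<Longrightarrow> has_pd 1 F (p u) u" "\<And>u. u \<in> D \<Longrightarrow> has_pd 2 F 0 u"
    and p: "\<And>u. u \<in> D \<Longrightarrow> has_pd 1 p (q u) u" "\<And>u. u \<in> D \<Longrightarrow> has_pd 2 p 0 u"
    and F0: "\<And>u. u \<in> D \<Longrightarrow> F u \<noteq> 0"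
    and pq: "\<And>u. u \<in> D \<Longrightarrow> p u * (q u - k\<^sup>2 * F u) = 0"
  shows "(\<forall>u\<in>D. p u = 0) \<or>
    (\<exists>P Q. \<forall>u\<in>D. F u = P * exp (k * fst u) + Q * exp (- k * fst u)
                \<and> p u = k * (P * exp (k * fst u) - Q * exp (- k * fst u)))"
proof -
  let ?A = "{u \<in> D. p u = 0 \<and> q u = 0}" and ?B = "{u \<in> D. q u = k\<^sup>2 * F u}"
  have k2: "k\<^sup>2 > 0" using \<open>k > 0\<close> by simp
  have disj: "?A \<inter> ?B = {}" using F0 k2 by auto
  have loc: "\<exists>T. open T \<and> u \<in> T \<and> (T \<subseteq> ?A \<or> T \<subseteq> ?B)" if u: "u \<in> D" for u
  proof -
    obtain \<delta> where \<delta>: "\<delta> > 0" and sub: "{fst u - \<delta><..<fst u + \<delta>} \<times> {snd u - \<delta><..<snd u + \<delta>} \<subseteq> D"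
      using open_contains_box[OF D(1) u] .
    let ?I = "{fst u - \<delta><..<fst u + \<delta>}" and ?J = "{snd u - \<delta><..<snd u + \<delta>}"
    have inD: "(s, t) \<in> D" if "s \<in> ?I" "t \<in> ?J" for s t using sub that by blast
    have y: "snd u \<in> ?J" using \<delta> by simp
    have const: "h (s, t) = h (s, snd u)"
      if "s \<in> ?I" "t \<in> ?J" and h: "\<And>u. u \<in> D \<Longrightarrow> has_pd 2 h 0 u" for s t and h :: "real \<times> real \<Rightarrow> real"
      by (rule DERIV_isconst3[of "snd u - \<delta>" "snd u + \<delta>" t "snd u" "\<lambda>t. h (s, t)"])
         (use \<delta> that h[OF inD] in \<open>auto simp: has_pd_2_real\<close>)
    have q_const: "q (s, t) = q (s, snd u)" if "s \<in> ?I" "t \<in> ?J" for s t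
    proof -
      have "((\<lambda>s. p (s, t)) has_real_derivative q (s, t)) (at s)"
        using p(1)[OF inD[OF that]] by (simp add: has_pd_1_real[unfolded One_nat_def])
      then have "((\<lambda>s. p (s, snd u)) has_real_derivative q (s, t)) (at s)"
        by (rule has_field_derivative_transform_within_open[of _ _ _ ?I])
           (use that const[OF _ that(2) p(2)] in auto)
      moreover have "((\<lambda>s. p (s, snd u)) has_real_derivative q (s, snd u)) (at s)"
        using p(1)[OF inD[OF that(1) y]] by (simp add: has_pd_1_real[unfolded One_nat_def])
      ultimately show ?thesis by (rule DERIV_unique)
    qed
    have "(\<forall>s\<in>?I. p (s, snd u) = 0 \<and> q (s, snd u) = 0) \<or> (\<forall>s\<in>?I. q (s, snd u) = k\<^sup>2 * F (s, snd u))"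
      by (rule second_order_dichotomy[OF k2])
         (use F(1)[OF inD[OF _ y]] p(1)[OF inD[OF _ y]] pq[OF inD[OF _ y]] F0[OF inD[OF _ y]]
          in \<open>auto simp: has_pd_1_real[unfolded One_nat_def]\<close>)
    then have "?I \<times> ?J \<subseteq> ?A \<or> ?I \<times> ?J \<subseteq> ?B"
    proof
      assume *: "\<forall>s\<in>?I. p (s, snd u) = 0 \<and> q (s, snd u) = 0"
      have "(s, t) \<in> ?A" if "s \<in> ?I" "t \<in> ?J" for s t
        using * that inD const[OF that p(2)] q_const[OF that] by simp
      then show ?thesis by blast
    next
      assume *: "\<forall>s\<in>?I. q (s, snd u) = k\<^sup>2 * F (s, snd u)"
      have "(s, t) \<in> ?B" if "s \<in> ?I" "t \<in> ?J" for s t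
        using * that inD const[OF that F(2)] q_const[OF that] by simp
      then show ?thesis by blast
    qed
    moreover have "open (?I \<times> ?J)" "u \<in> ?I \<times> ?J" using \<delta> by (auto intro: open_Times simp: mem_Times_iff)
    ultimately show ?thesis by blast
  qed
  have "open ?A"
  proof (subst open_subopen, intro ballI)
    fix u assume "u \<in> ?A"
    then show "\<exists>T. open T \<and> u \<in> T \<and> T \<subseteq> ?A" using loc[of u] disj by blast
  qed
  moreover have "open ?B"
  proof (subst open_subopen, intro ballI)
    fix u assume "u \<in> ?B"
    then show "\<exists>T. open T \<and> u \<in> T \<and> T \<subseteq> ?B" using loc[of u] disj by blast
  qed
  moreover have "D \<subseteq> ?A \<union> ?B" using loc by blast
  ultimately have "?A \<inter> D = {} \<or> ?B \<inter> D = {}"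
    using disj by (intro connectedD[OF D(2)]) auto
  then have "D \<subseteq> ?A \<or> D \<subseteq> ?B" using \<open>D \<subseteq> ?A \<union> ?B\<close> by blast
  then show ?thesis
  proof
    assume "D \<subseteq> ?A"
    then show ?thesis by blast
  next
    assume "D \<subseteq> ?B"
    then have q: "q u = k\<^sup>2 * F u" if "u \<in> D" for u using that by blast
    have const: "\<exists>c. \<forall>u\<in>D. (p u + m * F u) * exp (- m * fst u) = c" if "m\<^sup>2 = k\<^sup>2" for m
    proof (rule constant_if_pd_zero[OF D])
      fix u assume u: "u \<in> D"
      have "(\<lambda>u. exp (- m * fst u)) differentiable (at u)"
        by (rule differentiableI) (auto intro!: derivative_eq_intros)
      then show "(\<lambda>u. (p u + m * F u) * exp (- m * fst u)) differentiable (at u)"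
        using diff[OF u] by (intro differentiable_mult differentiable_add differentiable_const)
      have qu: "q u = m * (m * F u)"
        unfolding q[OF u] that[symmetric] by (simp add: power2_eq_square)
      show "has_pd 1 (\<lambda>u. (p u + m * F u) * exp (- m * fst u)) 0 u"
        using F(1)[OF u] p(1)[OF u] unfolding has_pd_1_real
        by (auto intro!: derivative_eq_intros simp: qu algebra_simps)
      show "has_pd 2 (\<lambda>u. (p u + m * F u) * exp (- m * fst u)) 0 u"
        using F(2)[OF u] p(2)[OF u] unfolding has_pd_2_real
        by (auto intro!: derivative_eq_intros)
    qed
    obtain c1 where c1: "\<And>u. u \<in> D \<Longrightarrow> (p u + k * F u) * exp (- k * fst u) = c1"
      using const[of k] by blast
    obtain c2 where c2: "\<And>u. u \<in> D \<Longrightarrow> (p u + (- k) * F u) * exp (- (- k) * fst u) = c2"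
      using const[of "- k"] by auto
    have "F u = (c1 / (2 * k)) * exp (k * fst u) + (- c2 / (2 * k)) * exp (- k * fst u)
      \<and> p u = k * ((c1 / (2 * k)) * exp (k * fst u) - (- c2 / (2 * k)) * exp (- k * fst u))" if "u \<in> D" for u
    proof -
      have w: "c1 * exp (k * fst u) = p u + k * F u" "c2 * exp (- k * fst u) = p u - k * F u"
        using c1[OF that] c2[OF that] by (auto simp: exp_minus field_simps)
      have e: "(c1 / (2 * k)) * exp (k * fst u) = (p u + k * F u) / (2 * k)"
        "(- c2 / (2 * k)) * exp (- k * fst u) = - (p u - k * F u) / (2 * k)"
        unfolding w[symmetric] by simp_all
      show ?thesis unfolding e using \<open>k > 0\<close> by (simp add: field_simps)
    qed
    then show ?thesis by blast
  qed
qed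

lemma has_pd_swap:
  fixes F :: "real \<times> real \<Rightarrow> real"
  shows "has_pd 1 (\<lambda>u. F (snd u, fst u)) y u \<longleftrightarrow> has_pd 2 F y (snd u, fst u)"
    "has_pd 2 (\<lambda>u. F (snd u, fst u)) y u \<longleftrightarrow> has_pd 1 F y (snd u, fst u)"
  unfolding has_pd_1_real has_pd_2_real by simp_all

text \<open>The same statement with the coordinates exchanged, obtained by precomposing with the swap.\<close>

lemma separated_profile_snd:
  fixes F p q :: "real \<times> real \<Rightarrow> real"
  assumes D: "open D" "connected D" and "k > 0"
    and diff: "\<And>u. u \<in> D \<Longrightarrow> F differentiable (at u)" "\<And>u. u \<in> D \<Longrightarrow> p differentiable (at u)"
    and F: "\<And>u. u \<in> D \<Longrightarrow> has_pd 2 F (p u) u" "\<And>u. u \<in> D \<Longrightarrow> has_pd 1 F 0 u"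
    and p: "\<And>u. u \<in> D \<Longrightarrow> has_pd 2 p (q u) u" "\<And>u. u \<in> D \<Longrightarrow> has_pd 1 p 0 u"
    and F0: "\<And>u. u \<in> D \<Longrightarrow> F u \<noteq> 0"
    and pq: "\<And>u. u \<in> D \<Longrightarrow> p u * (q u - k\<^sup>2 * F u) = 0"
  shows "(\<forall>u\<in>D. p u = 0) \<or>
    (\<exists>P Q. \<forall>u\<in>D. F u = P * exp (k * snd u) + Q * exp (- k * snd u)
                \<and> p u = k * (P * exp (k * snd u) - Q * exp (- k * snd u)))"
proof -
  let ?s = "\<lambda>u :: real \<times> real. (snd u, fst u)"
  let ?D = "?s ` D"
  have s: "u \<in> ?D \<longleftrightarrow> ?s u \<in> D" for u by (force simp: image_iff)
  have cont: "continuous_on UNIV ?s" by (intro continuous_intros)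
  have "?D = ?s -` D" using s by blast
  then have "open ?D" using open_vimage[OF D(1) cont] by simp
  moreover have "connected ?D"
    by (rule connected_continuous_image[OF continuous_on_subset[OF cont] D(2)]) simp
  moreover have ds: "?s differentiable (at u)" for u
    by (rule bounded_linear_imp_differentiable) (intro bounded_linear_intros)
  have dsw: "(\<lambda>u. x (?s u)) differentiable (at u)" if "x differentiable (at (?s u))" for u and x :: "real \<times> real \<Rightarrow> real"
    by (rule differentiable_compose[where g="?s", OF that ds])
  ultimately have "(\<forall>u\<in>?D. p (?s u) = 0) \<or>
    (\<exists>P Q. \<forall>u\<in>?D. F (?s u) = P * exp (k * fst u) + Q * exp (- k * fst u)
                \<and> p (?s u) = k * (P * exp (k * fst u) - Q * exp (- k * fst u)))"
    by (intro separated_profile[where q="\<lambda>u. q (?s u)"])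
       (simp_all only: s has_pd_swap \<open>k > 0\<close> dsw diff F p F0 pq not_False_eq_True)
  then show ?thesis by auto
qed

lemma derivative_zero_on_open:
  fixes F :: "real \<Rightarrow> real"
  assumes "open I" "t \<in> I" "\<And>s. s \<in> I \<Longrightarrow> F s = 0" "(F has_real_derivative F') (at t)"
  shows "F' = 0"
proof -
  have "((\<lambda>_. 0) has_real_derivative F') (at t)"
    by (rule has_field_derivative_transform_within_open[OF assms(4,1,2)]) (rule assms(3))
  then show ?thesis using DERIV_const DERIV_unique by blast
qed

text \<open>For \<open>\<mu> \<noteq> 0\<close>, a nontrivial solution of \<open>x'' = \<mu> x\<close> is not constant on any interval: differentiate the relation
  \<open>K x + L = 0\<close> twice.\<close>

lemma second_order_zero_on_open:
  fixes x y :: "real \<Rightarrow> real"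
  assumes "open I" "t \<in> I" "\<And>s. s \<in> I \<Longrightarrow> K * x s + L = 0"
    and "\<And>s. (x has_real_derivative y s) (at s)" "\<And>s. (y has_real_derivative \<mu> * x s) (at s)"
  shows "K * \<mu> * x t = 0"
proof -
  have "K * y s = 0" if "s \<in> I" for s
    by (rule derivative_zero_on_open[OF assms(1) that assms(3)])
       (use assms(4) in \<open>auto intro!: derivative_eq_intros\<close>)
  then have "K * (\<mu> * x t) = 0"
    by (rule derivative_zero_on_open[OF assms(1,2)])
       (use assms(5) in \<open>auto intro!: derivative_eq_intros\<close>)
  then show ?thesis by simp
qed

section \<open>Flatness of orthogonal metrics\<close>

text \<open>For the metric \<open>e\<^sup>2 du\<^sub>1\<^sup>2 + h\<^sup>2 du\<^sub>2\<^sup>2\<close> the Gauss curvature is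
  \<open>- ((e\<^sub>,\<^sub>2 / h)\<^sub>,\<^sub>2 + (h\<^sub>,\<^sub>1 / e)\<^sub>,\<^sub>1) / (e h)\<close>. Writing \<open>e\<^sub>,\<^sub>2 = a h\<close> and \<open>h\<^sub>,\<^sub>1 = b e\<close> turns the
  bracket into \<open>a\<^sub>,\<^sub>2 + b\<^sub>,\<^sub>1\<close>, so that no second derivatives of \<open>e\<close> and \<open>h\<close> have to be computed.\<close>

lemma orthogonal_metric_flat:
  fixes e h a b e1 h2 :: "real \<times> real \<Rightarrow> real"
  assumes "open D" "u \<in> D"
    and E: "\<And>v. v \<in> D \<Longrightarrow> metric X 1 1 v = (e v)\<^sup>2" and F: "\<And>v. v \<in> D \<Longrightarrow> metric X 1 2 v = 0"
    and G: "\<And>v. v \<in> D \<Longrightarrow> metric X 2 2 v = (h v)\<^sup>2"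
    and nz: "\<And>v. v \<in> D \<Longrightarrow> e v \<noteq> 0" "\<And>v. v \<in> D \<Longrightarrow> h v \<noteq> 0"
    and de: "\<And>v. v \<in> D \<Longrightarrow> has_pd 1 e (e1 v) v" "\<And>v. v \<in> D \<Longrightarrow> has_pd 2 e (a v * h v) v"
    and dh: "\<And>v. v \<in> D \<Longrightarrow> has_pd 1 h (b v * e v) v" "\<And>v. v \<in> D \<Longrightarrow> has_pd 2 h (h2 v) v"
    and dab: "has_pd 2 a a2 u" "has_pd 1 b b1 u" "a2 + b1 = 0"
  shows "gauss_curvature X u = 0"
proof -
  have F': "metric X 2 1 v = 0" if "v \<in> D" for v
    using F[OF that] by (simp add: metric_def inner_commute)
  have dE: "pd 1 (metric X 1 1) v = 2 * e v * e1 v" "pd 2 (metric X 1 1) v = 2 * e v * (a v * h v)" if "v \<in> D" for v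
    using pd_cong[OF assms(1) that E[symmetric] has_pd_power2[OF de(1)[OF that]]]
      pd_cong[OF assms(1) that E[symmetric] has_pd_power2[OF de(2)[OF that]]] by blast+
  have dG: "pd 1 (metric X 2 2) v = 2 * h v * (b v * e v)" "pd 2 (metric X 2 2) v = 2 * h v * h2 v" if "v \<in> D" for v
    using pd_cong[OF assms(1) that G[symmetric] has_pd_power2[OF dh(1)[OF that]]]
      pd_cong[OF assms(1) that G[symmetric] has_pd_power2[OF dh(2)[OF that]]] by blast+
  have dF: "pd i (metric X 1 2) v = 0" "pd i (metric X 2 1) v = 0" if "v \<in> D" for i v
    by (rule pd_cong[OF assms(1) that _ has_pd_const], simp add: F F' del: One_nat_def)+
  note metric_simps = E F G F' dE dG dF
  have inv: "inv_metric X 1 1 v = 1 / (e v)\<^sup>2" "inv_metric X 2 2 v = 1 / (h v)\<^sup>2"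
    "inv_metric X 1 2 v = 0" "inv_metric X 2 1 v = 0" if "v \<in> D" for v
    using metric_simps[OF that, unfolded One_nat_def] nz[OF that]
    by (simp_all add: inv_metric_def metric_det_def)
  have chr: "christoffel X 1 2 2 v = - (h v * b v / e v)"
    "christoffel X 1 1 2 v = a v * h v / e v"
    "christoffel X 1 2 1 v = a v * h v / e v"
    "christoffel X 1 1 1 v = e1 v / e v"
    "christoffel X 2 2 2 v = h2 v / h v"
    "christoffel X 2 1 2 v = b v * e v / h v" if "v \<in> D" for v
    using metric_simps[OF that] nz[OF that] inv[OF that]
    by (simp_all add: christoffel_def field_simps power2_eq_square del: One_nat_def)
  have d1: "pd 1 (christoffel X 1 2 2) u =
      - (((h u * b1 + b u * e u * b u) * e u - h u * b u * e1 u) / (e u)\<^sup>2)"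
  proof (rule pd_cong[OF assms(1,2) chr(1)[symmetric]])
    have "has_pd 1 (\<lambda>u. h u * b u / e u) (((h u * b1 + b u * e u * b u) * e u - h u * b u * e1 u) / (e u)\<^sup>2) u"
      by (rule has_pd_divide[OF has_pd_mult[OF dh(1) dab(2)] de(1) nz(1)]) (rule assms(2))+
    from has_pd_diff[OF has_pd_const this, of 0]
    show "has_pd 1 (\<lambda>u. - (h u * b u / e u)) (- (((h u * b1 + b u * e u * b u) * e u - h u * b u * e1 u) / (e u)\<^sup>2)) u"
      by simp
  qed
  have d2: "pd 2 (christoffel X 1 1 2) u =
      ((a u * h2 u + a2 * h u) * e u - a u * h u * (a u * h u)) / (e u)\<^sup>2"
    by (rule pd_cong[OF assms(1,2) chr(2)[symmetric] has_pd_divide[OF has_pd_mult[OF dab(1) dh(2)] de(2) nz(1)]])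
      (use assms(2) in auto)
  have b1: "b1 = - a2" using dab(3) by simp
  have "curv_comp X 1 u = 0"
    using nz[OF assms(2)] unfolding curv_comp_def d1 d2
    by (simp add: chr[OF assms(2)] b1 field_simps power2_eq_square del: One_nat_def)
  then show ?thesis
    using F'[OF assms(2)] by (simp add: gauss_curvature_def del: One_nat_def)
qed

section \<open>Reflections and the moving frame of the torus\<close>

text \<open>The reflection in the hyperplane orthogonal to \<open>n\<close>; for \<open>n = 0\<close>, where the coefficient is a division
  by zero, it is the identity and hence still an isometry.\<close>

definition reflect :: "'a::real_inner \<Rightarrow> 'a \<Rightarrow> 'a" where
  "reflect n v = v - (2 * (v \<bullet> n) / (n \<bullet> n)) *\<^sub>R n"

lemma reflect_inner: "reflect n v \<bullet> reflect n w = v \<bullet> w"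
  by (cases "n = 0") (simp_all add: reflect_def inner_diff_left inner_diff_right inner_commute)

text \<open>The point at angle \<open>t\<close> of the unit circle in the \<open>(i, j)\<close> coordinate plane, and its unit tangent.\<close>

definition radial :: "4 \<Rightarrow> 4 \<Rightarrow> real \<Rightarrow> real^4" where
  "radial i j t = cos t *\<^sub>R axis i 1 + sin t *\<^sub>R axis j 1"

definition tangential :: "4 \<Rightarrow> 4 \<Rightarrow> real \<Rightarrow> real^4" where
  "tangential i j t = - sin t *\<^sub>R axis i 1 + cos t *\<^sub>R axis j 1"

lemma radial_deriv:
  "((\<lambda>t. radial i j (k * t)) has_vector_derivative k *\<^sub>R tangential i j (k * t)) (at t)"
  unfolding radial_def tangential_def
  by (auto intro!: derivative_eq_intros simp: scaleR_add_right algebra_simps)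

lemma tangential_deriv:
  "((\<lambda>t. tangential i j (k * t)) has_vector_derivative - k *\<^sub>R radial i j (k * t)) (at t)"
  unfolding radial_def tangential_def
  by (auto intro!: derivative_eq_intros simp: scaleR_add_right algebra_simps)

lemma vector_4_nth:
  "(vector [x, y, z, w] :: real^4) $ 1 = x" "(vector [x, y, z, w] :: real^4) $ 2 = y"
  "(vector [x, y, z, w] :: real^4) $ 3 = z" "(vector [x, y, z, w] :: real^4) $ 4 = w"
  by (simp_all add: vector_def)

lemma axis_inner_axis: "(axis i 1 :: real^4) \<bullet> axis j 1 = (if i = j then 1 else 0)"
  by (simp add: inner_axis_axis)

locale torus_radii =
  fixes r1 r2 :: real
  assumes r1: "r1 > 0" and r2: "r2 > 0" and r12: "r1\<^sup>2 + r2\<^sup>2 = 1"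
begin

text \<open>The orthonormal frame of \<open>\<real>\<^sup>4\<close> adapted to the torus: both the position vector and the normal are
  combinations of \<open>C1\<close> and \<open>C2\<close> with constant coefficients, and \<open>S1\<close>, \<open>S2\<close> are the principal directions.\<close>

definition C1 where "C1 u = radial 1 2 (r2 * fst u)"
definition S1 where "S1 u = tangential 1 2 (r2 * fst u)"
definition C2 where "C2 u = radial 3 4 (r1 * snd u)"
definition S2 where "S2 u = tangential 3 4 (r1 * snd u)"

lemmas frame_defs = C1_def S1_def C2_def S2_def radial_def tangential_def

lemma frame_inner:
  "C1 u \<bullet> C1 u = 1" "S1 u \<bullet> S1 u = 1" "C2 u \<bullet> C2 u = 1" "S2 u \<bullet> S2 u = 1"
  "C1 u \<bullet> S1 u = 0" "S1 u \<bullet> C1 u = 0" "C1 u \<bullet> C2 u = 0" "C2 u \<bullet> C1 u = 0"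
  "C1 u \<bullet> S2 u = 0" "S2 u \<bullet> C1 u = 0" "S1 u \<bullet> C2 u = 0" "C2 u \<bullet> S1 u = 0"
  "S1 u \<bullet> S2 u = 0" "S2 u \<bullet> S1 u = 0" "C2 u \<bullet> S2 u = 0" "S2 u \<bullet> C2 u = 0"
  by (simp_all add: frame_defs inner_add_left inner_add_right inner_diff_left inner_diff_right axis_inner_axis power2_eq_square[symmetric])

lemma torus_frame_eq: "torus r1 r2 u = r1 *\<^sub>R C1 u + r2 *\<^sub>R C2 u"
  by (cases u) (simp add: torus_def frame_defs vec_eq_iff forall_4 vector_4_nth axis_def)

lemma torus_normal_frame_eq: "torus_normal r1 r2 u = r1 *\<^sub>R C2 u - r2 *\<^sub>R C1 u"
  by (cases u) (simp add: torus_normal_def frame_defs vec_eq_iff forall_4 vector_4_nth axis_def)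

lemma frame_pd:
  "has_pd i C1 (if i = 1 then r2 *\<^sub>R S1 u else 0) u"
  "has_pd i S1 (if i = 1 then - r2 *\<^sub>R C1 u else 0) u"
  "has_pd i C2 (if i = 1 then 0 else r1 *\<^sub>R S2 u) u"
  "has_pd i S2 (if i = 1 then 0 else - r1 *\<^sub>R C2 u) u"
proof -
  have c: "coord 1 u = fst u" "coord 2 u = snd u" for u by (simp_all add: coord_def)
  show "has_pd i C1 (if i = 1 then r2 *\<^sub>R S1 u else 0) u"
    using has_pd_coord[OF radial_deriv[of 1 2 r2], where j=1 and u=u and i=i]
    unfolding c C1_def[abs_def] S1_def by simp
  show "has_pd i S1 (if i = 1 then - r2 *\<^sub>R C1 u else 0) u"
    using has_pd_coord[OF tangential_deriv[of 1 2 r2], where j=1 and u=u and i=i]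
    unfolding c C1_def S1_def[abs_def] by simp
  show "has_pd i C2 (if i = 1 then 0 else r1 *\<^sub>R S2 u) u"
    using has_pd_coord[OF radial_deriv[of 3 4 r1], where j=2 and u=u and i=i]
    unfolding c C2_def[abs_def] S2_def by (auto split: if_splits)
  show "has_pd i S2 (if i = 1 then 0 else - r1 *\<^sub>R C2 u) u"
    using has_pd_coord[OF tangential_deriv[of 3 4 r1], where j=2 and u=u and i=i]
    unfolding c C2_def S2_def[abs_def] by (auto split: if_splits)
qed

lemma torus_pd:
  "has_pd 1 (torus r1 r2) ((r1 * r2) *\<^sub>R S1 u) u" "has_pd 2 (torus r1 r2) ((r1 * r2) *\<^sub>R S2 u) u"
proof -
  have t: "torus r1 r2 = (\<lambda>u. r1 *\<^sub>R C1 u + r2 *\<^sub>R C2 u)" by (rule ext) (rule torus_frame_eq)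
  show "has_pd 1 (torus r1 r2) ((r1 * r2) *\<^sub>R S1 u) u"
    unfolding t using has_pd_add[OF has_pd_scaleR[OF has_pd_const[of 1 r1 u] frame_pd(1)]
      has_pd_scaleR[OF has_pd_const[of 1 r2 u] frame_pd(3)]] by simp
  show "has_pd 2 (torus r1 r2) ((r1 * r2) *\<^sub>R S2 u) u"
    unfolding t using has_pd_add[OF has_pd_scaleR[OF has_pd_const[of 2 r1 u] frame_pd(1)]
      has_pd_scaleR[OF has_pd_const[of 2 r2 u] frame_pd(3)]] by (simp add: mult.commute)
qed

lemma torus_frame_1: "torus_frame r1 r2 1 u = S1 u" and torus_frame_2: "torus_frame r1 r2 2 u = S2 u"
  unfolding torus_frame_def torus_pd[THEN has_pd_imp_pd] using r1 r2 by simp_all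

lemma frame_smooth:
  assumes "open D"
  shows "ck_on k D C1" "ck_on k D S1" "ck_on k D C2" "ck_on k D S2"
proof -
  have "ck_on k D (\<lambda>u. cos (m * coord i u)) \<and> ck_on k D (\<lambda>u. (- m) * sin (m * coord i u))" for m :: real and i
    by (rule ck_on_second_order_ode[OF assms, where \<mu>="- m\<^sup>2"])
       (auto intro!: derivative_eq_intros simp: power2_eq_square)
  then have s: "ck_on k D (\<lambda>u. cos (m * coord i u))" and m: "ck_on k D (\<lambda>u. (- m) * sin (m * coord i u))" for m :: real and i
    by blast+
  have sn: "ck_on k D (\<lambda>u. sin (m * coord i u))" if "m > 0" for m i
    using ck_on_mult[OF assms ck_on_const[OF assms, of k "- 1 / m"] m[of m i]] that by simp
  have c: "coord 1 = fst" "coord 2 = snd" by (auto simp: coord_def)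
  note sc = s[of r2 1, unfolded c] sn[OF r2, of 1, unfolded c] s[of r1 2, unfolded c] sn[OF r1, of 2, unfolded c]
  note sm = ck_on_add[OF assms] ck_on_scaleR[OF assms] ck_on_const[OF assms] sc
    ck_on_diff[OF assms ck_on_const[OF assms, of _ 0], simplified]
  show "ck_on k D C1" unfolding C1_def[abs_def] radial_def by (rule sm)+
  show "ck_on k D C2" unfolding C2_def[abs_def] radial_def by (rule sm)+
  show "ck_on k D S1" unfolding S1_def[abs_def] tangential_def by (rule sm)+
  show "ck_on k D S2" unfolding S2_def[abs_def] tangential_def by (rule sm)+
qed

end

section \<open>The transformed surface as a reflected torus\<close>

text \<open>The properties of \<open>f\<close> and \<open>g\<close> that the geometry uses. They are shared by the three families and
  are preserved by translations and reflections of the arguments and by a common factor. The last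
  assumption is the additional relation, as \<open>\<Omega>\<^sup>2 + W\<^sup>2 = r\<^sub>2\<^sup>2 f\<^sup>2 + r\<^sub>1\<^sup>2 g\<^sup>2\<close>.\<close>

locale ribaucour_profile = torus_radii +
  fixes c :: real and f g f' g' :: "real \<Rightarrow> real"
  assumes c: "c > 0"
    and df: "(f has_real_derivative f' t) (at t)" and ddf: "(f' has_real_derivative c * r2\<^sup>2 * f t) (at t)"
    and dg: "(g has_real_derivative g' t) (at t)" and ddg: "(g' has_real_derivative c * r1\<^sup>2 * g t) (at t)"
    and energy: "(f' s)\<^sup>2 + (g' t)\<^sup>2 = c * (r2\<^sup>2 * (f s)\<^sup>2 + r1\<^sup>2 * (g t)\<^sup>2)"
begin

abbreviation "Om \<equiv> Omega r1 r2 f g"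
abbreviation "W \<equiv> Wfun r1 r2 f g"
abbreviation "S \<equiv> Sfun r1 r2 c f g"
abbreviation "V \<equiv> Vset r1 r2 f g"
abbreviation "XT \<equiv> Xtilde r1 r2 c f g"
abbreviation "NT \<equiv> Ntilde r1 r2 c f g"

definition Q where "Q u = r2\<^sup>2 * (f (fst u))\<^sup>2 + r1\<^sup>2 * (g (snd u))\<^sup>2"

text \<open>The normal of the mirror at \<open>u\<close>; in terms of the torus it is
  \<open>\<Omega>X + \<Omega>\<^sub>1e\<^sub>1 + \<Omega>\<^sub>2e\<^sub>2 - WN\<close>, see \<open>\<xi>_eq\<close> below.\<close>

definition \<xi> where
  "\<xi> u = (r2 * f (fst u)) *\<^sub>R C1 u + f' (fst u) *\<^sub>R S1 u + (r1 * g (snd u)) *\<^sub>R C2 u + g' (snd u) *\<^sub>R S2 u"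

text \<open>The signed lengths of the two partial derivatives of the transformed surface, cf. \<open>XT_pd\<close>. Up to the
  factor \<open>r\<^sub>1 r\<^sub>2 / Q\<close> they are the two factors in the definition of \<^const>\<open>Vset\<close>.\<close>

definition e where
  "e u = r1 * r2 * (r1\<^sup>2 * (g (snd u))\<^sup>2 - r2\<^sup>2 * (f (fst u))\<^sup>2 - 2 * r2\<^sup>2 * f (fst u) * g (snd u)) / Q u"

definition h where
  "h u = r1 * r2 * (r2\<^sup>2 * (f (fst u))\<^sup>2 - r1\<^sup>2 * (g (snd u))\<^sup>2 - 2 * r1\<^sup>2 * f (fst u) * g (snd u)) / Q u"

lemma Om_eq: "Om u = r1 * r2 * (f (fst u) + g (snd u))"
  by (cases u) (simp add: Omega_def)

lemma W_eq: "W u = r2\<^sup>2 * f (fst u) - r1\<^sup>2 * g (snd u)"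
  by (cases u) (simp add: Wfun_def)

text \<open>The pair \<open>(r\<^sub>2 f, r\<^sub>1 g)\<close> arises from \<open>(\<Omega>, W)\<close> by an orthogonal matrix with entries \<open>\<plusminus> r\<^sub>1, \<plusminus> r\<^sub>2\<close>.\<close>

lemma Om_W_f: "r1 * Om u + r2 * W u = r2 * f (fst u)"
proof -
  have "r1 * Om u + r2 * W u = (r1\<^sup>2 + r2\<^sup>2) * (r2 * f (fst u))"
    by (simp add: Om_eq W_eq power2_eq_square algebra_simps)
  then show ?thesis by (simp add: r12)
qed

lemma Om_W_g: "r2 * Om u - r1 * W u = r1 * g (snd u)"
proof -
  have "r2 * Om u - r1 * W u = (r1\<^sup>2 + r2\<^sup>2) * (r1 * g (snd u))"
    by (simp add: Om_eq W_eq power2_eq_square algebra_simps)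
  then show ?thesis by (simp add: r12)
qed

lemma Om_W_Q: "(Om u)\<^sup>2 + (W u)\<^sup>2 = Q u"
proof -
  have "(Om u)\<^sup>2 + (W u)\<^sup>2 = (r1\<^sup>2 + r2\<^sup>2) * Q u"
    by (simp add: Om_eq W_eq Q_def power2_eq_square algebra_simps)
  then show ?thesis by (simp add: r12)
qed

lemma S_eq: "S u = (1 + c) * Q u"
  by (simp add: Sfun_def Om_W_Q)

lemma energy_Q: "(f' (fst u))\<^sup>2 + (g' (snd u))\<^sup>2 = c * Q u"
  by (simp add: energy Q_def)

lemma S_nonzero: "Q u \<noteq> 0 \<Longrightarrow> S u \<noteq> 0"
  using c by (simp add: S_eq)

lemma V_iff: "u \<in> V \<longleftrightarrow> Q u \<noteq> 0 \<and> e u \<noteq> 0 \<and> h u \<noteq> 0"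
proof -
  have "Q u = 0 \<longleftrightarrow> f (fst u) = 0 \<and> g (snd u) = 0"
    using r1 r2 by (simp add: Q_def add_nonneg_eq_0_iff)
  then show ?thesis using r1 r2 by (cases u) (auto simp: Vset_def e_def h_def)
qed

lemma nondegenerate_iff:
  "nondegenerate_at r1 r2 Om W u \<longleftrightarrow> W u \<noteq> 0 \<and> f (fst u) \<noteq> 0 \<and> g (snd u) \<noteq> 0"
proof -
  have "W u + lam r1 r2 1 * Om u = - (r1\<^sup>2 + r2\<^sup>2) * g (snd u)"
    using r1 by (simp add: lam_def Om_eq W_eq power2_eq_square field_simps)
  moreover have "W u + lam r1 r2 2 * Om u = (r1\<^sup>2 + r2\<^sup>2) * f (fst u)"
    using r2 by (simp add: lam_def Om_eq W_eq power2_eq_square field_simps)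
  ultimately show ?thesis unfolding nondegenerate_at_def r12
    by (simp del: One_nat_def) blast
qed

lemma inner_\<xi>:
  "torus r1 r2 u \<bullet> \<xi> u = Om u" "torus_normal r1 r2 u \<bullet> \<xi> u = - W u"
  "S1 u \<bullet> \<xi> u = f' (fst u)" "S2 u \<bullet> \<xi> u = g' (snd u)" "\<xi> u \<bullet> \<xi> u = S u"
proof -
  note s = \<xi>_def torus_frame_eq torus_normal_frame_eq inner_add_left inner_add_right
    inner_diff_left frame_inner
  show "torus r1 r2 u \<bullet> \<xi> u = Om u" by (simp add: s Om_eq algebra_simps)
  show "torus_normal r1 r2 u \<bullet> \<xi> u = - W u" by (simp add: s W_eq power2_eq_square algebra_simps)
  show "S1 u \<bullet> \<xi> u = f' (fst u)" "S2 u \<bullet> \<xi> u = g' (snd u)" by (simp_all add: s)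
  have "\<xi> u \<bullet> \<xi> u = Q u + ((f' (fst u))\<^sup>2 + (g' (snd u))\<^sup>2)"
    by (simp add: s Q_def power2_eq_square algebra_simps)
  then show "\<xi> u \<bullet> \<xi> u = S u" by (simp add: energy_Q S_eq algebra_simps)
qed

lemma \<xi>_eq: "\<xi> u = Om u *\<^sub>R torus r1 r2 u + f' (fst u) *\<^sub>R S1 u + g' (snd u) *\<^sub>R S2 u - W u *\<^sub>R torus_normal r1 r2 u"
  unfolding \<xi>_def Om_W_f[symmetric] Om_W_g[symmetric] torus_frame_eq torus_normal_frame_eq
  by (simp add: algebra_simps)

lemma deriv_f: "deriv f t = f' t" and deriv_g: "deriv g t = g' t"
  using DERIV_imp_deriv[OF df] DERIV_imp_deriv[OF dg] by auto

lemma XT_eq: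
  assumes "Q u \<noteq> 0"
  shows "XT u = torus r1 r2 u - (2 * Om u / S u) *\<^sub>R \<xi> u"
proof -
  have 1: "r1 * S u - 2 * r1 * (Om u)\<^sup>2 - 2 * r2 * Om u * W u = r1 * S u - 2 * Om u * (r2 * f (fst u))"
    "r2 * S u - 2 * r2 * (Om u)\<^sup>2 + 2 * r1 * Om u * W u = r2 * S u - 2 * Om u * (r1 * g (snd u))"
    unfolding Om_W_f[symmetric] Om_W_g[symmetric] by (simp_all add: power2_eq_square algebra_simps)
  obtain a b where u: "u = (a, b)" by (cases u)
  show ?thesis
    using S_nonzero[OF assms] unfolding u
    by (simp add: Xtilde_def Let_def 1[unfolded u] deriv_f deriv_g torus_def \<xi>_def frame_defs
        vec_eq_iff forall_4 vector_4_nth axis_def diff_divide_distrib add_divide_distrib) (simp add: field_simps)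
qed

lemma NT_eq:
  assumes "Q u \<noteq> 0"
  shows "NT u = torus_normal r1 r2 u + (2 * W u / S u) *\<^sub>R \<xi> u"
proof -
  have 1: "- r2 * S u + 2 * r2 * (W u)\<^sup>2 + 2 * r1 * Om u * W u = - r2 * S u + 2 * W u * (r2 * f (fst u))"
    "r1 * S u - 2 * r1 * (W u)\<^sup>2 + 2 * r2 * Om u * W u = r1 * S u + 2 * W u * (r1 * g (snd u))"
    unfolding Om_W_f[symmetric] Om_W_g[symmetric] by (simp_all add: power2_eq_square algebra_simps)
  obtain a b where u: "u = (a, b)" by (cases u)
  show ?thesis
    using S_nonzero[OF assms] unfolding u Ntilde_def Let_def prod.case 1[unfolded u]
    by (simp add: deriv_f deriv_g torus_normal_def \<xi>_def frame_defs
        vec_eq_iff forall_4 vector_4_nth axis_def) (simp add: field_simps)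
qed

lemma XT_reflect: "Q u \<noteq> 0 \<Longrightarrow> XT u = reflect (\<xi> u) (torus r1 r2 u)"
  and NT_reflect: "Q u \<noteq> 0 \<Longrightarrow> NT u = reflect (\<xi> u) (torus_normal r1 r2 u)"
  by (simp_all add: XT_eq NT_eq reflect_def inner_\<xi>)

end

section \<open>First fundamental form, flatness and normal map\<close>

context ribaucour_profile
begin

lemma pd_profile:
  "has_pd 1 (\<lambda>u. f (fst u)) (f' (fst u)) u" "has_pd 2 (\<lambda>u. f (fst u)) 0 u"
  "has_pd 1 (\<lambda>u. f' (fst u)) (c * r2\<^sup>2 * f (fst u)) u" "has_pd 2 (\<lambda>u. f' (fst u)) 0 u"
  "has_pd 1 (\<lambda>u. g (snd u)) 0 u" "has_pd 2 (\<lambda>u. g (snd u)) (g' (snd u)) u"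
  "has_pd 1 (\<lambda>u. g' (snd u)) 0 u" "has_pd 2 (\<lambda>u. g' (snd u)) (c * r1\<^sup>2 * g (snd u)) u"
  unfolding has_pd_1_real has_pd_2_real fst_conv snd_conv by (rule df ddf dg ddg DERIV_const)+

lemma pd_scalars:
  "has_pd 1 Om (r1 * r2 * f' (fst u)) u" "has_pd 2 Om (r1 * r2 * g' (snd u)) u"
  "has_pd 1 W (r2\<^sup>2 * f' (fst u)) u" "has_pd 2 W (- (r1\<^sup>2 * g' (snd u))) u"
  "has_pd 1 Q (2 * r2\<^sup>2 * f (fst u) * f' (fst u)) u" "has_pd 2 Q (2 * r1\<^sup>2 * g (snd u) * g' (snd u)) u"
  "has_pd 1 S ((1 + c) * (2 * r2\<^sup>2 * f (fst u) * f' (fst u))) u"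
  "has_pd 2 S ((1 + c) * (2 * r1\<^sup>2 * g (snd u) * g' (snd u))) u"
proof -
  note pf = pd_profile[of u]
  have eq: "Om = (\<lambda>u. r1 * r2 * (f (fst u) + g (snd u)))" "W = (\<lambda>u. r2\<^sup>2 * f (fst u) - r1\<^sup>2 * g (snd u))"
    "Q = (\<lambda>u. r2\<^sup>2 * (f (fst u))\<^sup>2 + r1\<^sup>2 * (g (snd u))\<^sup>2)" "S = (\<lambda>u. (1 + c) * Q u)"
    by (auto simp: Om_eq W_eq Q_def S_eq)
  show "has_pd 1 Om (r1 * r2 * f' (fst u)) u" "has_pd 2 Om (r1 * r2 * g' (snd u)) u"
    using has_pd_mult[OF has_pd_const has_pd_add[OF pf(1) pf(5)], of "r1 * r2"]
      has_pd_mult[OF has_pd_const has_pd_add[OF pf(2) pf(6)], of "r1 * r2"]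
    unfolding eq by simp_all
  show "has_pd 1 W (r2\<^sup>2 * f' (fst u)) u" "has_pd 2 W (- (r1\<^sup>2 * g' (snd u))) u"
    using has_pd_diff[OF has_pd_mult[OF has_pd_const pf(1)] has_pd_mult[OF has_pd_const pf(5)], of "r2\<^sup>2" "r1\<^sup>2"]
      has_pd_diff[OF has_pd_mult[OF has_pd_const pf(2)] has_pd_mult[OF has_pd_const pf(6)], of "r2\<^sup>2" "r1\<^sup>2"]
    unfolding eq by simp_all
  show Q: "has_pd 1 Q (2 * r2\<^sup>2 * f (fst u) * f' (fst u)) u" "has_pd 2 Q (2 * r1\<^sup>2 * g (snd u) * g' (snd u)) u"
    using has_pd_add[OF has_pd_mult[OF has_pd_const has_pd_power2[OF pf(1)]]
        has_pd_mult[OF has_pd_const has_pd_power2[OF pf(5)]], of "r2\<^sup>2" "r1\<^sup>2"]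
      has_pd_add[OF has_pd_mult[OF has_pd_const has_pd_power2[OF pf(2)]]
        has_pd_mult[OF has_pd_const has_pd_power2[OF pf(6)]], of "r2\<^sup>2" "r1\<^sup>2"]
    unfolding eq by (simp_all add: mult_ac)
  show "has_pd 1 S ((1 + c) * (2 * r2\<^sup>2 * f (fst u) * f' (fst u))) u"
    "has_pd 2 S ((1 + c) * (2 * r1\<^sup>2 * g (snd u) * g' (snd u))) u"
    using has_pd_mult[OF has_pd_const Q(1), of "1 + c"] has_pd_mult[OF has_pd_const Q(2), of "1 + c"]
    unfolding eq(4) by simp_all
qed

text \<open>The terms in \<open>C1\<close> and \<open>C2\<close> cancel because the frame rotates, and \<open>f'' = c r\<^sub>2\<^sup>2 f\<close> turns the
  coefficient \<open>r\<^sub>2\<^sup>2 f + f''\<close> of \<open>S1\<close> into a multiple of \<open>f\<close>; likewise for \<open>S2\<close>.\<close>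

lemma pd_\<xi>:
  "has_pd 1 \<xi> (((1 + c) * r2\<^sup>2 * f (fst u)) *\<^sub>R S1 u) u"
  "has_pd 2 \<xi> (((1 + c) * r1\<^sup>2 * g (snd u)) *\<^sub>R S2 u) u"
proof -
  have m: "has_pd 1 (\<lambda>u. r2 * f (fst u)) (r2 * f' (fst u)) u" "has_pd 2 (\<lambda>u. r2 * f (fst u)) 0 u"
    "has_pd 1 (\<lambda>u. r1 * g (snd u)) 0 u" "has_pd 2 (\<lambda>u. r1 * g (snd u)) (r1 * g' (snd u)) u"
    unfolding has_pd_1_real has_pd_2_real fst_conv snd_conv
    by (auto intro!: derivative_eq_intros df dg)
  have f1: "has_pd 1 C1 (r2 *\<^sub>R S1 u) u" "has_pd 1 S1 (- r2 *\<^sub>R C1 u) u" "has_pd 1 C2 0 u" "has_pd 1 S2 0 u"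
    and f2: "has_pd 2 C1 0 u" "has_pd 2 S1 0 u" "has_pd 2 C2 (r1 *\<^sub>R S2 u) u" "has_pd 2 S2 (- r1 *\<^sub>R C2 u) u"
    using frame_pd[of 1 u] frame_pd[of 2 u] by simp_all
  show "has_pd 1 \<xi> (((1 + c) * r2\<^sup>2 * f (fst u)) *\<^sub>R S1 u) u"
    using has_pd_add[OF has_pd_add[OF has_pd_add[OF has_pd_scaleR[OF m(1) f1(1)]
        has_pd_scaleR[OF pd_profile(3) f1(2)]] has_pd_scaleR[OF m(3) f1(3)]] has_pd_scaleR[OF pd_profile(7) f1(4)]]
    unfolding \<xi>_def[abs_def] by (simp add: algebra_simps power2_eq_square)
  show "has_pd 2 \<xi> (((1 + c) * r1\<^sup>2 * g (snd u)) *\<^sub>R S2 u) u"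
    using has_pd_add[OF has_pd_add[OF has_pd_add[OF has_pd_scaleR[OF m(2) f2(1)]
        has_pd_scaleR[OF pd_profile(4) f2(2)]] has_pd_scaleR[OF m(4) f2(3)]] has_pd_scaleR[OF pd_profile(8) f2(4)]]
    unfolding \<xi>_def[abs_def] by (simp add: algebra_simps power2_eq_square)
qed

lemma profile_smooth:
  assumes "open D"
  shows "ck_on k D (\<lambda>u. f (fst u))" "ck_on k D (\<lambda>u. f' (fst u))"
    "ck_on k D (\<lambda>u. g (snd u))" "ck_on k D (\<lambda>u. g' (snd u))"
  using ck_on_second_order_ode[OF assms df ddf, of k 1] ck_on_second_order_ode[OF assms dg ddg, of k 2]
  by (simp_all add: coord_def)

lemma scalars_smooth:
  assumes "open D"
  shows "ck_on k D Om" "ck_on k D W" "ck_on k D Q" "ck_on k D S" "ck_on k D \<xi>"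
    "ck_on k D (torus r1 r2)" "ck_on k D (torus_normal r1 r2)"
proof -
  note sm = ck_on_add[OF assms] ck_on_diff[OF assms] ck_on_mult[OF assms] ck_on_scaleR[OF assms]
    ck_on_const[OF assms] profile_smooth[OF assms] frame_smooth[OF assms]
  have eq: "Om = (\<lambda>u. r1 * r2 * (f (fst u) + g (snd u)))" "W = (\<lambda>u. r2\<^sup>2 * f (fst u) - r1\<^sup>2 * g (snd u))"
    "Q = (\<lambda>u. r2\<^sup>2 * (f (fst u) * f (fst u)) + r1\<^sup>2 * (g (snd u) * g (snd u)))"
    "S = (\<lambda>u. (1 + c) * Q u)" "torus r1 r2 = (\<lambda>u. r1 *\<^sub>R C1 u + r2 *\<^sub>R C2 u)"
    "torus_normal r1 r2 = (\<lambda>u. r1 *\<^sub>R C2 u - r2 *\<^sub>R C1 u)"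
    by (auto simp: Om_eq W_eq Q_def S_eq torus_frame_eq torus_normal_frame_eq power2_eq_square)
  show "ck_on k D Om" unfolding eq by (intro sm)
  show "ck_on k D W" unfolding eq by (intro sm)
  show Q: "ck_on k D Q" unfolding eq by (intro sm)
  show "ck_on k D S" unfolding eq(4) by (intro sm Q)
  show "ck_on k D \<xi>" unfolding \<xi>_def[abs_def] by (intro sm)
  show "ck_on k D (torus r1 r2)" unfolding eq by (intro sm)
  show "ck_on k D (torus_normal r1 r2)" unfolding eq by (intro sm)
qed

lemma open_Q: "open {u. Q u \<noteq> 0}" and open_e: "open {u. Q u \<noteq> 0 \<and> e u \<noteq> 0 \<and> h u \<noteq> 0}"
  and open_nondegenerate: "open {u. nondegenerate_at r1 r2 Om W u}"
proof -
  have c: "continuous_on UNIV (\<lambda>u :: real \<times> real. f (fst u))"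
    "continuous_on UNIV (\<lambda>u :: real \<times> real. g (snd u))"
    "continuous_on UNIV W" "continuous_on UNIV Q"
    using profile_smooth[of UNIV 0] scalars_smooth[of UNIV 0] by auto
  show "open {u. Q u \<noteq> 0}" by (intro open_Collect_neq c continuous_intros)
  have "{u. Q u \<noteq> 0 \<and> e u \<noteq> 0 \<and> h u \<noteq> 0} =
    {u. Q u \<noteq> 0 \<and> r1\<^sup>2 * (g (snd u))\<^sup>2 - r2\<^sup>2 * (f (fst u))\<^sup>2 - 2 * r2\<^sup>2 * f (fst u) * g (snd u) \<noteq> 0
      \<and> r2\<^sup>2 * (f (fst u))\<^sup>2 - r1\<^sup>2 * (g (snd u))\<^sup>2 - 2 * r1\<^sup>2 * f (fst u) * g (snd u) \<noteq> 0}"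
    using r1 r2 by (auto simp: e_def h_def)
  also have "open \<dots>" by (intro open_Collect_conj open_Collect_neq c continuous_intros)
  finally show "open {u. Q u \<noteq> 0 \<and> e u \<noteq> 0 \<and> h u \<noteq> 0}" .
  show "open {u. nondegenerate_at r1 r2 Om W u}"
    unfolding nondegenerate_iff by (intro open_Collect_conj open_Collect_neq c continuous_intros)
qed

lemma open_V: "open V"
proof -
  have "V = {u. Q u \<noteq> 0 \<and> e u \<noteq> 0 \<and> h u \<noteq> 0}" using V_iff by blast
  then show ?thesis using open_e by simp
qed

lemma XT_smooth: "smooth_on {u. Q u \<noteq> 0} XT" and NT_smooth: "smooth_on {u. Q u \<noteq> 0} NT"
proof -
  note sm = scalars_smooth[OF open_Q] ck_on_diff[OF open_Q] ck_on_add[OF open_Q] ck_on_scaleR[OF open_Q]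
    ck_on_divide[OF open_Q] ck_on_mult[OF open_Q] ck_on_const[OF open_Q]
  show "smooth_on {u. Q u \<noteq> 0} XT" unfolding smooth_on_def
  proof
    fix k
    have "ck_on k {u. Q u \<noteq> 0} (\<lambda>u. torus r1 r2 u - (2 * Om u / S u) *\<^sub>R \<xi> u)"
      by (intro sm) (auto dest: S_nonzero)
    then show "ck_on k {u. Q u \<noteq> 0} XT" by (rule ck_on_cong[OF open_Q, rotated]) (simp add: XT_eq)
  qed
  show "smooth_on {u. Q u \<noteq> 0} NT" unfolding smooth_on_def
  proof
    fix k
    have "ck_on k {u. Q u \<noteq> 0} (\<lambda>u. torus_normal r1 r2 u + (2 * W u / S u) *\<^sub>R \<xi> u)"
      by (intro sm) (auto dest: S_nonzero)
    then show "ck_on k {u. Q u \<noteq> 0} NT" by (rule ck_on_cong[OF open_Q, rotated]) (simp add: NT_eq)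
  qed
qed

lemma collect_reflection:
  fixes x y :: "'a::real_vector"
  assumes "p - A * B = q" "C = q * F"
  shows "p *\<^sub>R x - (A *\<^sub>R (B *\<^sub>R x) + C *\<^sub>R y) = q *\<^sub>R (x - F *\<^sub>R y)"
  unfolding assms(1)[symmetric] assms(2) by (simp add: algebra_simps)

text \<open>With \<open>XT = X - (2\<Omega>/S) \<xi>\<close> the product rule yields a combination of \<open>S1\<close> and \<open>\<xi>\<close>. Its coefficients are
  those of a multiple of the reflected \<open>S1\<close>, because \<open>S\<^sub>,\<^sub>1 = 2 \<xi>\<^sub>,\<^sub>1 \<bullet> \<xi>\<close> and \<open>\<Omega>\<^sub>,\<^sub>1 = r\<^sub>1 r\<^sub>2 S1 \<bullet> \<xi>\<close>.\<close>

lemma XT_pd: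
  assumes "Q u \<noteq> 0"
  shows "has_pd 1 XT (e u *\<^sub>R reflect (\<xi> u) (S1 u)) u" "has_pd 2 XT (h u *\<^sub>R reflect (\<xi> u) (S2 u)) u"
proof -
  note S0 = S_nonzero[OF assms]
  have c1: "1 + c \<noteq> 0" using c by simp
  have m2: "has_pd 1 (\<lambda>u. 2 * Om u) (2 * (r1 * r2 * f' (fst u))) u" "has_pd 2 (\<lambda>u. 2 * Om u) (2 * (r1 * r2 * g' (snd u))) u"
    using has_pd_mult[OF has_pd_const pd_scalars(1), of 2] has_pd_mult[OF has_pd_const pd_scalars(2), of 2] by simp_all
  have u: "u \<in> {u. Q u \<noteq> 0}" using assms by simp
  show "has_pd 1 XT (e u *\<^sub>R reflect (\<xi> u) (S1 u)) u"
  proof (rule has_pd_cong[OF open_Q u, of "\<lambda>u. torus r1 r2 u - (2 * Om u / S u) *\<^sub>R \<xi> u"])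
    let ?C = "(2 * (r1 * r2 * f' (fst u)) * S u - 2 * Om u * ((1 + c) * (2 * r2\<^sup>2 * f (fst u) * f' (fst u)))) / (S u)\<^sup>2"
    have "has_pd 1 (\<lambda>u. torus r1 r2 u - (2 * Om u / S u) *\<^sub>R \<xi> u)
       ((r1 * r2) *\<^sub>R S1 u - ((2 * Om u / S u) *\<^sub>R (((1 + c) * r2\<^sup>2 * f (fst u)) *\<^sub>R S1 u) + ?C *\<^sub>R \<xi> u)) u"
      by (rule has_pd_diff[OF torus_pd(1) has_pd_scaleR[OF has_pd_divide[OF m2(1) pd_scalars(7) S0] pd_\<xi>(1)]])
    moreover have e: "r1 * r2 - 2 * Om u / S u * ((1 + c) * r2\<^sup>2 * f (fst u)) = e u"
    proof -
      have "2 * Om u / S u * ((1 + c) * r2\<^sup>2 * f (fst u)) = 2 * Om u * r2\<^sup>2 * f (fst u) / Q u"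
        using c1 by (simp add: S_eq)
      moreover have "r1 * r2 = r1 * r2 * Q u / Q u" using assms by simp
      ultimately have "r1 * r2 - 2 * Om u / S u * ((1 + c) * r2\<^sup>2 * f (fst u))
          = (r1 * r2 * Q u - 2 * Om u * r2\<^sup>2 * f (fst u)) / Q u"
        by (simp add: diff_divide_distrib)
      also have "r1 * r2 * Q u - 2 * Om u * r2\<^sup>2 * f (fst u) =
          r1 * r2 * (r1\<^sup>2 * (g (snd u))\<^sup>2 - r2\<^sup>2 * (f (fst u))\<^sup>2 - 2 * r2\<^sup>2 * f (fst u) * g (snd u))"
        by (simp add: Q_def Om_eq power2_eq_square algebra_simps)
      finally show ?thesis by (simp add: e_def)
    qed
    moreover have "?C = e u * (2 * f' (fst u) / S u)"
      unfolding e[symmetric] using S0 by (simp add: field_simps power2_eq_square)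
    ultimately show "has_pd 1 (\<lambda>u. torus r1 r2 u - (2 * Om u / S u) *\<^sub>R \<xi> u) (e u *\<^sub>R reflect (\<xi> u) (S1 u)) u"
      using collect_reflection[of "r1 * r2" "2 * Om u / S u" "(1 + c) * r2\<^sup>2 * f (fst u)" "e u" ?C "2 * f' (fst u) / S u" "S1 u" "\<xi> u"]
      by (simp add: reflect_def inner_\<xi> del: One_nat_def)
  qed (simp add: XT_eq)
  show "has_pd 2 XT (h u *\<^sub>R reflect (\<xi> u) (S2 u)) u"
  proof (rule has_pd_cong[OF open_Q u, of "\<lambda>u. torus r1 r2 u - (2 * Om u / S u) *\<^sub>R \<xi> u"])
    let ?C = "(2 * (r1 * r2 * g' (snd u)) * S u - 2 * Om u * ((1 + c) * (2 * r1\<^sup>2 * g (snd u) * g' (snd u)))) / (S u)\<^sup>2"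
    have "has_pd 2 (\<lambda>u. torus r1 r2 u - (2 * Om u / S u) *\<^sub>R \<xi> u)
       ((r1 * r2) *\<^sub>R S2 u - ((2 * Om u / S u) *\<^sub>R (((1 + c) * r1\<^sup>2 * g (snd u)) *\<^sub>R S2 u) + ?C *\<^sub>R \<xi> u)) u"
      by (rule has_pd_diff[OF torus_pd(2) has_pd_scaleR[OF has_pd_divide[OF m2(2) pd_scalars(8) S0] pd_\<xi>(2)]])
    moreover have h: "r1 * r2 - 2 * Om u / S u * ((1 + c) * r1\<^sup>2 * g (snd u)) = h u"
    proof -
      have "2 * Om u / S u * ((1 + c) * r1\<^sup>2 * g (snd u)) = 2 * Om u * r1\<^sup>2 * g (snd u) / Q u"
        using c1 by (simp add: S_eq)
      moreover have "r1 * r2 = r1 * r2 * Q u / Q u" using assms by simp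
      ultimately have "r1 * r2 - 2 * Om u / S u * ((1 + c) * r1\<^sup>2 * g (snd u))
          = (r1 * r2 * Q u - 2 * Om u * r1\<^sup>2 * g (snd u)) / Q u"
        by (simp add: diff_divide_distrib)
      also have "r1 * r2 * Q u - 2 * Om u * r1\<^sup>2 * g (snd u) =
          r1 * r2 * (r2\<^sup>2 * (f (fst u))\<^sup>2 - r1\<^sup>2 * (g (snd u))\<^sup>2 - 2 * r1\<^sup>2 * f (fst u) * g (snd u))"
        by (simp add: Q_def Om_eq power2_eq_square algebra_simps)
      finally show ?thesis by (simp add: h_def)
    qed
    moreover have "?C = h u * (2 * g' (snd u) / S u)"
      unfolding h[symmetric] using S0 by (simp add: field_simps power2_eq_square)
    ultimately show "has_pd 2 (\<lambda>u. torus r1 r2 u - (2 * Om u / S u) *\<^sub>R \<xi> u) (h u *\<^sub>R reflect (\<xi> u) (S2 u)) u"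
      using collect_reflection[of "r1 * r2" "2 * Om u / S u" "(1 + c) * r1\<^sup>2 * g (snd u)" "h u" ?C "2 * g' (snd u) / S u" "S2 u" "\<xi> u"]
      by (simp add: reflect_def inner_\<xi>)
  qed (simp add: XT_eq)
qed

text \<open>The rotation coefficients \<open>e\<^sub>,\<^sub>2 / h\<close> and \<open>h\<^sub>,\<^sub>1 / e\<close> of the metric in closed form. The common
  factors of numerator and denominator have cancelled.\<close>

definition a where "a u = - 2 * r2\<^sup>2 * f (fst u) * g' (snd u) / Q u"
definition b where "b u = - 2 * r1\<^sup>2 * g (snd u) * f' (fst u) / Q u"

lemma pd_e_h:
  assumes "Q u \<noteq> 0"
  shows "has_pd 2 e (a u * h u) u" "has_pd 1 h (b u * e u) u" "has_pd 1 e (pd 1 e u) u" "has_pd 2 h (pd 2 h u) u"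
proof -
  let ?f = "f (fst u)" and ?g = "g (snd u)" and ?f' = "f' (fst u)" and ?g' = "g' (snd u)"
  let ?N = "\<lambda>u. r1 * r2 * (r1\<^sup>2 * (g (snd u))\<^sup>2 - r2\<^sup>2 * (f (fst u))\<^sup>2 - 2 * r2\<^sup>2 * f (fst u) * g (snd u))"
  let ?M = "\<lambda>u. r1 * r2 * (r2\<^sup>2 * (f (fst u))\<^sup>2 - r1\<^sup>2 * (g (snd u))\<^sup>2 - 2 * r1\<^sup>2 * f (fst u) * g (snd u))"
  note pf = pd_profile[of u]
  have form: "has_pd i (\<lambda>u. r1 * r2 * (k * (x u)\<^sup>2 - l * (y u)\<^sup>2 - m * y u * x u))
      (r1 * r2 * (k * (2 * x u * x') - l * (2 * y u * y') - m * (y u * x' + y' * x u))) u"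
    if "has_pd i x x' u" "has_pd i y y' u" for i x y x' y' and k l m :: real
    using has_pd_mult[OF has_pd_const has_pd_diff[OF has_pd_diff[OF has_pd_mult[OF has_pd_const has_pd_power2[OF that(1)]]
      has_pd_mult[OF has_pd_const has_pd_power2[OF that(2)]]] has_pd_mult[OF has_pd_const has_pd_mult[OF that(2,1)]]],
      of "r1 * r2" k l m] by (simp add: mult.assoc)
  have N: "has_pd 1 ?N (r1 * r2 * (r1\<^sup>2 * (2 * ?g * 0) - r2\<^sup>2 * (2 * ?f * ?f') - 2 * r2\<^sup>2 * (?f * 0 + ?f' * ?g))) u"
    "has_pd 2 ?N (r1 * r2 * (r1\<^sup>2 * (2 * ?g * ?g') - r2\<^sup>2 * (2 * ?f * 0) - 2 * r2\<^sup>2 * (?f * ?g' + 0 * ?g))) u"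
    "has_pd 1 ?M (r1 * r2 * (r2\<^sup>2 * (2 * ?f * ?f') - r1\<^sup>2 * (2 * ?g * 0) - 2 * r1\<^sup>2 * (?g * ?f' + 0 * ?f))) u"
    "has_pd 2 ?M (r1 * r2 * (r2\<^sup>2 * (2 * ?f * 0) - r1\<^sup>2 * (2 * ?g * ?g') - 2 * r1\<^sup>2 * (?g * 0 + ?g' * ?f))) u"
    using form[OF pf(5) pf(1), of "r1\<^sup>2" "r2\<^sup>2" "2 * r2\<^sup>2"] form[OF pf(6) pf(2), of "r1\<^sup>2" "r2\<^sup>2" "2 * r2\<^sup>2"]
      form[OF pf(1) pf(5), of "r2\<^sup>2" "r1\<^sup>2" "2 * r1\<^sup>2"] form[OF pf(2) pf(6), of "r2\<^sup>2" "r1\<^sup>2" "2 * r1\<^sup>2"]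
    by (simp_all add: mult_ac)
  note d = has_pd_divide[OF N(1) pd_scalars(5) assms] has_pd_divide[OF N(2) pd_scalars(6) assms]
    has_pd_divide[OF N(3) pd_scalars(5) assms] has_pd_divide[OF N(4) pd_scalars(6) assms]
  show "has_pd 1 e (pd 1 e u) u" "has_pd 2 h (pd 2 h u) u"
    using d(1,4)[THEN has_pd_pd] unfolding e_def[abs_def] h_def[abs_def] by simp_all
  have "(r1 * r2 * (r1\<^sup>2 * (2 * ?g * ?g') - r2\<^sup>2 * (2 * ?f * 0) - 2 * r2\<^sup>2 * (?f * ?g' + 0 * ?g)) * Q u - ?N u * (2 * r1\<^sup>2 * ?g * ?g'))
      = (- 2 * r2\<^sup>2 * ?f * ?g') * ?M u"
    by (simp add: Q_def power2_eq_square algebra_simps)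
  then show "has_pd 2 e (a u * h u) u"
    using d(2) unfolding e_def[abs_def] a_def h_def by (simp add: power2_eq_square)
  have "(r1 * r2 * (r2\<^sup>2 * (2 * ?f * ?f') - r1\<^sup>2 * (2 * ?g * 0) - 2 * r1\<^sup>2 * (?g * ?f' + 0 * ?f)) * Q u - ?M u * (2 * r2\<^sup>2 * ?f * ?f'))
      = (- 2 * r1\<^sup>2 * ?g * ?f') * ?N u"
    by (simp add: Q_def power2_eq_square algebra_simps)
  then show "has_pd 1 h (b u * e u) u"
    using d(3) unfolding h_def[abs_def] b_def e_def by (simp add: power2_eq_square)
qed

text \<open>The reason for flatness: by the second order equations, \<open>a\<^sub>,\<^sub>2 + b\<^sub>,\<^sub>1\<close> is a
  multiple of \<open>f'\<^sup>2 + g'\<^sup>2 - c Q\<close>.\<close>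

lemma pd_a_b:
  assumes "Q u \<noteq> 0"
  shows "\<exists>a2 b1. has_pd 2 a a2 u \<and> has_pd 1 b b1 u \<and> a2 + b1 = 0"
proof -
  let ?f = "f (fst u)" and ?g = "g (snd u)" and ?f' = "f' (fst u)" and ?g' = "g' (snd u)"
  have N: "has_pd 2 (\<lambda>u. - 2 * r2\<^sup>2 * f (fst u) * g' (snd u)) (- 2 * r2\<^sup>2 * ?f * (c * r1\<^sup>2 * ?g)) u"
    "has_pd 1 (\<lambda>u. - 2 * r1\<^sup>2 * g (snd u) * f' (fst u)) (- 2 * r1\<^sup>2 * ?g * (c * r2\<^sup>2 * ?f)) u"
    unfolding has_pd_1_real has_pd_2_real fst_conv snd_conv
    by (auto intro!: derivative_eq_intros ddf ddg)
  have "(- 2 * r2\<^sup>2 * ?f * (c * r1\<^sup>2 * ?g) * Q u - (- 2 * r2\<^sup>2 * ?f * ?g') * (2 * r1\<^sup>2 * ?g * ?g'))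
      + (- 2 * r1\<^sup>2 * ?g * (c * r2\<^sup>2 * ?f) * Q u - (- 2 * r1\<^sup>2 * ?g * ?f') * (2 * r2\<^sup>2 * ?f * ?f'))
      = 4 * r1\<^sup>2 * r2\<^sup>2 * ?f * ?g * ((?f')\<^sup>2 + (?g')\<^sup>2 - c * Q u)"
    by (simp add: power2_eq_square algebra_simps)
  also have "\<dots> = 0" by (simp add: energy_Q)
  finally have sum: "(- 2 * r2\<^sup>2 * ?f * (c * r1\<^sup>2 * ?g) * Q u - (- 2 * r2\<^sup>2 * ?f * ?g') * (2 * r1\<^sup>2 * ?g * ?g'))
      + (- 2 * r1\<^sup>2 * ?g * (c * r2\<^sup>2 * ?f) * Q u - (- 2 * r1\<^sup>2 * ?g * ?f') * (2 * r2\<^sup>2 * ?f * ?f')) = 0" .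
  note d = has_pd_divide[OF N(1) pd_scalars(6) assms] has_pd_divide[OF N(2) pd_scalars(5) assms]
  show ?thesis
    by (rule exI, rule exI, rule conjI[OF d(1)[folded a_def] conjI[OF d(2)[folded b_def]]])
       (simp only: sum add_divide_distrib[symmetric] div_0)
qed

lemma flat_surface_XT:
  assumes D: "open D" "D \<subseteq> V" and X: "\<And>u. u \<in> D \<Longrightarrow> X u = XT u"
  shows "flat_surface D X"
proof -
  have DQ: "Q u \<noteq> 0" "e u \<noteq> 0" "h u \<noteq> 0" if "u \<in> D" for u using D(2) that V_iff by blast+
  \<comment> \<open>\<open>X\<close> is prescribed on \<open>D\<close> only, which is enough because \<open>D\<close> is open.\<close>
  have pdX: "pd 1 X u = e u *\<^sub>R reflect (\<xi> u) (S1 u)" "pd 2 X u = h u *\<^sub>R reflect (\<xi> u) (S2 u)" if "u \<in> D" for u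
    using pd_cong[OF D(1) that X[symmetric] XT_pd(1)[OF DQ(1)[OF that]]]
      pd_cong[OF D(1) that X[symmetric] XT_pd(2)[OF DQ(1)[OF that]]] by blast+
  have metric: "metric X 1 1 u = (e u)\<^sup>2" "metric X 1 2 u = 0" "metric X 2 2 u = (h u)\<^sup>2" if "u \<in> D" for u
    unfolding metric_def pdX[OF that] by (simp_all add: reflect_inner frame_inner power2_eq_square)
  have "smooth_on D X" unfolding smooth_on_def
  proof
    fix k
    have "ck_on k D XT" by (rule ck_on_mono[of k "{u. Q u \<noteq> 0}"]) (use XT_smooth DQ in \<open>auto simp: smooth_on_def\<close>)
    then show "ck_on k D X" by (rule ck_on_cong[OF D(1), rotated]) (simp add: X)
  qed
  moreover have "norm (X u) = 1" if "u \<in> D" for u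
    unfolding X[OF that] XT_reflect[OF DQ(1)[OF that]] norm_eq_sqrt_inner reflect_inner
    using r12 by (simp add: torus_frame_eq inner_add_left inner_add_right frame_inner power2_eq_square)
  moreover have "s = 0 \<and> t = 0" if u: "u \<in> D" and z: "s *\<^sub>R pd 1 X u + t *\<^sub>R pd 2 X u = 0" for u s t
  proof -
    have "(s *\<^sub>R pd 1 X u + t *\<^sub>R pd 2 X u) \<bullet> reflect (\<xi> u) (S1 u) = s * e u"
      "(s *\<^sub>R pd 1 X u + t *\<^sub>R pd 2 X u) \<bullet> reflect (\<xi> u) (S2 u) = t * h u"
      unfolding pdX[OF u] by (simp_all add: inner_add_left reflect_inner frame_inner)
    then show ?thesis using DQ[OF u] unfolding z by simp
  qed
  ultimately have "regular_surface D X" by (auto simp: regular_surface_def simp del: One_nat_def)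
  moreover have "gauss_curvature X u = 0" if u: "u \<in> D" for u
  proof -
    obtain a2 b1 where ab: "has_pd 2 a a2 u" "has_pd 1 b b1 u" "a2 + b1 = 0" using pd_a_b[OF DQ(1)[OF u]] by blast
    note p = pd_e_h[OF DQ(1)]
    show ?thesis
      by (rule orthogonal_metric_flat[OF D(1) u metric DQ(2,3) p(3) p(1) p(2) p(4) ab])
  qed
  ultimately show ?thesis by (simp add: flat_surface_def)
qed

lemma normal_map_NT: "normal_map V XT NT"
proof -
  have "smooth_on V NT"
    using NT_smooth V_iff ck_on_mono[of _ "{u. Q u \<noteq> 0}" NT V] unfolding smooth_on_def by blast
  moreover have "norm (NT u) = 1 \<and> NT u \<bullet> XT u = 0 \<and> NT u \<bullet> pd 1 XT u = 0 \<and> NT u \<bullet> pd 2 XT u = 0"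
    if "u \<in> V" for u
  proof -
    have q: "Q u \<noteq> 0" using that V_iff by blast
    show ?thesis
      unfolding XT_pd[OF q, THEN has_pd_imp_pd] NT_reflect[OF q] XT_reflect[OF q] norm_eq_sqrt_inner
        inner_scaleR_right reflect_inner
      using r12 by (simp add: torus_frame_eq torus_normal_frame_eq inner_add_left inner_add_right
        inner_diff_left inner_diff_right frame_inner power2_eq_square)
  qed
  ultimately show ?thesis by (simp add: normal_map_def)
qed

text \<open>The data enter only through their values at \<open>u\<close>, so that data known merely on \<open>D\<close> can be inserted.\<close>

lemma ribaucour_transform_XT:
  assumes "Q u \<noteq> 0" "Om0 u = Om u" "W0 u = W u" "om 1 u = f' (fst u)" "om 2 u = g' (snd u)"
  shows "ribaucour_transform r1 r2 W0 Om0 om u = XT u"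
proof -
  have "(f' (fst u))\<^sup>2 + (g' (snd u))\<^sup>2 + (W u)\<^sup>2 + (Om u)\<^sup>2 = c * Q u + Q u"
    using energy_Q[of u] Om_W_Q[of u] by linarith
  also have "\<dots> = S u" by (simp add: S_eq algebra_simps)
  finally have S: "(f' (fst u))\<^sup>2 + (g' (snd u))\<^sup>2 + (W u)\<^sup>2 + (Om u)\<^sup>2 = S u" .
  show ?thesis
    unfolding ribaucour_transform_def Let_def assms(2-5) S torus_frame_1 torus_frame_2 XT_eq[OF assms(1)] \<xi>_eq
    by (simp add: algebra_simps power2_eq_square)
qed

end

section \<open>Association to the torus\<close>

context ribaucour_profile
begin

text \<open>For fixed \<open>g\<close>, the quotient \<open>\<Omega>/W\<close> is a fractional linear function of \<open>f\<close> of determinant a nonzero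
  multiple of \<open>g\<close>. It can be constant on an interval only if \<open>f\<close> is, and a nonzero solution of
  \<open>f'' = c r\<^sub>2\<^sup>2 f\<close> is not.\<close>

lemma h_nonconstant:
  assumes D: "open D" and nd: "\<And>u. u \<in> D \<Longrightarrow> nondegenerate_at r1 r2 Om W u"
  shows "nonconstant_along_curvature_lines D (\<lambda>u. Om u / W u)"
proof -
  have "\<not> (\<lambda>t. Om (t, snd u) / W (t, snd u)) constant_on {t. (t, snd u) \<in> D}
      \<and> \<not> (\<lambda>t. Om (fst u, t) / W (fst u, t)) constant_on {t. (fst u, t) \<in> D}" if u: "u \<in> D" for u
  proof -
    obtain \<delta> where \<delta>: "\<delta> > 0" and sub: "{fst u - \<delta><..<fst u + \<delta>} \<times> {snd u - \<delta><..<snd u + \<delta>} \<subseteq> D"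
      using open_contains_box[OF D u] .
    have nz: "f (fst u) \<noteq> 0" "g (snd u) \<noteq> 0" using nd[OF u] nondegenerate_iff by blast+
    have 1: False if "r1 * r2 - d * r2\<^sup>2 = 0" "r1 * r2 + d * r1\<^sup>2 = 0" for d
    proof -
      have "r1\<^sup>2 * (r1 * r2 - d * r2\<^sup>2) + r2\<^sup>2 * (r1 * r2 + d * r1\<^sup>2) = (r1\<^sup>2 + r2\<^sup>2) * (r1 * r2)"
        by (simp add: power2_eq_square algebra_simps)
      then show False unfolding that r12 using r1 r2 by simp
    qed
    have "\<not> (\<lambda>t. Om (t, snd u) / W (t, snd u)) constant_on {t. (t, snd u) \<in> D}"
    proof
      assume "(\<lambda>t. Om (t, snd u) / W (t, snd u)) constant_on {t. (t, snd u) \<in> D}"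
      then obtain d where d: "\<And>t. (t, snd u) \<in> D \<Longrightarrow> Om (t, snd u) / W (t, snd u) = d"
        by (auto simp: constant_on_def)
      have eq: "(r1 * r2 - d * r2\<^sup>2) * f t + (r1 * r2 + d * r1\<^sup>2) * g (snd u) = 0"
        if "t \<in> {fst u - \<delta><..<fst u + \<delta>}" for t
      proof -
        have "(t, snd u) \<in> D" using sub that \<delta> by auto
        then have "Om (t, snd u) = d * W (t, snd u)"
          using d nd nondegenerate_iff by (auto simp: field_simps)
        then show ?thesis by (simp add: Om_eq W_eq algebra_simps)
      qed
      have "(r1 * r2 - d * r2\<^sup>2) * (c * r2\<^sup>2) * f (fst u) = 0"
        by (rule second_order_zero_on_open[where I="{fst u - \<delta><..<fst u + \<delta>}", OF _ _ eq df ddf]) (use \<delta> in auto)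
      then have z: "r1 * r2 - d * r2\<^sup>2 = 0" using nz c r2 by simp
      moreover have "r1 * r2 + d * r1\<^sup>2 = 0" using eq[of "fst u"] \<delta> nz unfolding z by simp
      ultimately show False using 1 by blast
    qed
    moreover have "\<not> (\<lambda>t. Om (fst u, t) / W (fst u, t)) constant_on {t. (fst u, t) \<in> D}"
    proof
      assume "(\<lambda>t. Om (fst u, t) / W (fst u, t)) constant_on {t. (fst u, t) \<in> D}"
      then obtain d where d: "\<And>t. (fst u, t) \<in> D \<Longrightarrow> Om (fst u, t) / W (fst u, t) = d"
        by (auto simp: constant_on_def)
      have eq: "(r1 * r2 + d * r1\<^sup>2) * g t + (r1 * r2 - d * r2\<^sup>2) * f (fst u) = 0"
        if "t \<in> {snd u - \<delta><..<snd u + \<delta>}" for t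
      proof -
        have "(fst u, t) \<in> D" using sub that \<delta> by auto
        then have "Om (fst u, t) = d * W (fst u, t)"
          using d nd nondegenerate_iff by (auto simp: field_simps)
        then show ?thesis by (simp add: Om_eq W_eq algebra_simps)
      qed
      have "(r1 * r2 + d * r1\<^sup>2) * (c * r1\<^sup>2) * g (snd u) = 0"
        by (rule second_order_zero_on_open[where I="{snd u - \<delta><..<snd u + \<delta>}", OF _ _ eq dg ddg]) (use \<delta> in auto)
      then have z: "r1 * r2 + d * r1\<^sup>2 = 0" using nz c r1 by simp
      moreover have "r1 * r2 - d * r2\<^sup>2 = 0" using eq[of "snd u"] \<delta> nz unfolding z by simp
      ultimately show False using 1 by blast
    qed
    ultimately show ?thesis ..
  qed
  then show ?thesis by (simp add: nonconstant_along_curvature_lines_def)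
qed

lemma Q_nonzero_if_nondegenerate: "nondegenerate_at r1 r2 Om W u \<Longrightarrow> Q u \<noteq> 0"
  using Om_W_Q[of u] nondegenerate_iff[of u] by (metis add_nonneg_eq_0_iff power_eq_0_iff zero_le_power2)

lemma ribaucour_associated_XT:
  assumes D: "open D" and nd: "\<And>u. u \<in> D \<Longrightarrow> nondegenerate_at r1 r2 Om W u"
    and X: "\<And>u. u \<in> D \<Longrightarrow> X u = XT u"
  shows "ribaucour_associated r1 r2 c D X"
proof -
  define om where "om = (\<lambda>(i::nat) u. if i = 1 then f' (fst u) else g' (snd u))"
  have om: "om 1 = (\<lambda>u. f' (fst u))" "om 2 = (\<lambda>u. g' (snd u))" by (auto simp: om_def)
  have diff: "W differentiable (at u)" "Om differentiable (at u)" "om 1 differentiable (at u)"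
    "om 2 differentiable (at u)" for u
    using ck_on_SucE(1)[OF scalars_smooth(2)[of UNIV "Suc 0"]] ck_on_SucE(1)[OF scalars_smooth(1)[of UNIV "Suc 0"]]
      ck_on_SucE(1)[OF profile_smooth(2)[of UNIV "Suc 0"]] ck_on_SucE(1)[OF profile_smooth(4)[of UNIV "Suc 0"]]
    unfolding om by auto
  have pd: "pd 2 (om 1) u = 0" "pd 1 (om 2) u = 0" "pd 1 Om u = r1 * r2 * om 1 u" "pd 2 Om u = r1 * r2 * om 2 u"
    "pd 1 W u = - r1 * r2 * lam r1 r2 1 * om 1 u" "pd 2 W u = - r1 * r2 * lam r1 r2 2 * om 2 u" for u
    unfolding om pd_profile[THEN has_pd_imp_pd] pd_scalars[THEN has_pd_imp_pd]
    using r1 r2 by (simp_all add: lam_def power2_eq_square)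
  have "ribaucour_data r1 r2 D W Om om"
    unfolding ribaucour_data_def using diff pd nd by (auto simp del: One_nat_def)
  moreover have "\<forall>u\<in>D. X u = ribaucour_transform r1 r2 W Om om u"
    using ribaucour_transform_XT[OF Q_nonzero_if_nondegenerate[OF nd]] X om by (auto simp del: One_nat_def)
  moreover have "nonconstant_along_curvature_lines D (\<lambda>u. Om u / W u)"
    by (rule h_nonconstant[OF D nd])
  moreover have "\<forall>u\<in>D. (om 1 u)\<^sup>2 + (om 2 u)\<^sup>2 = c * ((Om u)\<^sup>2 + (W u)\<^sup>2)"
    unfolding om by (simp add: energy_Q Om_W_Q)
  ultimately show ?thesis unfolding ribaucour_associated_def by blast
qed

end

section \<open>Symmetries of the torus and changes of coordinates\<close>

definition affine_coords :: "real \<Rightarrow> real \<Rightarrow> real \<Rightarrow> real \<Rightarrow> real \<times> real \<Rightarrow> real \<times> real" where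
  "affine_coords \<sigma>1 \<alpha>1 \<sigma>2 \<alpha>2 u = (\<sigma>1 * fst u + \<alpha>1, \<sigma>2 * snd u + \<alpha>2)"

lemma sign_cases: "(\<sigma>::real)\<^sup>2 = 1 \<Longrightarrow> \<sigma> = 1 \<or> \<sigma> = -1"
  by (simp add: power2_eq_1_iff)

lemma radial_shift:
  assumes "\<sigma> = 1 \<or> \<sigma> = -1"
  shows "radial i j (x + \<sigma> * pi) = - radial i j x" "radial i j (x + \<sigma> * (pi / 2)) = \<sigma> *\<^sub>R tangential i j x"
  using assms by (auto simp: radial_def tangential_def cos_add sin_add cos_diff sin_diff algebra_simps)

context torus_radii
begin

text \<open>An isometry compatible with the torus and a coordinate change also respects the frame. Moving \<open>u\<^sub>1\<close>
  by half a period changes the sign of \<open>C1\<close> only, which separates the two summands of \<open>X = r\<^sub>1 C\<^sub>1 + r\<^sub>2 C\<^sub>2\<close>;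
  moving it by a quarter of a period turns \<open>C1\<close> into \<open>S1\<close>.\<close>

lemma symmetry_frame:
  assumes sym: "torus_symmetry r1 r2 A (affine_coords \<sigma>1 \<alpha>1 \<sigma>2 \<alpha>2)" and "\<sigma>1\<^sup>2 = 1" "\<sigma>2\<^sup>2 = 1"
  defines "\<phi> \<equiv> affine_coords \<sigma>1 \<alpha>1 \<sigma>2 \<alpha>2"
  shows "A (C1 (\<phi> u)) = C1 u" "A (S1 (\<phi> u)) = \<sigma>1 *\<^sub>R S1 u" "A (C2 (\<phi> u)) = C2 u" "A (S2 (\<phi> u)) = \<sigma>2 *\<^sub>R S2 u"
proof -
  have "linear A" using sym by (simp add: torus_symmetry_def orthogonal_transformation_def)
  then interpret A: linear A .
  have \<sigma>: "\<sigma>1 = 1 \<or> \<sigma>1 = -1" "\<sigma>2 = 1 \<or> \<sigma>2 = -1" using assms(2,3) sign_cases by auto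
  have T: "r1 *\<^sub>R A (C1 (\<phi> u)) + r2 *\<^sub>R A (C2 (\<phi> u)) = r1 *\<^sub>R C1 u + r2 *\<^sub>R C2 u" for u
  proof -
    have "A (torus r1 r2 (\<phi> u)) = torus r1 r2 u"
      using sym unfolding torus_symmetry_def \<phi>_def by (metis comp_apply)
    then show ?thesis by (simp add: torus_frame_eq A.add A.scaleR)
  qed
  have arg: "r2 * (\<sigma>1 * (x + y / r2) + \<alpha>1) = r2 * (\<sigma>1 * x + \<alpha>1) + \<sigma>1 * y"
    "r1 * (\<sigma>2 * (x + y / r1) + \<alpha>2) = r1 * (\<sigma>2 * x + \<alpha>2) + \<sigma>2 * y"
    "r2 * (x + y / r2) = r2 * x + y" "r1 * (x + y / r1) = r1 * x + y" for x y
    using r1 r2 by (simp_all add: field_simps)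
  have sh: "radial i j (x + pi) = - radial i j x" "radial i j (x + pi / 2) = tangential i j x" for i j x
    using radial_shift[of 1] by simp_all
  have C1A: "A (C1 (\<phi> u)) = C1 u" for u
  proof -
    \<comment> \<open>Half a period in the first factor: this changes the sign of \<open>C1\<close> and keeps \<open>C2\<close>.\<close>
    define v where "v = (fst u + pi / r2, snd u)"
    have "C1 v = - C1 u" "C1 (\<phi> v) = - C1 (\<phi> u)" "C2 v = C2 u" "C2 (\<phi> v) = C2 (\<phi> u)"
      by (simp_all add: v_def C1_def C2_def \<phi>_def affine_coords_def arg sh radial_shift[OF \<sigma>(1)])
    then have v: "- (r1 *\<^sub>R A (C1 (\<phi> u))) + r2 *\<^sub>R A (C2 (\<phi> u)) = - (r1 *\<^sub>R C1 u) + r2 *\<^sub>R C2 u"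
      using T[of v] by (simp add: A.neg)
    have two: "(x + y) - (- x + y) = 2 *\<^sub>R x" for x y :: "real^4" by (simp add: scaleR_2)
    have "2 *\<^sub>R (r1 *\<^sub>R A (C1 (\<phi> u))) = (r1 *\<^sub>R A (C1 (\<phi> u)) + r2 *\<^sub>R A (C2 (\<phi> u)))
        - (- (r1 *\<^sub>R A (C1 (\<phi> u))) + r2 *\<^sub>R A (C2 (\<phi> u)))"
      by (rule two[symmetric])
    also have "\<dots> = 2 *\<^sub>R (r1 *\<^sub>R C1 u)" unfolding T v by (rule two)
    finally have "2 *\<^sub>R (r1 *\<^sub>R A (C1 (\<phi> u))) = 2 *\<^sub>R (r1 *\<^sub>R C1 u)" .
    then show ?thesis using r1 by simp
  qed
  have C2A: "A (C2 (\<phi> u)) = C2 u" for u using T[of u] r2 by (simp add: C1A)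
  show "A (C1 (\<phi> u)) = C1 u" "A (C2 (\<phi> u)) = C2 u" by (rule C1A C2A)+
  have "A (\<sigma>1 *\<^sub>R S1 (\<phi> u)) = S1 u"
    using C1A[of "(fst u + (pi / 2) / r2, snd u)"]
    by (simp add: C1_def S1_def \<phi>_def affine_coords_def arg sh radial_shift(2)[OF \<sigma>(1), simplified] del: divide_divide_eq_left)
  then have "\<sigma>1 *\<^sub>R (\<sigma>1 *\<^sub>R A (S1 (\<phi> u))) = \<sigma>1 *\<^sub>R S1 u" by (simp add: A.scaleR)
  then show "A (S1 (\<phi> u)) = \<sigma>1 *\<^sub>R S1 u" using assms(2) by (simp add: power2_eq_square)
  have "A (\<sigma>2 *\<^sub>R S2 (\<phi> u)) = S2 u"
    using C2A[of "(fst u, snd u + (pi / 2) / r1)"]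
    by (simp add: C2_def S2_def \<phi>_def affine_coords_def arg sh radial_shift(2)[OF \<sigma>(2), simplified] del: divide_divide_eq_left)
  then have "\<sigma>2 *\<^sub>R (\<sigma>2 *\<^sub>R A (S2 (\<phi> u))) = \<sigma>2 *\<^sub>R S2 u" by (simp add: A.scaleR)
  then show "A (S2 (\<phi> u)) = \<sigma>2 *\<^sub>R S2 u" using assms(3) by (simp add: power2_eq_square)
qed

text \<open>The isometry undoes the coordinate change in each of the two coordinate planes: a rotation by
  \<open>- r\<^sub>2 \<alpha>\<^sub>1\<close> followed by a reflection if \<open>\<sigma>\<^sub>1 = -1\<close>, and likewise in the second plane.\<close>

lemma torus_symmetry_exists:
  assumes "\<sigma>1\<^sup>2 = 1" "\<sigma>2\<^sup>2 = 1"
  shows "\<exists>A. torus_symmetry r1 r2 A (affine_coords \<sigma>1 \<alpha>1 \<sigma>2 \<alpha>2)"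
proof -
  define A :: "real^4 \<Rightarrow> real^4" where "A = (\<lambda>v. vector
    [cos (r2 * \<alpha>1) * v $ 1 + sin (r2 * \<alpha>1) * v $ 2, \<sigma>1 * (cos (r2 * \<alpha>1) * v $ 2 - sin (r2 * \<alpha>1) * v $ 1),
     cos (r1 * \<alpha>2) * v $ 3 + sin (r1 * \<alpha>2) * v $ 4, \<sigma>2 * (cos (r1 * \<alpha>2) * v $ 4 - sin (r1 * \<alpha>2) * v $ 3)])"
  have "linear A"
    by (rule linearI) (simp_all add: A_def vec_eq_iff forall_4 vector_4_nth algebra_simps)
  moreover have "A v \<bullet> A w = v \<bullet> w" for v w
  proof -
    have rot: "(x * a + y * b) * (x * a' + y * b') + (\<sigma> * (x * b - y * a)) * (\<sigma> * (x * b' - y * a')) = a * a' + b * b'"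
      if "x\<^sup>2 + y\<^sup>2 = 1" "\<sigma>\<^sup>2 = 1" for x y a b a' b' \<sigma> :: real
    proof -
      have "(x * a + y * b) * (x * a' + y * b') + (\<sigma> * (x * b - y * a)) * (\<sigma> * (x * b' - y * a'))
        = (x * a + y * b) * (x * a' + y * b') + \<sigma>\<^sup>2 * ((x * b - y * a) * (x * b' - y * a'))"
        by (simp add: power2_eq_square)
      also have "\<dots> = (x\<^sup>2 + y\<^sup>2) * (a * a' + b * b')"
        unfolding that(2) by (simp add: power2_eq_square algebra_simps)
      finally show ?thesis by (simp add: that(1))
    qed
    show ?thesis
      using rot[OF sin_cos_squared_add2 assms(1), of "r2 * \<alpha>1" "v $ 1" "v $ 2" "w $ 1" "w $ 2"]
        rot[OF sin_cos_squared_add2 assms(2), of "r1 * \<alpha>2" "v $ 3" "v $ 4" "w $ 3" "w $ 4"]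
      by (simp add: A_def inner_vec_def sum_4 vector_4_nth)
  qed
  ultimately have "orthogonal_transformation A" by (simp add: orthogonal_transformation_def)
  moreover have "A (torus r1 r2 (affine_coords \<sigma>1 \<alpha>1 \<sigma>2 \<alpha>2 u)) = torus r1 r2 u" for u
  proof -
    obtain x y where u: "u = (x, y)" by (cases u)
    have cs: "cos b * (p * cos a) + sin b * (p * sin a) = p * cos (a - b)"
      and sn: "cos b * (p * sin a) - sin b * (p * cos a) = p * sin (a - b)" for a b p :: real
      by (simp_all add: cos_diff sin_diff algebra_simps)
    have rot: "cos (r * \<alpha>) * (p * cos (r * (\<sigma> * z + \<alpha>))) + sin (r * \<alpha>) * (p * sin (r * (\<sigma> * z + \<alpha>))) = p * cos (r * z)"
      "\<sigma> * (cos (r * \<alpha>) * (p * sin (r * (\<sigma> * z + \<alpha>))) - sin (r * \<alpha>) * (p * cos (r * (\<sigma> * z + \<alpha>)))) = p * sin (r * z)"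
      if \<sigma>: "\<sigma>\<^sup>2 = 1" for r \<alpha> p \<sigma> z :: real
    proof -
      have "cos (r * \<alpha>) * (p * cos (r * (\<sigma> * z + \<alpha>))) + sin (r * \<alpha>) * (p * sin (r * (\<sigma> * z + \<alpha>)))
          = p * cos (r * (\<sigma> * z + \<alpha>) - r * \<alpha>)"
        by (rule cs)
      also have "r * (\<sigma> * z + \<alpha>) - r * \<alpha> = \<sigma> * (r * z)" by (simp add: algebra_simps)
      finally show "cos (r * \<alpha>) * (p * cos (r * (\<sigma> * z + \<alpha>))) + sin (r * \<alpha>) * (p * sin (r * (\<sigma> * z + \<alpha>))) = p * cos (r * z)"
        using sign_cases[OF \<sigma>] by auto
      have "cos (r * \<alpha>) * (p * sin (r * (\<sigma> * z + \<alpha>))) - sin (r * \<alpha>) * (p * cos (r * (\<sigma> * z + \<alpha>)))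
          = p * sin (r * (\<sigma> * z + \<alpha>) - r * \<alpha>)"
        by (rule sn)
      also have "r * (\<sigma> * z + \<alpha>) - r * \<alpha> = \<sigma> * (r * z)" by (simp add: algebra_simps)
      finally show "\<sigma> * (cos (r * \<alpha>) * (p * sin (r * (\<sigma> * z + \<alpha>))) - sin (r * \<alpha>) * (p * cos (r * (\<sigma> * z + \<alpha>)))) = p * sin (r * z)"
        using sign_cases[OF \<sigma>] by auto
    qed
    show ?thesis
      unfolding u torus_def affine_coords_def A_def prod.case fst_conv snd_conv vector_4_nth
      by (simp only: rot[OF assms(1)] rot[OF assms(2)])
  qed
  moreover have "coord_change (affine_coords \<sigma>1 \<alpha>1 \<sigma>2 \<alpha>2)"
    unfolding coord_change_def using assms by (auto simp: affine_coords_def fun_eq_iff)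
  ultimately have "torus_symmetry r1 r2 A (affine_coords \<sigma>1 \<alpha>1 \<sigma>2 \<alpha>2)"
    by (auto simp: torus_symmetry_def)
  then show ?thesis by blast
qed

end

lemma torus_symmetryE:
  assumes "torus_symmetry r1 r2 A \<phi>"
  obtains \<sigma>1 \<alpha>1 \<sigma>2 \<alpha>2 where "\<sigma>1\<^sup>2 = 1" "\<sigma>2\<^sup>2 = 1" "\<phi> = affine_coords \<sigma>1 \<alpha>1 \<sigma>2 \<alpha>2"
proof -
  obtain \<sigma>1 \<sigma>2 \<alpha>1 \<alpha>2 where *: "\<sigma>1\<^sup>2 = 1" "\<sigma>2\<^sup>2 = 1" "\<phi> = (\<lambda>(u1, u2). (\<sigma>1 * u1 + \<alpha>1, \<sigma>2 * u2 + \<alpha>2))"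
    using assms by (auto simp: torus_symmetry_def coord_change_def)
  have "\<phi> = affine_coords \<sigma>1 \<alpha>1 \<sigma>2 \<alpha>2" by (auto simp: *(3) affine_coords_def fun_eq_iff)
  with * that show ?thesis by blast
qed

context ribaucour_profile
begin

lemma rescaled_profile:
  assumes "\<sigma>1\<^sup>2 = 1" "\<sigma>2\<^sup>2 = 1"
  shows "ribaucour_profile r1 r2 c (\<lambda>s. l * f (\<sigma>1 * s + \<alpha>1)) (\<lambda>t. l * g (\<sigma>2 * t + \<alpha>2))
    (\<lambda>s. l * (\<sigma>1 * f' (\<sigma>1 * s + \<alpha>1))) (\<lambda>t. l * (\<sigma>2 * g' (\<sigma>2 * t + \<alpha>2)))"
proof
  have chain: "((\<lambda>s. l * x (\<sigma> * s + \<alpha>)) has_real_derivative l * (\<sigma> * y (\<sigma> * s + \<alpha>))) (at s)"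
    if "\<And>s. (x has_real_derivative y s) (at s)" for x y :: "real \<Rightarrow> real" and l \<sigma> \<alpha> s
  proof -
    have "((\<lambda>s. \<sigma> * s + \<alpha>) has_real_derivative \<sigma>) (at s)" by (auto intro!: derivative_eq_intros)
    from DERIV_cmult[OF DERIV_chain2[OF that this], of l] show ?thesis by (simp add: mult_ac)
  qed
  have sq: "l * \<sigma> * (\<sigma> * (k * x)) = k * (l * x)" if "\<sigma>\<^sup>2 = 1" for \<sigma> k x :: real
  proof -
    have "l * \<sigma> * (\<sigma> * (k * x)) = \<sigma>\<^sup>2 * (k * (l * x))" by (simp add: power2_eq_square mult_ac)
    then show ?thesis by (simp add: that)
  qed
  show "((\<lambda>s. l * f (\<sigma>1 * s + \<alpha>1)) has_real_derivative l * (\<sigma>1 * f' (\<sigma>1 * t + \<alpha>1))) (at t)" for t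
    by (rule chain[OF df])
  show "((\<lambda>s. l * g (\<sigma>2 * s + \<alpha>2)) has_real_derivative l * (\<sigma>2 * g' (\<sigma>2 * t + \<alpha>2))) (at t)" for t
    by (rule chain[OF dg])
  show "((\<lambda>s. l * (\<sigma>1 * f' (\<sigma>1 * s + \<alpha>1))) has_real_derivative c * r2\<^sup>2 * (l * f (\<sigma>1 * t + \<alpha>1))) (at t)" for t
    using chain[OF ddf, of "l * \<sigma>1" \<sigma>1 \<alpha>1 t] unfolding sq[OF assms(1)] unfolding mult.assoc .
  show "((\<lambda>s. l * (\<sigma>2 * g' (\<sigma>2 * s + \<alpha>2))) has_real_derivative c * r1\<^sup>2 * (l * g (\<sigma>2 * t + \<alpha>2))) (at t)" for t
    using chain[OF ddg, of "l * \<sigma>2" \<sigma>2 \<alpha>2 t] unfolding sq[OF assms(2)] unfolding mult.assoc .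
  show "(l * (\<sigma>1 * f' (\<sigma>1 * s + \<alpha>1)))\<^sup>2 + (l * (\<sigma>2 * g' (\<sigma>2 * t + \<alpha>2)))\<^sup>2 =
      c * (r2\<^sup>2 * (l * f (\<sigma>1 * s + \<alpha>1))\<^sup>2 + r1\<^sup>2 * (l * g (\<sigma>2 * t + \<alpha>2))\<^sup>2)" for s t
  proof -
    have "(l * (\<sigma>1 * f' (\<sigma>1 * s + \<alpha>1)))\<^sup>2 + (l * (\<sigma>2 * g' (\<sigma>2 * t + \<alpha>2)))\<^sup>2 =
        l\<^sup>2 * ((f' (\<sigma>1 * s + \<alpha>1))\<^sup>2 + (g' (\<sigma>2 * t + \<alpha>2))\<^sup>2)"
      by (simp add: power_mult_distrib assms algebra_simps)
    then show ?thesis by (simp add: energy power_mult_distrib algebra_simps)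
  qed
qed (rule c)

text \<open>Changing coordinates in \<open>f\<close> and \<open>g\<close> transports \<open>\<xi>\<close> by the isometry, and a common factor \<open>l\<close> scales
  \<open>\<Omega>\<close> and \<open>\<xi>\<close> by \<open>l\<close> and \<open>S\<close> by \<open>l\<^sup>2\<close>, so that it drops out of \<open>(2\<Omega>/S) \<xi>\<close>.\<close>

lemma XT_symmetry:
  assumes sym: "torus_symmetry r1 r2 A (affine_coords \<sigma>1 \<alpha>1 \<sigma>2 \<alpha>2)" and \<sigma>: "\<sigma>1\<^sup>2 = 1" "\<sigma>2\<^sup>2 = 1"
    and "l \<noteq> 0" and Q0: "Q (affine_coords \<sigma>1 \<alpha>1 \<sigma>2 \<alpha>2 u) \<noteq> 0"
  shows "A (XT (affine_coords \<sigma>1 \<alpha>1 \<sigma>2 \<alpha>2 u)) =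
    Xtilde r1 r2 c (\<lambda>s. l * f (\<sigma>1 * s + \<alpha>1)) (\<lambda>t. l * g (\<sigma>2 * t + \<alpha>2)) u"
proof -
  let ?\<phi> = "affine_coords \<sigma>1 \<alpha>1 \<sigma>2 \<alpha>2"
  interpret P: ribaucour_profile r1 r2 c "\<lambda>s. l * f (\<sigma>1 * s + \<alpha>1)" "\<lambda>t. l * g (\<sigma>2 * t + \<alpha>2)"
    "\<lambda>s. l * (\<sigma>1 * f' (\<sigma>1 * s + \<alpha>1))" "\<lambda>t. l * (\<sigma>2 * g' (\<sigma>2 * t + \<alpha>2))"
    by (rule rescaled_profile[OF \<sigma>])
  have "linear A" using sym by (simp add: torus_symmetry_def orthogonal_transformation_def)
  then interpret A: linear A .
  have T: "A (torus r1 r2 (?\<phi> u)) = torus r1 r2 u"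
    using sym unfolding torus_symmetry_def by (metis comp_apply)
  have OmP: "P.Om u = l * Om (?\<phi> u)" 
    unfolding P.Om_eq Om_eq by (simp add: affine_coords_def algebra_simps)
  have QP: "P.Q u = l\<^sup>2 * Q (?\<phi> u)"
    unfolding P.Q_def Q_def by (simp add: affine_coords_def power_mult_distrib algebra_simps)
  have SP: "P.S u = l\<^sup>2 * S (?\<phi> u)" unfolding P.S_eq S_eq QP by simp
  have \<xi>P: "P.\<xi> u = l *\<^sub>R A (\<xi> (?\<phi> u))"
    unfolding P.\<xi>_def \<xi>_def A.add A.scaleR symmetry_frame[OF sym \<sigma>]
    by (simp add: affine_coords_def scaleR_add_right mult_ac)
  have "Q (?\<phi> u) \<noteq> 0" "P.Q u \<noteq> 0" using Q0 \<open>l \<noteq> 0\<close> by (auto simp: QP)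
  moreover have "2 * P.Om u / P.S u * l = 2 * Om (?\<phi> u) / S (?\<phi> u)"
    unfolding OmP SP using \<open>l \<noteq> 0\<close> S_nonzero[OF Q0] by (simp add: field_simps power2_eq_square)
  ultimately show ?thesis
    by (simp add: XT_eq P.XT_eq A.diff A.scaleR T \<xi>P)
qed

end

lemma Vset_rescaled:
  "l \<noteq> 0 \<Longrightarrow> u \<in> Vset r1 r2 (\<lambda>s. l * f (\<sigma>1 * s + \<alpha>1)) (\<lambda>t. l * g (\<sigma>2 * t + \<alpha>2))
    \<longleftrightarrow> affine_coords \<sigma>1 \<alpha>1 \<sigma>2 \<alpha>2 u \<in> Vset r1 r2 f g"
proof -
  assume l: "l \<noteq> 0"
  have "a * (l * x)\<^sup>2 - b * (l * y)\<^sup>2 - 2 * d * (l * z) * (l * w) = l\<^sup>2 * (a * x\<^sup>2 - b * y\<^sup>2 - 2 * d * z * w)"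
    for a b d x y z w :: real
    by (simp add: power2_eq_square algebra_simps)
  then show ?thesis using l by (cases u) (simp add: Vset_def affine_coords_def)
qed

lemma nondegenerate_rescaled:
  "l \<noteq> 0 \<Longrightarrow> nondegenerate_at r1 r2 (Omega r1 r2 (\<lambda>s. l * f (\<sigma>1 * s + \<alpha>1)) (\<lambda>t. l * g (\<sigma>2 * t + \<alpha>2)))
     (Wfun r1 r2 (\<lambda>s. l * f (\<sigma>1 * s + \<alpha>1)) (\<lambda>t. l * g (\<sigma>2 * t + \<alpha>2))) u
    \<longleftrightarrow> nondegenerate_at r1 r2 (Omega r1 r2 f g) (Wfun r1 r2 f g) (affine_coords \<sigma>1 \<alpha>1 \<sigma>2 \<alpha>2 u)"
proof -
  assume l: "l \<noteq> 0"
  have 1: "Wfun r1 r2 (\<lambda>s. l * f (\<sigma>1 * s + \<alpha>1)) (\<lambda>t. l * g (\<sigma>2 * t + \<alpha>2)) u = l * Wfun r1 r2 f g (affine_coords \<sigma>1 \<alpha>1 \<sigma>2 \<alpha>2 u)"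
    "Omega r1 r2 (\<lambda>s. l * f (\<sigma>1 * s + \<alpha>1)) (\<lambda>t. l * g (\<sigma>2 * t + \<alpha>2)) u = l * Omega r1 r2 f g (affine_coords \<sigma>1 \<alpha>1 \<sigma>2 \<alpha>2 u)"
    by (cases u, simp add: Wfun_def Omega_def affine_coords_def algebra_simps)+
  have "l * w + x * (l * y) = l * (w + x * y)" for w x y :: real
    by (simp add: algebra_simps)
  then show ?thesis unfolding nondegenerate_at_def 1 using l by simp
qed

section \<open>The three families as normal forms\<close>

lemma exp_combination_degenerate:
  fixes P Q k :: real
  assumes "P * Q = 0" "P \<noteq> 0 \<or> Q \<noteq> 0"
  shows "\<exists>a \<epsilon>. a \<noteq> 0 \<and> \<epsilon>\<^sup>2 = 1 \<and> (\<forall>s. P * exp (k * s) + Q * exp (- k * s) = a * exp (\<epsilon> * k * s))"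
proof (cases "P = 0")
  case True
  then show ?thesis using assms by (intro exI[of _ Q] exI[of _ "-1"]) simp
next
  case False
  then show ?thesis using assms by (intro exI[of _ P] exI[of _ 1]) simp
qed

text \<open>The translation \<open>\<alpha>\<close> is chosen such that \<open>e\<^sup>2\<^sup>k\<^sup>\<alpha> = P / Q\<close>, which makes both exponentials in the
  hyperbolic cosine carry the same coefficient \<open>m = P e\<^sup>-\<^sup>k\<^sup>\<alpha>\<close>.\<close>

lemma exp_combination_cosh:
  fixes P Q k :: real
  assumes "P * Q > 0" "k > 0"
  shows "\<exists>m \<alpha>. m\<^sup>2 = P * Q \<and> (\<forall>s. P * exp (k * s) + Q * exp (- k * s) = 2 * m * cosh (k * (s + \<alpha>)))"
proof -
  define \<alpha> where "\<alpha> = ln (P / Q) / (2 * k)"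
  define E where "E = exp (k * \<alpha>)"
  have nz: "P \<noteq> 0" "Q \<noteq> 0" "E > 0" using assms by (auto simp: E_def)
  have "P / Q > 0" using assms by (auto simp: zero_less_mult_iff zero_less_divide_iff)
  then have "E * E = P / Q" using assms(2) by (simp add: E_def \<alpha>_def exp_add[symmetric])
  then have E: "P / E / E = Q" using nz by (simp add: field_simps)
  have "P * exp (k * s) + Q * exp (- k * s) = 2 * (P / E) * cosh (k * (s + \<alpha>))" for s
  proof -
    have ex: "exp (k * (s + \<alpha>)) = exp (k * s) * E" "exp (- (k * (s + \<alpha>))) = exp (- k * s) / E"
      by (simp_all add: E_def exp_add[symmetric] exp_diff[symmetric] algebra_simps)
    have "2 * (P / E) * cosh (k * (s + \<alpha>)) = P / E * (exp (k * s) * E) + P / E * (exp (- k * s) / E)"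
      unfolding cosh_field_def ex by (simp add: algebra_simps add_divide_distrib)
    also have "\<dots> = P * exp (k * s) + (P / E / E) * exp (- k * s)" using nz by simp
    finally show ?thesis unfolding E by simp
  qed
  moreover have "(P / E)\<^sup>2 = P * (P / E / E)" by (simp add: power2_eq_square)
  ultimately show ?thesis unfolding E by blast
qed

lemma exp_combination_sinh:
  fixes P Q k :: real
  assumes "P * Q < 0" "k > 0"
  shows "\<exists>m \<alpha>. m\<^sup>2 = - (P * Q) \<and> (\<forall>s. P * exp (k * s) + Q * exp (- k * s) = 2 * m * sinh (k * (s + \<alpha>)))"
proof -
  define \<alpha> where "\<alpha> = ln (- P / Q) / (2 * k)"
  define E where "E = exp (k * \<alpha>)"
  have nz: "P \<noteq> 0" "Q \<noteq> 0" "E > 0" using assms by (auto simp: E_def)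
  have "- P / Q > 0" using assms by (auto simp: mult_less_0_iff zero_less_divide_iff divide_less_0_iff)
  then have "E * E = - P / Q" using assms(2) by (simp add: E_def \<alpha>_def exp_add[symmetric])
  then have E: "P / E / E = - Q" using nz by (simp add: field_simps)
  have "P * exp (k * s) + Q * exp (- k * s) = 2 * (P / E) * sinh (k * (s + \<alpha>))" for s
  proof -
    have ex: "exp (k * (s + \<alpha>)) = exp (k * s) * E" "exp (- (k * (s + \<alpha>))) = exp (- k * s) / E"
      by (simp_all add: E_def exp_add[symmetric] exp_diff[symmetric] algebra_simps)
    have "2 * (P / E) * sinh (k * (s + \<alpha>)) = P / E * (exp (k * s) * E) - P / E * (exp (- k * s) / E)"
      unfolding sinh_field_def ex by (simp add: algebra_simps diff_divide_distrib)
    also have "\<dots> = P * exp (k * s) - (P / E / E) * exp (- k * s)" using nz by simp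
    finally show ?thesis unfolding E by simp
  qed
  moreover have "(P / E)\<^sup>2 = P * (P / E / E)" by (simp add: power2_eq_square)
  ultimately show ?thesis unfolding E by auto
qed

context torus_radii
begin

text \<open>The relation forces \<open>P' Q'\<close> to be \<open>- (r\<^sub>2/r\<^sub>1)\<^sup>2 P Q\<close>. So if one of the two functions is a hyperbolic
  cosine the other is a hyperbolic sine, and their amplitudes have the ratio \<open>r\<^sub>2/r\<^sub>1\<close> up to sign. The sign is
  moved into the argument of the odd function, where it becomes a reflection of the coordinate.\<close>

lemma flat_family_normal_form:
  assumes "c > 0" and rel: "r2\<^sup>2 * (P * Q) + r1\<^sup>2 * (P' * Q') = 0"
    and nz: "P \<noteq> 0 \<or> Q \<noteq> 0" "P' \<noteq> 0 \<or> Q' \<noteq> 0"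
  shows "\<exists>f g l \<sigma>1 \<alpha>1 \<sigma>2 \<alpha>2. flat_family r1 r2 c f g \<and> l \<noteq> 0 \<and> \<sigma>1\<^sup>2 = 1 \<and> \<sigma>2\<^sup>2 = 1 \<and>
    (\<forall>s. P * exp (r2 * sqrt c * s) + Q * exp (- (r2 * sqrt c) * s) = l * f (\<sigma>1 * s + \<alpha>1)) \<and>
    (\<forall>t. P' * exp (r1 * sqrt c * t) + Q' * exp (- (r1 * sqrt c) * t) = l * g (\<sigma>2 * t + \<alpha>2))"
proof -
  have k: "r2 * sqrt c > 0" "r1 * sqrt c > 0" using r1 r2 \<open>c > 0\<close> by auto
  have rel': "P' * Q' = - ((r2 / r1)\<^sup>2 * (P * Q))"
    using rel r1 by (simp add: power_divide field_simps)
  have pos: "(r2 / r1)\<^sup>2 > 0" using r1 r2 by simp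
  have sign: "\<exists>\<sigma>. \<sigma>\<^sup>2 = 1 \<and> y = \<sigma> * x" if "x\<^sup>2 = y\<^sup>2" for x y :: real
    using that by (cases "y = x") (auto simp: power2_eq_iff intro: exI[of _ 1] exI[of _ "-1"])
  have odd: "sinh (x * (\<sigma> * y)) = \<sigma> * sinh (x * y)" if "\<sigma>\<^sup>2 = 1" for x y \<sigma> :: real
    using sign_cases[OF that] by auto
  consider "P * Q = 0" | "P * Q > 0" | "P * Q < 0" by linarith
  then show ?thesis
  proof cases
    case 1
    then have "P' * Q' = 0" using rel' by simp
    obtain a \<epsilon> where a: "a \<noteq> 0" "\<epsilon>\<^sup>2 = 1" "\<And>s. P * exp (r2 * sqrt c * s) + Q * exp (- (r2 * sqrt c) * s) = a * exp (\<epsilon> * (r2 * sqrt c) * s)"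
      using exp_combination_degenerate[OF 1 nz(1)] by blast
    obtain b \<eta> where b: "b \<noteq> 0" "\<eta>\<^sup>2 = 1" "\<And>s. P' * exp (r1 * sqrt c * s) + Q' * exp (- (r1 * sqrt c) * s) = b * exp (\<eta> * (r1 * sqrt c) * s)"
      using exp_combination_degenerate[OF \<open>P' * Q' = 0\<close> nz(2)] by blast
    have "flat_family r1 r2 c (\<lambda>t. a * exp (\<epsilon> * r2 * sqrt c * t)) (\<lambda>t. b * exp (\<eta> * r1 * sqrt c * t))"
      unfolding flat_family_def using a(1,2) b(1,2) by blast
    then show ?thesis unfolding a(3) b(3)
      by (rule_tac exI, rule_tac exI, rule_tac exI[of _ 1], rule_tac exI[of _ 1], rule_tac exI[of _ 0],
          rule_tac exI[of _ 1], rule_tac exI[of _ 0], intro conjI) (assumption | simp add: mult.assoc)+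
  next
    case 2
    then have "P' * Q' < 0" using rel' pos by simp
    obtain m \<alpha> where m: "m\<^sup>2 = P * Q" "\<And>s. P * exp (r2 * sqrt c * s) + Q * exp (- (r2 * sqrt c) * s) = 2 * m * cosh (r2 * sqrt c * (s + \<alpha>))"
      using exp_combination_cosh[OF 2 k(1)] by blast
    obtain n \<beta> where n: "n\<^sup>2 = - (P' * Q')" "\<And>s. P' * exp (r1 * sqrt c * s) + Q' * exp (- (r1 * sqrt c) * s) = 2 * n * sinh (r1 * sqrt c * (s + \<beta>))"
      using exp_combination_sinh[OF \<open>P' * Q' < 0\<close> k(2)] by blast
    have "m \<noteq> 0" using m(1) 2 by auto
    have "(r2 / r1 * m)\<^sup>2 = n\<^sup>2" unfolding n(1) rel' m(1)[symmetric] by (simp add: power_mult_distrib power_divide)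
    then obtain \<sigma> where \<sigma>: "\<sigma>\<^sup>2 = 1" "n = \<sigma> * (r2 / r1 * m)" using sign by blast
    have "2 * n * sinh (r1 * sqrt c * (t + \<beta>)) = 2 * m * (r2 / r1 * sinh (r1 * sqrt c * (\<sigma> * t + \<sigma> * \<beta>)))" for t
      using odd[OF \<sigma>(1), of "r1 * sqrt c" "t + \<beta>"] by (simp add: \<sigma>(2) distrib_left mult_ac)
    moreover have "flat_family r1 r2 c (\<lambda>t. cosh (r2 * sqrt c * t)) (\<lambda>t. r2 / r1 * sinh (r1 * sqrt c * t))"
      unfolding flat_family_def by blast
    ultimately show ?thesis unfolding m(2) n(2) using \<open>m \<noteq> 0\<close> \<sigma>(1)
      by (rule_tac exI, rule_tac exI, rule_tac exI[of _ "2 * m"], rule_tac exI[of _ 1], rule_tac exI[of _ \<alpha>],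
          rule_tac exI[of _ \<sigma>], rule_tac exI[of _ "\<sigma> * \<beta>"], intro conjI) (assumption | simp)+
  next
    case 3
    then have "P' * Q' > 0" using rel' pos by (simp add: mult_less_0_iff)
    obtain m \<alpha> where m: "m\<^sup>2 = - (P * Q)" "\<And>s. P * exp (r2 * sqrt c * s) + Q * exp (- (r2 * sqrt c) * s) = 2 * m * sinh (r2 * sqrt c * (s + \<alpha>))"
      using exp_combination_sinh[OF 3 k(1)] by blast
    obtain n \<beta> where n: "n\<^sup>2 = P' * Q'" "\<And>s. P' * exp (r1 * sqrt c * s) + Q' * exp (- (r1 * sqrt c) * s) = 2 * n * cosh (r1 * sqrt c * (s + \<beta>))"
      using exp_combination_cosh[OF \<open>P' * Q' > 0\<close> k(2)] by blast
    define l where "l = n * r1 / r2"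
    have l: "n = r2 / r1 * l" using r1 r2 by (simp add: l_def)
    have "m \<noteq> 0" "n \<noteq> 0" using m(1) n(1) 3 \<open>P' * Q' > 0\<close> by auto
    have "(r2 / r1)\<^sup>2 * l\<^sup>2 = (r2 / r1)\<^sup>2 * m\<^sup>2"
      using n(1) unfolding rel' m(1) l power_mult_distrib by simp
    then have "l\<^sup>2 = m\<^sup>2" using pos by simp
    then obtain \<sigma> where \<sigma>: "\<sigma>\<^sup>2 = 1" "m = \<sigma> * l" using sign by blast
    have "2 * m * sinh (r2 * sqrt c * (t + \<alpha>)) = 2 * l * sinh (r2 * sqrt c * (\<sigma> * t + \<sigma> * \<alpha>))" for t
      using odd[OF \<sigma>(1), of "r2 * sqrt c" "t + \<alpha>"] by (simp add: \<sigma>(2) distrib_left mult_ac)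
    moreover have "2 * n * x = 2 * l * (r2 / r1 * x)" for x by (simp add: l)
    moreover have "l \<noteq> 0" using \<open>n \<noteq> 0\<close> l by auto
    moreover have "flat_family r1 r2 c (\<lambda>t. sinh (r2 * sqrt c * t)) (\<lambda>t. r2 / r1 * cosh (r1 * sqrt c * t))"
      unfolding flat_family_def by blast
    ultimately show ?thesis unfolding m(2) n(2) using \<sigma>(1)
      by (rule_tac exI, rule_tac exI, rule_tac exI[of _ "2 * l"], rule_tac exI[of _ \<sigma>], rule_tac exI[of _ "\<sigma> * \<alpha>"],
          rule_tac exI[of _ 1], rule_tac exI[of _ \<beta>], intro conjI) (assumption | simp)+
  qed
qed

text \<open>In the first two families the additional relation is \<open>cosh\<^sup>2 - sinh\<^sup>2 = 1\<close>, for which the factor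
  \<open>r\<^sub>2/r\<^sub>1\<close> in \<open>g\<close> is needed; in the third each of the two functions satisfies it separately.\<close>

lemma flat_family_profile:
  assumes "c > 0" "flat_family r1 r2 c f g"
  shows "\<exists>f' g'. ribaucour_profile r1 r2 c f g f' g'"
proof -
  have ch: "(cosh x)\<^sup>2 = 1 + (sinh x)\<^sup>2" for x :: real by (simp add: cosh_square_eq)
  let ?a = "r2 * sqrt c" and ?b = "r1 * sqrt c"
  have ab: "?a\<^sup>2 = c * r2\<^sup>2" "?b\<^sup>2 = c * r1\<^sup>2" using assms(1) by (simp_all add: power_mult_distrib)
  have chs: "((\<lambda>t. cosh (k * t)) has_real_derivative k * sinh (k * t)) (at t)"
    "((\<lambda>t. sinh (k * t)) has_real_derivative k * cosh (k * t)) (at t)" for k t :: real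
    by (auto intro!: derivative_eq_intros)
  have dcm: "((\<lambda>t. m * cosh (k * t)) has_real_derivative m * (k * sinh (k * t))) (at t)"
    "((\<lambda>t. m * sinh (k * t)) has_real_derivative m * (k * cosh (k * t))) (at t)" for m k t :: real
    by (rule DERIV_cmult[OF chs(1)] DERIV_cmult[OF chs(2)])+
  show ?thesis using assms(2) unfolding flat_family_def
  proof (elim disjE exE conjE)
    assume f: "f = (\<lambda>t. cosh (?a * t))" "g = (\<lambda>t. r2 / r1 * sinh (?b * t))"
    have "ribaucour_profile r1 r2 c f g (\<lambda>t. ?a * sinh (?a * t)) (\<lambda>t. r2 / r1 * (?b * cosh (?b * t)))"
    proof
      show "c > 0" by (rule assms(1))
      show "(f has_real_derivative ?a * sinh (?a * t)) (at t)" for t unfolding f by (rule chs)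
      show "(g has_real_derivative r2 / r1 * (?b * cosh (?b * t))) (at t)" for t unfolding f by (rule dcm)
      show "((\<lambda>t. ?a * sinh (?a * t)) has_real_derivative c * r2\<^sup>2 * f t) (at t)" for t
        using dcm(2)[of "?a" "?a" t] unfolding f ab(1)[symmetric] by (simp only: power2_eq_square mult_ac)
      show "((\<lambda>t. r2 / r1 * (?b * cosh (?b * t))) has_real_derivative c * r1\<^sup>2 * g t) (at t)" for t
        using dcm(1)[of "r2 / r1 * ?b" "?b" t] unfolding f ab(2)[symmetric] by (simp only: power2_eq_square mult_ac)
      show "(?a * sinh (?a * s))\<^sup>2 + (r2 / r1 * (?b * cosh (?b * t)))\<^sup>2 = c * (r2\<^sup>2 * (f s)\<^sup>2 + r1\<^sup>2 * (g t)\<^sup>2)" for s t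
        unfolding f power_mult_distrib[of ?a] power_mult_distrib[of ?b] power_mult_distrib[of "r2 / r1"] ab ch
        using r1 by (simp add: field_simps)
    qed
    then show ?thesis by blast
  next
    assume f: "f = (\<lambda>t. sinh (?a * t))" "g = (\<lambda>t. r2 / r1 * cosh (?b * t))"
    have "ribaucour_profile r1 r2 c f g (\<lambda>t. ?a * cosh (?a * t)) (\<lambda>t. r2 / r1 * (?b * sinh (?b * t)))"
    proof
      show "c > 0" by (rule assms(1))
      show "(f has_real_derivative ?a * cosh (?a * t)) (at t)" for t unfolding f by (rule chs)
      show "(g has_real_derivative r2 / r1 * (?b * sinh (?b * t))) (at t)" for t unfolding f by (rule dcm)
      show "((\<lambda>t. ?a * cosh (?a * t)) has_real_derivative c * r2\<^sup>2 * f t) (at t)" for t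
        using dcm(1)[of "?a" "?a" t] unfolding f ab(1)[symmetric] by (simp only: power2_eq_square mult_ac)
      show "((\<lambda>t. r2 / r1 * (?b * sinh (?b * t))) has_real_derivative c * r1\<^sup>2 * g t) (at t)" for t
        using dcm(2)[of "r2 / r1 * ?b" "?b" t] unfolding f ab(2)[symmetric] by (simp only: power2_eq_square mult_ac)
      show "(?a * cosh (?a * s))\<^sup>2 + (r2 / r1 * (?b * sinh (?b * t)))\<^sup>2 = c * (r2\<^sup>2 * (f s)\<^sup>2 + r1\<^sup>2 * (g t)\<^sup>2)" for s t
        unfolding f power_mult_distrib[of ?a] power_mult_distrib[of ?b] power_mult_distrib[of "r2 / r1"] ab ch
        using r1 by (simp add: field_simps)
    qed
    then show ?thesis by blast
  next
    fix a1 b1 \<epsilon>1 \<epsilon>2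
    assume \<epsilon>: "\<epsilon>1\<^sup>2 = 1" "\<epsilon>2\<^sup>2 = 1"
      and f: "f = (\<lambda>t. a1 * exp (\<epsilon>1 * r2 * sqrt c * t))" "g = (\<lambda>t. b1 * exp (\<epsilon>2 * r1 * sqrt c * t))"
    let ?p = "\<epsilon>1 * r2 * sqrt c" and ?q = "\<epsilon>2 * r1 * sqrt c"
    have pq: "?p\<^sup>2 = c * r2\<^sup>2" "?q\<^sup>2 = c * r1\<^sup>2" using assms(1) \<epsilon> by (simp_all add: power_mult_distrib)
    have de: "((\<lambda>t. m * exp (k * t)) has_real_derivative k * (m * exp (k * t))) (at t)" for m k t :: real
      by (auto intro!: derivative_eq_intros)
    have de2: "((\<lambda>t. k * (m * exp (k * t))) has_real_derivative k\<^sup>2 * (m * exp (k * t))) (at t)" for m k t :: real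
      by (auto intro!: derivative_eq_intros simp: power2_eq_square)
    have "ribaucour_profile r1 r2 c f g (\<lambda>t. ?p * f t) (\<lambda>t. ?q * g t)"
    proof
      show "c > 0" by (rule assms(1))
      show "(f has_real_derivative ?p * f t) (at t)" "(g has_real_derivative ?q * g t) (at t)" for t
        unfolding f by (rule de)+
      show "((\<lambda>t. ?p * f t) has_real_derivative c * r2\<^sup>2 * f t) (at t)"
        "((\<lambda>t. ?q * g t) has_real_derivative c * r1\<^sup>2 * g t) (at t)" for t
        unfolding f pq[symmetric] by (rule de2)+
      show "(?p * f s)\<^sup>2 + (?q * g t)\<^sup>2 = c * (r2\<^sup>2 * (f s)\<^sup>2 + r1\<^sup>2 * (g t)\<^sup>2)" for s t
        unfolding power_mult_distrib[of ?p] power_mult_distrib[of ?q] pq by (simp add: algebra_simps)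
    qed
    then show ?thesis by blast
  qed
qed

end

section \<open>Data of an associated surface and the classification\<close>

context torus_radii
begin

text \<open>The functions \<open>F\<close> and \<open>G\<close> in the proof are \<open>f\<close> and \<open>g\<close> recovered from \<open>\<Omega>\<close> and \<open>W\<close>. Nondegeneracy is
  what makes them free of zeros, and nonconstancy of \<open>\<Omega>/W\<close> excludes the constant alternative of
  \<open>separated_profile\<close> for each of them in turn.\<close>

lemma ribaucour_data_normal_form:
  assumes c: "c > 0" and D: "open D" "connected D" "u0 \<in> D"
    and data: "ribaucour_data r1 r2 D W Om om"
    and nonconst: "nonconstant_along_curvature_lines D (\<lambda>u. Om u / W u)"
    and rel: "\<And>u. u \<in> D \<Longrightarrow> (om 1 u)\<^sup>2 + (om 2 u)\<^sup>2 = c * ((Om u)\<^sup>2 + (W u)\<^sup>2)"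
  defines "k1 \<equiv> r2 * sqrt c" and "k2 \<equiv> r1 * sqrt c"
  shows "\<exists>P Q P' Q'. r2\<^sup>2 * (P * Q) + r1\<^sup>2 * (P' * Q') = 0 \<and> (P \<noteq> 0 \<or> Q \<noteq> 0) \<and> (P' \<noteq> 0 \<or> Q' \<noteq> 0) \<and>
    (\<forall>u\<in>D. Om u = r1 * r2 * ((P * exp (k1 * fst u) + Q * exp (- k1 * fst u)) + (P' * exp (k2 * snd u) + Q' * exp (- k2 * snd u)))
      \<and> W u = r2\<^sup>2 * (P * exp (k1 * fst u) + Q * exp (- k1 * fst u)) - r1\<^sup>2 * (P' * exp (k2 * snd u) + Q' * exp (- k2 * snd u))
      \<and> om 1 u = k1 * (P * exp (k1 * fst u) - Q * exp (- k1 * fst u))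
      \<and> om 2 u = k2 * (P' * exp (k2 * snd u) - Q' * exp (- k2 * snd u)))"
proof -
  have k: "k1 > 0" "k2 > 0" using c r1 r2 by (auto simp: k1_def k2_def)
  have ksq: "k1\<^sup>2 = c * r2\<^sup>2" "k2\<^sup>2 = c * r1\<^sup>2" using c by (simp_all add: k1_def k2_def power_mult_distrib)
  define F where "F = (\<lambda>u. (r1 / r2) * Om u + W u)"
  define G where "G = (\<lambda>u. (r2 / r1) * Om u - W u)"
  have diff: "W differentiable (at u)" "Om differentiable (at u)" "om 1 differentiable (at u)"
    "om 2 differentiable (at u)" if "u \<in> D" for u
    using data that by (simp_all add: ribaucour_data_def)
  have pdo: "has_pd 1 Om (r1 * r2 * om 1 u) u" "has_pd 2 Om (r1 * r2 * om 2 u) u"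
    "has_pd 1 W (r2\<^sup>2 * om 1 u) u" "has_pd 2 W (- (r1\<^sup>2 * om 2 u)) u"
    "has_pd 2 (om 1) 0 u" "has_pd 1 (om 2) 0 u" "has_pd 1 (om 1) (pd 1 (om 1) u) u" "has_pd 2 (om 2) (pd 2 (om 2) u) u"
    if u: "u \<in> D" for u
  proof -
    have e: "pd 1 Om u = r1 * r2 * om 1 u" "pd 2 Om u = r1 * r2 * om 2 u"
      "pd 1 W u = - r1 * r2 * lam r1 r2 1 * om 1 u" "pd 2 W u = - r1 * r2 * lam r1 r2 2 * om 2 u"
      "pd 2 (om 1) u = 0" "pd 1 (om 2) u = 0"
      using data u by (simp_all add: ribaucour_data_def del: One_nat_def)
    have l: "- r1 * r2 * lam r1 r2 1 * om 1 u = r2\<^sup>2 * om 1 u" "- r1 * r2 * lam r1 r2 2 * om 2 u = - (r1\<^sup>2 * om 2 u)"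
      using r1 r2 by (simp_all add: lam_def power2_eq_square)
    note p = diff[OF u, THEN differentiable_imp_has_pd]
    show "has_pd 1 Om (r1 * r2 * om 1 u) u" "has_pd 2 Om (r1 * r2 * om 2 u) u"
      using p(2)[of 1] p(2)[of 2] unfolding e by blast+
    show "has_pd 1 W (r2\<^sup>2 * om 1 u) u" "has_pd 2 W (- (r1\<^sup>2 * om 2 u)) u"
      using p(1)[of 1] p(1)[of 2] unfolding e l by blast+
    show "has_pd 2 (om 1) 0 u" "has_pd 1 (om 2) 0 u"
      using p(3)[of 2] p(4)[of 1] unfolding e by blast+
    show "has_pd 1 (om 1) (pd 1 (om 1) u) u" "has_pd 2 (om 2) (pd 2 (om 2) u) u"
      by (rule p(3) p(4))+
  qed
  have diffFG: "F differentiable (at u)" "G differentiable (at u)" if "u \<in> D" for u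
    unfolding F_def G_def
    by (intro differentiable_add differentiable_diff differentiable_mult differentiable_const diff that)+
  have pdF: "has_pd 1 F (om 1 u) u" "has_pd 2 F 0 u" "has_pd 1 G 0 u" "has_pd 2 G (om 2 u) u" if u: "u \<in> D" for u
  proof -
    note p = pdo[OF u]
    have one: "r1 / r2 * (r1 * r2 * x) + r2\<^sup>2 * x = x" "r2 / r1 * (r1 * r2 * x) - - (r1\<^sup>2 * x) = x" for x
    proof -
      have "r1 / r2 * (r1 * r2 * x) + r2\<^sup>2 * x = (r1\<^sup>2 + r2\<^sup>2) * x"
        using r2 by (simp add: power2_eq_square algebra_simps)
      then show "r1 / r2 * (r1 * r2 * x) + r2\<^sup>2 * x = x" by (simp add: r12)
      have "r2 / r1 * (r1 * r2 * x) - - (r1\<^sup>2 * x) = (r1\<^sup>2 + r2\<^sup>2) * x"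
        using r1 by (simp add: power2_eq_square algebra_simps)
      then show "r2 / r1 * (r1 * r2 * x) - - (r1\<^sup>2 * x) = x" by (simp add: r12)
    qed
    have zero: "r1 / r2 * (r1 * r2 * x) + - (r1\<^sup>2 * x) = 0" "r2 / r1 * (r1 * r2 * x) - r2\<^sup>2 * x = 0" for x
      using r1 r2 by (simp_all add: power2_eq_square)
    show "has_pd 1 F (om 1 u) u"
      using has_pd_add[OF has_pd_mult[OF has_pd_const p(1)] p(3), of "r1 / r2"] unfolding F_def[symmetric] mult_zero_left add_0_right one .
    show "has_pd 2 F 0 u"
      using has_pd_add[OF has_pd_mult[OF has_pd_const p(2)] p(4), of "r1 / r2"] unfolding F_def[symmetric] mult_zero_left add_0_right zero .
    show "has_pd 1 G 0 u"
      using has_pd_diff[OF has_pd_mult[OF has_pd_const p(1)] p(3), of "r2 / r1"] unfolding G_def[symmetric] mult_zero_left add_0_right zero .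
    show "has_pd 2 G (om 2 u) u"
      using has_pd_diff[OF has_pd_mult[OF has_pd_const p(2)] p(4), of "r2 / r1"] unfolding G_def[symmetric] mult_zero_left add_0_right one .
  qed
  have nz: "F u \<noteq> 0" "G u \<noteq> 0" if "u \<in> D" for u
  proof -
    have n: "nondegenerate_at r1 r2 Om W u" using data that by (simp add: ribaucour_data_def)
    have "W u + lam r1 r2 2 * Om u = F u" "W u + lam r1 r2 1 * Om u = - G u" by (simp_all add: F_def G_def lam_def)
    then show "F u \<noteq> 0" "G u \<noteq> 0" using n unfolding nondegenerate_at_def by force+
  qed
  have OmW: "Om u = r1 * r2 * (F u + G u)" "W u = r2\<^sup>2 * F u - r1\<^sup>2 * G u" for u
  proof -
    have "r1 * r2 * (F u + G u) = (r1\<^sup>2 + r2\<^sup>2) * Om u"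
      using r1 r2 by (simp add: F_def G_def power2_eq_square field_simps)
    then show "Om u = r1 * r2 * (F u + G u)" by (simp add: r12)
    have "r2\<^sup>2 * F u - r1\<^sup>2 * G u = (r1\<^sup>2 + r2\<^sup>2) * W u"
      using r1 r2 by (simp add: F_def G_def power2_eq_square field_simps)
    then show "W u = r2\<^sup>2 * F u - r1\<^sup>2 * G u" by (simp add: r12)
  qed
  have rel': "(om 1 u)\<^sup>2 - k1\<^sup>2 * (F u)\<^sup>2 = k2\<^sup>2 * (G u)\<^sup>2 - (om 2 u)\<^sup>2" if "u \<in> D" for u
  proof -
    have "(Om u)\<^sup>2 + (W u)\<^sup>2 = (r1\<^sup>2 + r2\<^sup>2) * (r2\<^sup>2 * (F u)\<^sup>2 + r1\<^sup>2 * (G u)\<^sup>2)"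
      unfolding OmW by (simp add: power2_eq_square algebra_simps)
    then have "(om 1 u)\<^sup>2 + (om 2 u)\<^sup>2 = c * (r2\<^sup>2 * (F u)\<^sup>2 + r1\<^sup>2 * (G u)\<^sup>2)"
      using rel[OF that] by (simp add: r12)
    then show ?thesis unfolding ksq by (simp add: algebra_simps)
  qed
  have pq1: "om 1 u * (pd 1 (om 1) u - k1\<^sup>2 * F u) = 0" if u: "u \<in> D" for u
  proof -
    have "has_pd 1 (\<lambda>u. (om 1 u)\<^sup>2 - k1\<^sup>2 * (F u)\<^sup>2)
        (2 * om 1 u * pd 1 (om 1) u - (k1\<^sup>2 * (2 * F u * om 1 u) + 0 * (F u)\<^sup>2)) u"
      by (intro has_pd_diff has_pd_power2 has_pd_mult has_pd_const pdo(7) pdF(1) u)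
    moreover have "has_pd 1 (\<lambda>u. (om 1 u)\<^sup>2 - k1\<^sup>2 * (F u)\<^sup>2)
        (k2\<^sup>2 * (2 * G u * 0) + 0 * (G u)\<^sup>2 - 2 * om 2 u * 0) u"
      by (rule has_pd_cong[OF D(1) u rel'[symmetric]])
         (assumption | intro has_pd_diff has_pd_power2 has_pd_mult has_pd_const pdo(6) pdF(3) u)+
    ultimately have "2 * om 1 u * pd 1 (om 1) u - (k1\<^sup>2 * (2 * F u * om 1 u) + 0 * (F u)\<^sup>2)
        = k2\<^sup>2 * (2 * G u * 0) + 0 * (G u)\<^sup>2 - 2 * om 2 u * 0"
      by (blast dest: has_pd_unique)
    then show ?thesis by (simp add: algebra_simps)
  qed
  have pq2: "om 2 u * (pd 2 (om 2) u - k2\<^sup>2 * G u) = 0" if u: "u \<in> D" for u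
  proof -
    have "has_pd 2 (\<lambda>u. k2\<^sup>2 * (G u)\<^sup>2 - (om 2 u)\<^sup>2)
        (k2\<^sup>2 * (2 * G u * om 2 u) + 0 * (G u)\<^sup>2 - 2 * om 2 u * pd 2 (om 2) u) u"
      by (intro has_pd_diff has_pd_power2 has_pd_mult has_pd_const pdo(8) pdF(4) u)
    moreover have "has_pd 2 (\<lambda>u. k2\<^sup>2 * (G u)\<^sup>2 - (om 2 u)\<^sup>2)
        (2 * om 1 u * 0 - (k1\<^sup>2 * (2 * F u * 0) + 0 * (F u)\<^sup>2)) u"
      by (rule has_pd_cong[OF D(1) u rel'])
         (assumption | intro has_pd_diff has_pd_power2 has_pd_mult has_pd_const pdo(5) pdF(2) u)+
    ultimately have "k2\<^sup>2 * (2 * G u * om 2 u) + 0 * (G u)\<^sup>2 - 2 * om 2 u * pd 2 (om 2) u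
        = 2 * om 1 u * 0 - (k1\<^sup>2 * (2 * F u * 0) + 0 * (F u)\<^sup>2)"
      by (blast dest: has_pd_unique)
    then show ?thesis by (auto simp: algebra_simps)
  qed
  have dich1: "(\<forall>u\<in>D. om 1 u = 0) \<or> (\<exists>P Q. \<forall>u\<in>D. F u = P * exp (k1 * fst u) + Q * exp (- k1 * fst u)
      \<and> om 1 u = k1 * (P * exp (k1 * fst u) - Q * exp (- k1 * fst u)))"
    by (rule separated_profile[OF D(1,2) k(1) diffFG(1) diff(3) pdF(1,2) pdo(7,5) nz(1) pq1])
  have dich2: "(\<forall>u\<in>D. om 2 u = 0) \<or> (\<exists>P Q. \<forall>u\<in>D. G u = P * exp (k2 * snd u) + Q * exp (- k2 * snd u)
      \<and> om 2 u = k2 * (P * exp (k2 * snd u) - Q * exp (- k2 * snd u)))"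
    by (rule separated_profile_snd[OF D(1,2) k(2) diffFG(2) diff(4) pdF(4,3) pdo(8,6) nz(2) pq2])
  \<comment> \<open>If both were constant, the relation would force \<open>r\<^sub>2\<^sup>2 f\<^sup>2 + r\<^sub>1\<^sup>2 g\<^sup>2 = 0\<close>.\<close>
  have not_both: False if "\<forall>u\<in>D. om 1 u = 0" "\<forall>u\<in>D. om 2 u = 0"
  proof -
    have "k1\<^sup>2 * (F u0)\<^sup>2 + k2\<^sup>2 * (G u0)\<^sup>2 = 0" using rel'[OF D(3)] that D(3) by simp
    moreover have "k1\<^sup>2 * (F u0)\<^sup>2 > 0" "k2\<^sup>2 * (G u0)\<^sup>2 > 0" using k nz[OF D(3)] by simp_all
    ultimately show False by linarith
  qed
  have "\<not> (\<forall>u\<in>D. om 1 u = 0)"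
  proof
    assume z: "\<forall>u\<in>D. om 1 u = 0"
    obtain P Q where G: "\<And>u. u \<in> D \<Longrightarrow> G u = P * exp (k2 * snd u) + Q * exp (- k2 * snd u)"
      using dich2 not_both[OF z] by blast
    have "\<exists>d. \<forall>u\<in>D. F u = d"
      by (rule constant_if_pd_zero[OF D(1,2) diffFG(1) _ pdF(2)]) (use pdF(1) z in fastforce)+
    then obtain d where F: "\<And>u. u \<in> D \<Longrightarrow> F u = d" by blast
    have "\<And>t. (t, snd u0) \<in> D \<Longrightarrow> Om (t, snd u0) / W (t, snd u0) = Om u0 / W u0"
      unfolding OmW by (simp add: F G D(3))
    then have "(\<lambda>t. Om (t, snd u0) / W (t, snd u0)) constant_on {t. (t, snd u0) \<in> D}"
      unfolding constant_on_def by blast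
    then show False using nonconst D(3) unfolding nonconstant_along_curvature_lines_def by blast
  qed
  then obtain P Q where F: "\<And>u. u \<in> D \<Longrightarrow> F u = P * exp (k1 * fst u) + Q * exp (- k1 * fst u)"
    "\<And>u. u \<in> D \<Longrightarrow> om 1 u = k1 * (P * exp (k1 * fst u) - Q * exp (- k1 * fst u))"
    using dich1 by blast
  have "\<not> (\<forall>u\<in>D. om 2 u = 0)"
  proof
    assume z: "\<forall>u\<in>D. om 2 u = 0"
    have "\<exists>d. \<forall>u\<in>D. G u = d"
      by (rule constant_if_pd_zero[OF D(1,2) diffFG(2) pdF(3)]) (use pdF(4) z in fastforce)+
    then obtain d where G: "\<And>u. u \<in> D \<Longrightarrow> G u = d" by blast
    have "\<And>t. (fst u0, t) \<in> D \<Longrightarrow> Om (fst u0, t) / W (fst u0, t) = Om u0 / W u0"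
      unfolding OmW by (simp add: F G D(3))
    then have "(\<lambda>t. Om (fst u0, t) / W (fst u0, t)) constant_on {t. (fst u0, t) \<in> D}"
      unfolding constant_on_def by blast
    then show False using nonconst D(3) unfolding nonconstant_along_curvature_lines_def by blast
  qed
  then obtain P' Q' where G: "\<And>u. u \<in> D \<Longrightarrow> G u = P' * exp (k2 * snd u) + Q' * exp (- k2 * snd u)"
    "\<And>u. u \<in> D \<Longrightarrow> om 2 u = k2 * (P' * exp (k2 * snd u) - Q' * exp (- k2 * snd u))"
    using dich2 by blast
  \<comment> \<open>The first integrals in terms of the coefficients; the relation equates them at \<open>u0\<close>.\<close>
  have prod: "(k * (P * exp x - Q * exp (- x)))\<^sup>2 - k\<^sup>2 * (P * exp x + Q * exp (- x))\<^sup>2 = - 4 * k\<^sup>2 * (P * Q)" for k P Q x :: real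
  proof -
    have e: "exp x * exp (- x) = 1" by (simp add: exp_add[symmetric])
    have "(k * (P * exp x - Q * exp (- x)))\<^sup>2 - k\<^sup>2 * (P * exp x + Q * exp (- x))\<^sup>2
        = - 4 * k\<^sup>2 * (P * Q) * (exp x * exp (- x))"
      by (simp add: power2_eq_square algebra_simps del: exp_minus)
    then show ?thesis unfolding e by simp
  qed
  have "- 4 * k1\<^sup>2 * (P * Q) = 4 * k2\<^sup>2 * (P' * Q')"
    using rel'[OF D(3)] prod[of k1 P "k1 * fst u0" Q] prod[of k2 P' "k2 * snd u0" Q']
    unfolding F[OF D(3)] G[OF D(3)] mult_minus_left by linarith
  moreover have "4 * c * (r2\<^sup>2 * (P * Q) + r1\<^sup>2 * (P' * Q')) = 4 * k2\<^sup>2 * (P' * Q') - - 4 * k1\<^sup>2 * (P * Q)"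
    unfolding ksq by (simp add: algebra_simps)
  ultimately have "4 * c * (r2\<^sup>2 * (P * Q) + r1\<^sup>2 * (P' * Q')) = 0" by linarith
  then have "r2\<^sup>2 * (P * Q) + r1\<^sup>2 * (P' * Q') = 0" using c by simp
  moreover have "P \<noteq> 0 \<or> Q \<noteq> 0" "P' \<noteq> 0 \<or> Q' \<noteq> 0" using nz[OF D(3)] F(1)[OF D(3)] G(1)[OF D(3)] by auto
  moreover have "\<forall>u\<in>D. Om u = r1 * r2 * ((P * exp (k1 * fst u) + Q * exp (- k1 * fst u)) + (P' * exp (k2 * snd u) + Q' * exp (- k2 * snd u)))
      \<and> W u = r2\<^sup>2 * (P * exp (k1 * fst u) + Q * exp (- k1 * fst u)) - r1\<^sup>2 * (P' * exp (k2 * snd u) + Q' * exp (- k2 * snd u))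
      \<and> om 1 u = k1 * (P * exp (k1 * fst u) - Q * exp (- k1 * fst u))
      \<and> om 2 u = k2 * (P' * exp (k2 * snd u) - Q' * exp (- k2 * snd u))"
  proof
    fix u assume u: "u \<in> D"
    show "Om u = r1 * r2 * ((P * exp (k1 * fst u) + Q * exp (- k1 * fst u)) + (P' * exp (k2 * snd u) + Q' * exp (- k2 * snd u)))
      \<and> W u = r2\<^sup>2 * (P * exp (k1 * fst u) + Q * exp (- k1 * fst u)) - r1\<^sup>2 * (P' * exp (k2 * snd u) + Q' * exp (- k2 * snd u))
      \<and> om 1 u = k1 * (P * exp (k1 * fst u) - Q * exp (- k1 * fst u))
      \<and> om 2 u = k2 * (P' * exp (k2 * snd u) - Q' * exp (- k2 * snd u))"
      unfolding F(1)[OF u, symmetric] G(1)[OF u, symmetric] F(2)[OF u, symmetric] G(2)[OF u, symmetric]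
      using OmW by blast
  qed
  ultimately show ?thesis by blast
qed

text \<open>The profiles found for the data are a rescaling and a change of coordinates away from one of the
  three families, and \<open>XT_symmetry\<close> turns this into the isometry. Regularity of \<open>Xt\<close> says \<open>e h \<noteq> 0\<close>, which is
  membership in \<open>V\<close>.\<close>

lemma flat_ribaucour_imp_family:
  assumes c: "c > 0" and D: "open D" "connected D"
    and flat: "flat_surface D Xt" and assoc: "ribaucour_associated r1 r2 c D Xt"
  shows "\<exists>f g A \<phi>. flat_family r1 r2 c f g \<and> torus_symmetry r1 r2 A \<phi> \<and>
    (\<forall>u\<in>D. \<phi> u \<in> Vset r1 r2 f g \<and> nondegenerate_at r1 r2 (Omega r1 r2 f g) (Wfun r1 r2 f g) (\<phi> u) \<and>
      Xt u = A (Xtilde r1 r2 c f g (\<phi> u)))"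
proof (cases "D = {}")
  case True
  obtain A where "torus_symmetry r1 r2 A (affine_coords 1 0 1 0)" using torus_symmetry_exists[of 1 1] by auto
  moreover have "flat_family r1 r2 c (\<lambda>t. cosh (r2 * sqrt c * t)) (\<lambda>t. r2 / r1 * sinh (r1 * sqrt c * t))"
    unfolding flat_family_def by blast
  ultimately show ?thesis using True by blast
next
  case False
  then obtain u0 where u0: "u0 \<in> D" by blast
  obtain W Om om where data: "ribaucour_data r1 r2 D W Om om"
    and Xt: "\<And>u. u \<in> D \<Longrightarrow> Xt u = ribaucour_transform r1 r2 W Om om u"
    and nonconst: "nonconstant_along_curvature_lines D (\<lambda>u. Om u / W u)"
    and rel: "\<And>u. u \<in> D \<Longrightarrow> (om 1 u)\<^sup>2 + (om 2 u)\<^sup>2 = c * ((Om u)\<^sup>2 + (W u)\<^sup>2)"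
    using assoc unfolding ribaucour_associated_def by blast
  let ?k1 = "r2 * sqrt c" and ?k2 = "r1 * sqrt c"
  obtain P Q P' Q' where PQ: "r2\<^sup>2 * (P * Q) + r1\<^sup>2 * (P' * Q') = 0" "P \<noteq> 0 \<or> Q \<noteq> 0" "P' \<noteq> 0 \<or> Q' \<noteq> 0"
    and eqs: "\<And>u. u \<in> D \<Longrightarrow> Om u = r1 * r2 * ((P * exp (?k1 * fst u) + Q * exp (- ?k1 * fst u)) + (P' * exp (?k2 * snd u) + Q' * exp (- ?k2 * snd u)))"
      "\<And>u. u \<in> D \<Longrightarrow> W u = r2\<^sup>2 * (P * exp (?k1 * fst u) + Q * exp (- ?k1 * fst u)) - r1\<^sup>2 * (P' * exp (?k2 * snd u) + Q' * exp (- ?k2 * snd u))"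
      "\<And>u. u \<in> D \<Longrightarrow> om 1 u = ?k1 * (P * exp (?k1 * fst u) - Q * exp (- ?k1 * fst u))"
      "\<And>u. u \<in> D \<Longrightarrow> om 2 u = ?k2 * (P' * exp (?k2 * snd u) - Q' * exp (- ?k2 * snd u))"
    using ribaucour_data_normal_form[OF c D u0 data nonconst rel] by blast
  obtain f g l \<sigma>1 \<alpha>1 \<sigma>2 \<alpha>2 where fam: "flat_family r1 r2 c f g" and l: "l \<noteq> 0" and \<sigma>: "\<sigma>1\<^sup>2 = 1" "\<sigma>2\<^sup>2 = 1"
    and f: "\<And>s. P * exp (?k1 * s) + Q * exp (- ?k1 * s) = l * f (\<sigma>1 * s + \<alpha>1)"
    and g: "\<And>t. P' * exp (?k2 * t) + Q' * exp (- ?k2 * t) = l * g (\<sigma>2 * t + \<alpha>2)"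
    using flat_family_normal_form[OF c PQ] by blast
  obtain f' g' where "ribaucour_profile r1 r2 c f g f' g'" using flat_family_profile[OF c fam] by blast
  then interpret R: ribaucour_profile r1 r2 c f g f' g' .
  interpret S: ribaucour_profile r1 r2 c "\<lambda>s. l * f (\<sigma>1 * s + \<alpha>1)" "\<lambda>t. l * g (\<sigma>2 * t + \<alpha>2)"
    "\<lambda>s. l * (\<sigma>1 * f' (\<sigma>1 * s + \<alpha>1))" "\<lambda>t. l * (\<sigma>2 * g' (\<sigma>2 * t + \<alpha>2))"
    by (rule R.rescaled_profile[OF \<sigma>])
  let ?\<phi> = "affine_coords \<sigma>1 \<alpha>1 \<sigma>2 \<alpha>2"
  obtain A where A: "torus_symmetry r1 r2 A ?\<phi>" using torus_symmetry_exists[OF \<sigma>] by blast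
  have d: "((\<lambda>s. P * exp (k * s) + Q * exp (- k * s)) has_real_derivative k * (P * exp (k * s) - Q * exp (- k * s))) (at s)"
    for P Q k s :: real
    by (auto intro!: derivative_eq_intros simp: algebra_simps)
  \<comment> \<open>\<open>\<Omega>\<^sub>1\<close> and \<open>\<Omega>\<^sub>2\<close> are known as derivatives of the exponential forms, and these agree with the profiles.\<close>
  have df: "?k1 * (P * exp (?k1 * s) - Q * exp (- ?k1 * s)) = l * (\<sigma>1 * f' (\<sigma>1 * s + \<alpha>1))" for s
    using d[of P ?k1 Q s] S.df[of s] unfolding f by (rule DERIV_unique)
  have dg: "?k2 * (P' * exp (?k2 * s) - Q' * exp (- ?k2 * s)) = l * (\<sigma>2 * g' (\<sigma>2 * s + \<alpha>2))" for s
    using d[of P' ?k2 Q' s] S.dg[of s] unfolding g by (rule DERIV_unique)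
  have OmW: "Om u = S.Om u" "W u = S.W u" if "u \<in> D" for u
    unfolding eqs[OF that] f g S.Om_eq S.W_eq by simp_all
  have nd: "nondegenerate_at r1 r2 S.Om S.W u" if "u \<in> D" for u
  proof -
    have "nondegenerate_at r1 r2 Om W u" using data that by (simp add: ribaucour_data_def)
    then show ?thesis unfolding nondegenerate_at_def OmW[OF that] .
  qed
  have Q: "S.Q u \<noteq> 0" if "u \<in> D" for u by (rule S.Q_nonzero_if_nondegenerate[OF nd[OF that]])
  have XS: "Xt u = S.XT u" if u: "u \<in> D" for u
    unfolding Xt[OF u]
    by (rule S.ribaucour_transform_XT[of u Om W om, OF Q[OF u] OmW[OF u]])
       (simp_all only: eqs[OF u] df dg)
  have V: "u \<in> S.V" if u: "u \<in> D" for u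
  proof -
    have pd: "pd 1 Xt u = S.e u *\<^sub>R reflect (S.\<xi> u) (S1 u)" "pd 2 Xt u = S.h u *\<^sub>R reflect (S.\<xi> u) (S2 u)"
      using pd_cong[OF D(1) u XS[symmetric] S.XT_pd(1)[OF Q[OF u]]]
        pd_cong[OF D(1) u XS[symmetric] S.XT_pd(2)[OF Q[OF u]]] by blast+
    have reg: "a *\<^sub>R pd 1 Xt u + b *\<^sub>R pd 2 Xt u = 0 \<Longrightarrow> a = 0 \<and> b = 0" for a b
      using flat u unfolding flat_surface_def regular_surface_def by blast
    have "S.e u \<noteq> 0" using reg[of 1 0] unfolding pd by auto
    moreover have "S.h u \<noteq> 0" using reg[of 0 1] unfolding pd by auto
    ultimately show ?thesis using Q[OF u] by (simp add: S.V_iff)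
  qed
  have "?\<phi> u \<in> R.V \<and> nondegenerate_at r1 r2 R.Om R.W (?\<phi> u) \<and> Xt u = A (R.XT (?\<phi> u))" if u: "u \<in> D" for u
  proof (intro conjI)
    show *: "?\<phi> u \<in> R.V" using V[OF u] Vset_rescaled[OF l] by blast
    show "nondegenerate_at r1 r2 R.Om R.W (?\<phi> u)" using nd[OF u] nondegenerate_rescaled[OF l] by blast
    have "R.Q (?\<phi> u) \<noteq> 0" using * R.V_iff by blast
    then show "Xt u = A (R.XT (?\<phi> u))" unfolding XS[OF u] by (rule R.XT_symmetry[OF A \<sigma> l, symmetric])
  qed
  then show ?thesis using fam A by blast
qed

lemma family_imp_flat_ribaucour:
  assumes c: "c > 0" and D: "open D"
    and fam: "flat_family r1 r2 c f g" and sym: "torus_symmetry r1 r2 A \<phi>"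
    and X: "\<And>u. u \<in> D \<Longrightarrow> \<phi> u \<in> Vset r1 r2 f g \<and>
      nondegenerate_at r1 r2 (Omega r1 r2 f g) (Wfun r1 r2 f g) (\<phi> u) \<and> Xt u = A (Xtilde r1 r2 c f g (\<phi> u))"
  shows "flat_surface D Xt \<and> ribaucour_associated r1 r2 c D Xt"
proof -
  obtain \<sigma>1 \<alpha>1 \<sigma>2 \<alpha>2 where \<sigma>: "\<sigma>1\<^sup>2 = 1" "\<sigma>2\<^sup>2 = 1" and \<phi>: "\<phi> = affine_coords \<sigma>1 \<alpha>1 \<sigma>2 \<alpha>2"
    using torus_symmetryE[OF sym] by blast
  obtain f' g' where "ribaucour_profile r1 r2 c f g f' g'" using flat_family_profile[OF c fam] by blast
  then interpret R: ribaucour_profile r1 r2 c f g f' g' .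
  interpret S: ribaucour_profile r1 r2 c "\<lambda>s. 1 * f (\<sigma>1 * s + \<alpha>1)" "\<lambda>t. 1 * g (\<sigma>2 * t + \<alpha>2)"
    "\<lambda>s. 1 * (\<sigma>1 * f' (\<sigma>1 * s + \<alpha>1))" "\<lambda>t. 1 * (\<sigma>2 * g' (\<sigma>2 * t + \<alpha>2))"
    by (rule R.rescaled_profile[OF \<sigma>])
  have one: "(1::real) \<noteq> 0" by simp
  have "u \<in> S.V" "nondegenerate_at r1 r2 S.Om S.W u" "Xt u = S.XT u" if u: "u \<in> D" for u
  proof -
    show "u \<in> S.V" using X[OF u] Vset_rescaled[OF one] unfolding \<phi> by blast
    show "nondegenerate_at r1 r2 S.Om S.W u" using X[OF u] nondegenerate_rescaled[OF one] unfolding \<phi> by blast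
    have "R.Q (\<phi> u) \<noteq> 0" using X[OF u] R.V_iff by blast
    then show "Xt u = S.XT u"
      using X[OF u] R.XT_symmetry[OF sym[unfolded \<phi>] \<sigma> one] unfolding \<phi> by simp
  qed
  then show ?thesis using S.flat_surface_XT[OF D] S.ribaucour_associated_XT[OF D] by blast
qed

lemma family_properties:
  assumes c: "c > 0" and fam: "flat_family r1 r2 c f g"
  shows "flat_surface (Vset r1 r2 f g) (Xtilde r1 r2 c f g) \<and>
    ribaucour_associated r1 r2 c
      {u \<in> Vset r1 r2 f g. nondegenerate_at r1 r2 (Omega r1 r2 f g) (Wfun r1 r2 f g) u}
      (Xtilde r1 r2 c f g) \<and>
    normal_map (Vset r1 r2 f g) (Xtilde r1 r2 c f g) (Ntilde r1 r2 c f g)"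
proof -
  obtain f' g' where "ribaucour_profile r1 r2 c f g f' g'" using flat_family_profile[OF c fam] by blast
  then interpret R: ribaucour_profile r1 r2 c f g f' g' .
  have "open {u \<in> R.V. nondegenerate_at r1 r2 R.Om R.W u}"
    using open_Int[OF R.open_V R.open_nondegenerate] by (simp add: Int_def)
  then show ?thesis
    using R.flat_surface_XT[OF R.open_V] R.ribaucour_associated_XT R.normal_map_NT by auto
qed

end

theorem theorem3p1:
  fixes r1 r2 c :: real and D :: "(real \<times> real) set" and Xt :: "real \<times> real \<Rightarrow> real^4"
  assumes "r1 > 0" "r2 > 0" "r1\<^sup>2 + r2\<^sup>2 = 1" "c > 0"
    and "open D" "connected D"
  shows "((flat_surface D Xt \<and> ribaucour_associated r1 r2 c D Xt) \<longleftrightarrow>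
         (\<exists>f g A \<phi>. flat_family r1 r2 c f g \<and> torus_symmetry r1 r2 A \<phi> \<and>
            (\<forall>u\<in>D. \<phi> u \<in> Vset r1 r2 f g \<and>
                    nondegenerate_at r1 r2 (Omega r1 r2 f g) (Wfun r1 r2 f g) (\<phi> u) \<and>
                    Xt u = A (Xtilde r1 r2 c f g (\<phi> u)))))
       \<and> (\<forall>f g. flat_family r1 r2 c f g \<longrightarrow>
            flat_surface (Vset r1 r2 f g) (Xtilde r1 r2 c f g) \<and>
            ribaucour_associated r1 r2 c
              {u \<in> Vset r1 r2 f g. nondegenerate_at r1 r2 (Omega r1 r2 f g) (Wfun r1 r2 f g) u}
              (Xtilde r1 r2 c f g) \<and>
            normal_map (Vset r1 r2 f g) (Xtilde r1 r2 c f g) (Ntilde r1 r2 c f g))"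
proof -
  interpret torus_radii r1 r2 by unfold_locales (use assms in auto)
  show ?thesis (is "(?flat \<longleftrightarrow> ?family) \<and> ?props")
  proof (intro conjI iffI)
    assume ?flat
    then show ?family using flat_ribaucour_imp_family[OF assms(4-6)] by blast
  next
    assume ?family
    then obtain f g A \<phi> where *: "flat_family r1 r2 c f g" "torus_symmetry r1 r2 A \<phi>"
      "\<And>u. u \<in> D \<Longrightarrow> \<phi> u \<in> Vset r1 r2 f g \<and>
        nondegenerate_at r1 r2 (Omega r1 r2 f g) (Wfun r1 r2 f g) (\<phi> u) \<and> Xt u = A (Xtilde r1 r2 c f g (\<phi> u))"
      by blast
    show "flat_surface D Xt" "ribaucour_associated r1 r2 c D Xt"
      using family_imp_flat_ribaucour[OF assms(4,5) *] by blast+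
  next
    show ?props using family_properties[OF assms(4)] by blast
  qed
qed
end
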